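(* Let $n\ge 1$ and let $T$ be a triangulated $(n+3)$-gon with diagonals labelled $1,\dots,n$ and boundary sides labelled $n+1,\dots,2n+3$, such that the quiver $Q=Q_T$ is acyclic with underlying graph the path $1 - 2 - \cdots - n$. Let $\mathcal{A}(\overline{Q})$ be the cluster algebra with coefficients of the ice quiver $\overline{Q}=\overline{Q}_T$, with initial seed $((x_1,\dots,x_{2n+3}),\overline{Q})$. For $1\le i\le j\le n$ let $f^{[i,j]}\in\mathbb{Z}[x_1,\dots,x_{2n+3}]$ be the numerator of the cluster variable $\frac{f^{[i,j]}}{x_ix_{i+1}\cdots x_j}$ of $\mathcal{A}(\overline{Q})$. Then for all $1\le i\le j\le n$, $$f^{[i,j]}=\sum_{D\in\mathbb{D}(\overline{Q}^{[i,j]})}\ \prod_{\alpha\in D}x_\alpha,$$ where $\mathbb{D}(\overline{Q}^{[i,j]})$ is the set of maximal discrete subsets of the ice quiver $\overline{Q}^{[i,j]}$ and $x_\alpha$ is the element of $\{x_1,\dots,x_{2n+3}\}$ indexed by the third side of the triangle of $T$ having sides $s(\alpha)$ and $t(\alpha)$.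
   Context: Quivers from triangulations. Let $T$ be a triangulated (convex, planar) $(n+3)$-gon, with $n$ diagonals $1,\dots,n$ and boundary sides (boundary arcs) $n+1,\dots,2n+3$. The quiver $Q_T$ has vertices $1,\dots,n$ and an arrow $i\to j$ whenever the diagonals $i,j$ are sides of a common triangle of $T$ and $j$ follows $i$ in the clockwise order on the boundary of that triangle. The ice quiver $\overline{Q}_T$ is obtained from $Q_T$ by adding a vertex for each boundary arc and adding, by the same rule, the arrows between diagonals and boundary arcs lying in a common triangle (no arrows between two boundary arcs). The frozen vertices are the boundary arcs. For an arrow $\alpha$, $s(\alpha)$ and $t(\alpha)$ are its source and target. Cluster algebra. A seed is a pair $(x,R)$ where $R$ is a quiver on $\{1,\dots,m\}$ without loops and $2$-cycles, with no arrows between the frozen vertices $n+1,\dots,m$, and $x=(x_1,\dots,x_m)$ is a free generating set of the field $\mathbb{Q}(t_1,\dots,t_m)$ over $\mathbb{Q}$. Mutation at $k\in\{1,\dots,n\}$ gives $(x',R')$: $R'$ is obtained by adding an arrow $i\to j$ for each path $i\to k\to j$, reversing all arrows at $k$, removing a maximal set of disjoint $2$-cycles, and removing all arrows between frozen vertices; $x'_i=x_i$ for $i\ne k$ and $x_kx'_k=\prod_{(j\to k)\in R_1}x_j+\prod_{(k\to j)\in R_1}x_j$. The cluster variables are the elements $x_1,\dots,x_n$ of all seeds obtained from the initial seed by sequences of mutations; the coefficients are $x_{n+1},\dots,x_m$. $\mathcal{A}$ is the $\mathbb{Z}$-subalgebra generated by all cluster variables and coefficients. Here $m=2n+3$. Known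 fact used as definition of $f^{[i,j]}$: the non-initial cluster variables of $\mathcal{A}(\overline{Q})$ are indexed by pairs $1\le i\le j\le n$, the pair $(i,j)$ corresponding to the unique cluster variable of the form $f^{[i,j]}/(x_ix_{i+1}\cdots x_j)$ with $f^{[i,j]}\in\mathbb{Z}[x_1,\dots,x_{2n+3}]$ not divisible by any of $x_1,\dots,x_n$. Subpolygon. $T^{[i,j]}$ is the triangulated subpolygon of $T$ whose set of diagonals is $\{i,i+1,\dots,j\}$, i.e. the union of the triangles of $T$ having at least one side in $\{i,\dots,j\}$; its sides keep their labels from $T$. $\overline{Q}^{[i,j]}$ is the ice quiver $\overline{Q}_{T^{[i,j]}}$ obtained from $T^{[i,j]}$ by the construction above; its frozen vertices are the boundary sides of $T^{[i,j]}$ (some of which may be diagonals of $T$). Discrete subsets. Let $R$ be an ice quiver and $R'$ its full subquiver on the non-frozen vertices. A set $D$ of arrows of $R$ is discrete if for any $\alpha,\beta\in D$ there is no path in $R'$ from $t(\alpha)$ to $s(\beta)$. Paths of length $0$ (at non-frozen vertices) count as paths; a path in $R'$ has non-frozen endpoints. $\mathbb{D}(R)$ is the set of discrete subsets of $R_1$ that are maximal with respect to inclusion. *)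

theory Defs
  imports
    "HOL-Library.Poly_Mapping"
    "HOL-Computational_Algebra.Fraction_Field"
    "Graph_Theory.Digraph_Component"
begin

section \<open>Polynomials and rational functions in \<open>x\<^sub>0, x\<^sub>1, \<dots>\<close>\<close>

type_synonym 'c mpoly = "(nat \<Rightarrow>\<^sub>0 nat) \<Rightarrow>\<^sub>0 'c"

definition Var :: "nat \<Rightarrow> 'c::zero_neq_one mpoly" where
  "Var i = Poly_Mapping.single (Poly_Mapping.single i 1) 1"

definition polys_in :: "nat set \<Rightarrow> 'c::zero mpoly set" where
  "polys_in V = {p. \<forall>\<mu> \<in> Poly_Mapping.keys p. Poly_Mapping.keys \<mu> \<subseteq> V}"

text \<open>Evaluation at \<open>x\<close>, where \<open>\<phi>\<close> maps the coefficients into the target ring.\<close>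

definition peval :: "('c::zero \<Rightarrow> 'a::comm_semiring_1) \<Rightarrow> (nat \<Rightarrow> 'a) \<Rightarrow> 'c mpoly \<Rightarrow> 'a" where
  "peval \<phi> x p = (\<Sum>\<mu> \<in> Poly_Mapping.keys p. \<phi> (Poly_Mapping.lookup p \<mu>) *
      (\<Prod>k \<in> Poly_Mapping.keys \<mu>. x k ^ Poly_Mapping.lookup \<mu> k))"

type_synonym ratfun = "rat mpoly fract"

definition ratconst :: "rat \<Rightarrow> ratfun" where
  "ratconst c = Fraction_Field.Fract (Poly_Mapping.single 0 c) 1"

definition tvar :: "nat \<Rightarrow> ratfun" where
  "tvar i = Fraction_Field.Fract (Var i) 1"

definition is_subfield :: "'a::field set \<Rightarrow> bool" where
  "is_subfield K \<longleftrightarrow> 1 \<in> K \<and> (\<forall>a \<in> K. \<forall>b \<in> K. a - b \<in> K \<and> a * b \<in> K \<and> inverse a \<in> K)"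

text \<open>The type \<^typ>\<open>ratfun\<close> has infinitely many indeterminates; the field
  \<open>\<rat>(t\<^sub>1,\<dots>,t\<^sub>m)\<close> is the subfield generated by the first \<open>m\<close> of them (the
  rationals are contained in every subfield).\<close>

definition ratfun_field :: "nat \<Rightarrow> ratfun set" where
  "ratfun_field m = is_subfield hull (tvar ` {1..m})"

definition free_generating :: "nat \<Rightarrow> (nat \<Rightarrow> ratfun) \<Rightarrow> bool" where
  "free_generating m x \<longleftrightarrow>
     (\<forall>p \<in> polys_in {1..m}. peval ratconst x p = 0 \<longrightarrow> p = 0) \<and>
     is_subfield hull (x ` {1..m}) = ratfun_field m"


section \<open>Mutation of seeds and cluster variables\<close>

text \<open>In a seed \<open>(x, R)\<close>, the number of arrows from \<open>i\<close> to \<open>j\<close> is \<open>R i j\<close>. Vertices are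
  \<open>1,\<dots>,m\<close>, and \<open>n+1,\<dots>,m\<close> are the frozen ones. Values of \<open>x\<close> and \<open>R\<close> outside
  \<open>{1..m}\<close> play no role.\<close>

type_synonym seed = "(nat \<Rightarrow> ratfun) \<times> (nat \<Rightarrow> nat \<Rightarrow> nat)"

text \<open>Removing a maximal set of disjoint 2-cycles leaves \<open>B i j - B j i\<close> (truncated)
  arrows from \<open>i\<close> to \<open>j\<close>.\<close>

definition mutate_quiver :: "nat \<Rightarrow> nat \<Rightarrow> (nat \<Rightarrow> nat \<Rightarrow> nat) \<Rightarrow> nat \<Rightarrow> nat \<Rightarrow> nat" where
  "mutate_quiver n k R =
    (let A = (\<lambda>i j. R i j + R i k * R k j);
         B = (\<lambda>i j. if i = k \<or> j = k then A j i else A i j);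
         C = (\<lambda>i j. B i j - B j i)
     in (\<lambda>i j. if i > n \<and> j > n then 0 else C i j))"

definition mutate :: "nat \<Rightarrow> nat \<Rightarrow> nat \<Rightarrow> seed \<Rightarrow> seed" where
  "mutate n m k = (\<lambda>(x, R).
     (x(k := ((\<Prod>j = 1..m. x j ^ R j k) + (\<Prod>j = 1..m. x j ^ R k j)) / x k),
      mutate_quiver n k R))"

inductive_set seeds :: "nat \<Rightarrow> nat \<Rightarrow> seed \<Rightarrow> seed set" for n m :: nat and S\<^sub>0 :: seed where
  initial: "S\<^sub>0 \<in> seeds n m S\<^sub>0"
| mutation: "S \<in> seeds n m S\<^sub>0 \<Longrightarrow> k \<in> {1..n} \<Longrightarrow> mutate n m k S \<in> seeds n m S\<^sub>0"

definition cluster_variables :: "nat \<Rightarrow> nat \<Rightarrow> seed \<Rightarrow> ratfun set" where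
  "cluster_variables n m S\<^sub>0 = {x k | x R k. (x, R) \<in> seeds n m S\<^sub>0 \<and> k \<in> {1..n}}"

text \<open>The numerator \<open>f\<^sup>[\<^sup>i\<^sup>,\<^sup>j\<^sup>]\<close>. Non-divisibility by \<open>x\<^sub>1,\<dots>,x\<^sub>n\<close> excludes the initial
  cluster variables. The definite description is meaningful because exactly one cluster
  variable has this denominator.\<close>

definition numerator :: "nat \<Rightarrow> nat \<Rightarrow> seed \<Rightarrow> nat \<Rightarrow> nat \<Rightarrow> int mpoly" where
  "numerator n m S\<^sub>0 i j = (THE f. f \<in> polys_in {1..m} \<and>
     (\<forall>k \<in> {1..n}. \<not> Var k dvd f) \<and>
     peval of_int (fst S\<^sub>0) f / (\<Prod>k = i..j. fst S\<^sub>0 k) \<in> cluster_variables n m S\<^sub>0)"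

definition num_arrows :: "('v, 'e) pre_digraph \<Rightarrow> 'v \<Rightarrow> 'v \<Rightarrow> nat" where
  "num_arrows G i j = card {a \<in> arcs G. tail G a = i \<and> head G a = j}"


section \<open>Triangulated polygons\<close>

text \<open>The vertices of the convex \<open>N\<close>-gon are \<open>0,\<dots>,N-1\<close> in clockwise order; sides and
  diagonals are given by their two end points.\<close>

definition polygon_sides :: "nat \<Rightarrow> nat set set" where
  "polygon_sides N = {{k, Suc k mod N} | k. k < N}"

definition polygon_diagonals :: "nat \<Rightarrow> nat set set" where
  "polygon_diagonals N = {{a, b} | a b. a < b \<and> b < N} - polygon_sides N"

definition crossing :: "nat set \<Rightarrow> nat set \<Rightarrow> bool" where
  "crossing d e \<longleftrightarrow> (\<exists>a b c c'. a < c \<and> c < b \<and> b < c' \<and>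
     (d = {a, b} \<and> e = {c, c'} \<or> e = {a, b} \<and> d = {c, c'}))"

definition noncrossing :: "nat \<Rightarrow> nat set set \<Rightarrow> bool" where
  "noncrossing N T \<longleftrightarrow> T \<subseteq> polygon_diagonals N \<and> (\<forall>d \<in> T. \<forall>e \<in> T. \<not> crossing d e)"

definition triangulation :: "nat \<Rightarrow> nat set set \<Rightarrow> bool" where
  "triangulation N T \<longleftrightarrow> noncrossing N T \<and> (\<forall>T'. noncrossing N T' \<and> T \<subseteq> T' \<longrightarrow> T' = T)"

text \<open>\<open>E l\<close> is the side or diagonal with label \<open>l\<close>.\<close>

definition labelled_triangulation :: "nat \<Rightarrow> (nat \<Rightarrow> nat set) \<Rightarrow> nat set set \<Rightarrow> bool" where
  "labelled_triangulation n E T \<longleftrightarrow> triangulation (n + 3) T \<and>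
     bij_betw E {1..n} T \<and> bij_betw E {n+1..2*n+3} (polygon_sides (n + 3))"

text \<open>A triangle is the triple \<open>(a, b, c)\<close> of its vertices in increasing order, so that
  \<open>a \<rightarrow> b \<rightarrow> c \<rightarrow> a\<close> is the clockwise walk around it. By convexity and maximality, any
  three vertices that are pairwise joined by sides or diagonals of the triangulation span
  one of its triangles.\<close>

definition triangles :: "nat \<Rightarrow> nat set set \<Rightarrow> (nat \<times> nat \<times> nat) set" where
  "triangles N T = {(a, b, c). a < b \<and> b < c \<and> c < N \<and>
     {{a, b}, {b, c}, {c, a}} \<subseteq> T \<union> polygon_sides N}"

definition tri_sides :: "nat \<times> nat \<times> nat \<Rightarrow> nat set set" where
  "tri_sides = (\<lambda>(a, b, c). {{a, b}, {b, c}, {c, a}})"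

definition clockwise :: "nat \<times> nat \<times> nat \<Rightarrow> (nat set \<times> nat set) set" where
  "clockwise = (\<lambda>(a, b, c). {({a, b}, {b, c}), ({b, c}, {c, a}), ({c, a}, {a, b})})"

definition third_side :: "nat \<Rightarrow> (nat \<Rightarrow> nat set) \<Rightarrow> nat set set \<Rightarrow> nat \<Rightarrow> nat \<Rightarrow> nat" where
  "third_side n E T p q = (THE r. r \<in> {1..2*n+3} \<and>
     (\<exists>\<tau> \<in> triangles (n + 3) T. tri_sides \<tau> = {E p, E q, E r}))"


section \<open>Quivers of triangulated polygons\<close>

text \<open>Two sides determine a triangle, so there is at most one arrow from \<open>p\<close> to \<open>q\<close>, which
  we take to be the pair \<open>(p, q)\<close>. The argument \<open>\<Delta>\<close> is the set of triangles of the
  (sub)polygon and \<open>I\<close> is the set of labels of its diagonals.\<close>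

definition follows :: "nat \<Rightarrow> (nat \<Rightarrow> nat set) \<Rightarrow> (nat \<times> nat \<times> nat) set \<Rightarrow> (nat \<times> nat) set" where
  "follows n E \<Delta> = {(p, q). p \<in> {1..2*n+3} \<and> q \<in> {1..2*n+3} \<and>
     (\<exists>\<tau> \<in> \<Delta>. (E p, E q) \<in> clockwise \<tau>)}"

definition quiver_of ::
  "nat \<Rightarrow> (nat \<Rightarrow> nat set) \<Rightarrow> (nat \<times> nat \<times> nat) set \<Rightarrow> nat set \<Rightarrow> (nat, nat \<times> nat) pre_digraph" where
  "quiver_of n E \<Delta> I = \<lparr> verts = I,
     arcs = {(p, q) \<in> follows n E \<Delta>. p \<in> I \<and> q \<in> I}, tail = fst, head = snd \<rparr>"

definition ice_quiver_of ::
  "nat \<Rightarrow> (nat \<Rightarrow> nat set) \<Rightarrow> (nat \<times> nat \<times> nat) set \<Rightarrow> nat set \<Rightarrow> (nat, nat \<times> nat) pre_digraph" where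
  "ice_quiver_of n E \<Delta> I = \<lparr> verts = {l \<in> {1..2*n+3}. E l \<in> \<Union> (tri_sides ` \<Delta>)},
     arcs = {(p, q) \<in> follows n E \<Delta>. p \<in> I \<or> q \<in> I}, tail = fst, head = snd \<rparr>"

definition Q_T :: "nat \<Rightarrow> (nat \<Rightarrow> nat set) \<Rightarrow> nat set set \<Rightarrow> (nat, nat \<times> nat) pre_digraph" where
  "Q_T n E T = quiver_of n E (triangles (n + 3) T) {1..n}"

definition Qbar_T :: "nat \<Rightarrow> (nat \<Rightarrow> nat set) \<Rightarrow> nat set set \<Rightarrow> (nat, nat \<times> nat) pre_digraph" where
  "Qbar_T n E T = ice_quiver_of n E (triangles (n + 3) T) {1..n}"

definition subpolygon ::
  "nat \<Rightarrow> (nat \<Rightarrow> nat set) \<Rightarrow> nat set set \<Rightarrow> nat \<Rightarrow> nat \<Rightarrow> (nat \<times> nat \<times> nat) set" where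
  "subpolygon n E T i j = {\<tau> \<in> triangles (n + 3) T. tri_sides \<tau> \<inter> E ` {i..j} \<noteq> {}}"

definition Qbar_sub ::
  "nat \<Rightarrow> (nat \<Rightarrow> nat set) \<Rightarrow> nat set set \<Rightarrow> nat \<Rightarrow> nat \<Rightarrow> (nat, nat \<times> nat) pre_digraph" where
  "Qbar_sub n E T i j = ice_quiver_of n E (subpolygon n E T i j) {i..j}"

definition acyclic_quiver :: "('v, 'e) pre_digraph \<Rightarrow> bool" where
  "acyclic_quiver G \<longleftrightarrow> acyclic (arcs_ends G)"

definition underlying_path :: "nat \<Rightarrow> (nat, 'e) pre_digraph \<Rightarrow> bool" where
  "underlying_path n G \<longleftrightarrow> verts G = {1..n} \<and>
     (\<forall>i \<in> {1..n}. \<forall>j \<in> {1..n}.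
        num_arrows G i j + num_arrows G j i = (if j = Suc i \<or> i = Suc j then 1 else 0))"


section \<open>Discrete sets of arrows\<close>

text \<open>\<open>I\<close> is the set of non-frozen vertices. \<^const>\<open>reachable\<close> admits paths of length 0,
  but only at vertices of the given graph, here \<open>R \<restriction> I\<close>.\<close>

definition discrete :: "('v, 'e) pre_digraph \<Rightarrow> 'v set \<Rightarrow> 'e set \<Rightarrow> bool" where
  "discrete R I D \<longleftrightarrow> D \<subseteq> arcs R \<and>
     (\<forall>\<alpha> \<in> D. \<forall>\<beta> \<in> D. \<not> reachable (R \<restriction> I) (head R \<alpha>) (tail R \<beta>))"

definition max_discrete :: "('v, 'e) pre_digraph \<Rightarrow> 'v set \<Rightarrow> 'e set set" where
  "max_discrete R I = {D. discrete R I D \<and> (\<forall>D'. discrete R I D' \<and> D \<subseteq> D' \<longrightarrow> D' = D)}"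

end

theory Submission
  imports Defs
begin

text \<open>Map the polygon's vertices to vectors in the plane over the field of rational functions so
  that the determinants of the pairs joined by edges of the triangulation are the given variables.
  Then the determinant of every pair of vertices satisfies the Ptolemy relations, mutations are
  flips, and the cluster variables are exactly the determinants of the diagonals. In the strip of
  triangles crossed by a diagonal, the Ptolemy relations become a recursion with two states, one
  for each end of the current diagonal of the strip.

  A maximal discrete set is determined by the set \<open>U\<close> of vertices reachable from the heads of its
  arrows, which can be any subset of the diagonals that is closed under successors, and it has
  exactly one arrow in every triangle. Reading \<open>U\<close> along the path gives the same two-state
  recursion. As none of \<open>x\<^sub>1, \<dots>, x\<^sub>n\<close> divides the resulting polynomials, the denominators separate
  the cluster variables, and a count of the diagonals shows that none is missing.\<close>

section \<open>Evaluation of integer polynomials\<close>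

text \<open>The vectors are fixed once, before any mutation. The chords of all pairs of vertices
  then exist at the same time and a seed only selects some of them, so no sequence of mutations has
  to be computed. The obstacle is division: an exchange relation yields the new variable only where
  the old one is nonzero, and determinants are prescribed only on the edges of \<open>T\<close>.
  Hence the chord of every other diagonal is first written as a nonzero polynomial over a squarefree
  monomial, and only then are the cluster variables identified. The same formula replaces geometry
  in showing that \<open>{p i, q j}\<close> is a diagonal outside \<open>T\<close>. The two
  recursions agree because a diagonal \<open>k\<close> outside of \<open>U\<close> plays the role of
  its end \<open>l k\<close>, and a diagonal in \<open>U\<close> that of its end \<open>r k\<close>.
  Since the numerator is a definite description, both directions are needed: every seed comes from a
  triangulation, and every diagonal occurs in one that can be reached.\<close>

definition monom_eval :: "(nat \<Rightarrow> 'a) \<Rightarrow> (nat \<Rightarrow>\<^sub>0 nat) \<Rightarrow> 'a::comm_semiring_1" where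
  "monom_eval z \<mu> = (\<Prod>k \<in> Poly_Mapping.keys \<mu>. z k ^ Poly_Mapping.lookup \<mu> k)"

lemma monom_eval_superset:
  assumes "finite V" "Poly_Mapping.keys \<mu> \<subseteq> V"
  shows "monom_eval z \<mu> = (\<Prod>k \<in> V. z k ^ Poly_Mapping.lookup \<mu> k)"
  unfolding monom_eval_def using assms
  by (intro prod.mono_neutral_left) (auto simp: in_keys_iff)

lemma monom_eval_zero [simp]: "monom_eval z 0 = 1"
  by (simp add: monom_eval_def)

lemma monom_eval_single [simp]: "monom_eval z (Poly_Mapping.single k (Suc 0)) = z k"
  by (simp add: monom_eval_def)

lemma monom_eval_add: "monom_eval z (\<mu> + \<nu>) = monom_eval z \<mu> * monom_eval z \<nu>"
proof -
  let ?V = "Poly_Mapping.keys \<mu> \<union> Poly_Mapping.keys \<nu>"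
  have "monom_eval z (\<mu> + \<nu>) = (\<Prod>k \<in> ?V. z k ^ Poly_Mapping.lookup (\<mu> + \<nu>) k)"
    by (rule monom_eval_superset) (simp_all add: keys_add)
  also have "\<dots> = (\<Prod>k \<in> ?V. z k ^ Poly_Mapping.lookup \<mu> k) * (\<Prod>k \<in> ?V. z k ^ Poly_Mapping.lookup \<nu> k)"
    by (simp add: lookup_add power_add prod.distrib)
  also have "\<dots> = monom_eval z \<mu> * monom_eval z \<nu>"
    by (subst (1 2) monom_eval_superset[where V = ?V]) auto
  finally show ?thesis .
qed

context
  fixes z :: "nat \<Rightarrow> 'a::comm_ring_1"
begin

lemma peval_superset:
  assumes "finite A" "Poly_Mapping.keys p \<subseteq> A"
  shows "peval of_int z p = (\<Sum>\<mu> \<in> A. of_int (Poly_Mapping.lookup p \<mu>) * monom_eval z \<mu>)"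
  unfolding peval_def monom_eval_def using assms
  by (intro sum.mono_neutral_left) (auto simp: in_keys_iff)

lemma peval_zero [simp]: "peval of_int z 0 = 0"
  by (simp add: peval_def)

lemma peval_add: "peval of_int z (p + q) = peval of_int z p + peval of_int z q"
proof -
  let ?V = "Poly_Mapping.keys p \<union> Poly_Mapping.keys q"
  have "peval of_int z (p + q) = (\<Sum>\<mu> \<in> ?V. of_int (Poly_Mapping.lookup (p + q) \<mu>) * monom_eval z \<mu>)"
    by (rule peval_superset) (simp_all add: keys_add)
  then show ?thesis
    by (subst (1 2) peval_superset[where A = ?V])
      (auto simp: lookup_add ring_distribs sum.distrib)
qed

lemma peval_sum: "peval of_int z (\<Sum>a\<in>A. p a) = (\<Sum>a\<in>A. peval of_int z (p a))"
  by (induction A rule: infinite_finite_induct) (auto simp: peval_add)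

lemma peval_single: "peval of_int z (Poly_Mapping.single \<mu> c) = of_int c * monom_eval z \<mu>"
  by (subst peval_superset[where A = "{\<mu>}"]) auto

lemma peval_one [simp]: "peval of_int z 1 = 1"
  using peval_single[of 0 1] by simp

lemma peval_Var [simp]: "peval of_int z (Var k) = z k"
  using peval_single[of "Poly_Mapping.single k 1" 1] by (simp add: Var_def)

end

text \<open>Splitting into monomials reduces multiplicativity of \<open>peval\<close> and
  divisibility by a variable to single terms.\<close>

lemma poly_mapping_sum_single:
  "p = (\<Sum>\<mu>\<in>Poly_Mapping.keys p. Poly_Mapping.single \<mu> (Poly_Mapping.lookup p \<mu>))"
proof (rule poly_mapping_eqI)
  fix \<nu>
  have "Poly_Mapping.lookup (\<Sum>\<mu>\<in>Poly_Mapping.keys p. Poly_Mapping.single \<mu> (Poly_Mapping.lookup p \<mu>)) \<nu>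
      = (\<Sum>\<mu>\<in>Poly_Mapping.keys p. if \<mu> = \<nu> then Poly_Mapping.lookup p \<mu> else 0)"
    by (simp add: lookup_sum lookup_single when_def)
  also have "\<dots> = Poly_Mapping.lookup p \<nu>"
    by (simp add: in_keys_iff)
  finally show "Poly_Mapping.lookup p \<nu> = Poly_Mapping.lookup (\<Sum>\<mu>\<in>Poly_Mapping.keys p.
      Poly_Mapping.single \<mu> (Poly_Mapping.lookup p \<mu>)) \<nu>" by simp
qed

lemma peval_mult:
  fixes z :: "nat \<Rightarrow> 'a::comm_ring_1"
  shows "peval of_int z (p * q) = peval of_int z p * peval of_int z q"
proof -
  let ?s = "\<lambda>p. (\<Sum>\<mu>\<in>Poly_Mapping.keys p. Poly_Mapping.single \<mu> (Poly_Mapping.lookup p \<mu>))"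
  have "peval of_int z (p * q) = peval of_int z (?s p * ?s q)"
    using poly_mapping_sum_single[of p] poly_mapping_sum_single[of q] by simp
  also have "\<dots> = (\<Sum>\<mu>\<in>Poly_Mapping.keys p. \<Sum>\<nu>\<in>Poly_Mapping.keys q.
      (of_int (Poly_Mapping.lookup p \<mu>) * monom_eval z \<mu>) * (of_int (Poly_Mapping.lookup q \<nu>) * monom_eval z \<nu>))"
    by (simp add: sum_product peval_sum mult_single peval_single monom_eval_add mult_ac)
  also have "\<dots> = peval of_int z p * peval of_int z q"
    by (simp add: sum_product peval_def monom_eval_def)
  finally show ?thesis .
qed

lemma peval_prod:
  fixes z :: "nat \<Rightarrow> 'a::comm_ring_1"
  shows "peval of_int z (\<Prod>a\<in>A. p a) = (\<Prod>a\<in>A. peval of_int z (p a))"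
  by (induction A rule: infinite_finite_induct) (auto simp: peval_mult)

section \<open>Polynomials in a prescribed set of variables\<close>

lemma polys_in_one [simp]: "1 \<in> polys_in V"
  by (auto simp: polys_in_def)

lemma polys_in_Var [simp]: "k \<in> V \<Longrightarrow> Var k \<in> polys_in V"
  by (auto simp: polys_in_def Var_def)

lemma polys_in_add: "p \<in> polys_in V \<Longrightarrow> q \<in> polys_in V \<Longrightarrow> p + q \<in> polys_in V"
  unfolding polys_in_def using keys_add[of p q] by blast

lemma polys_in_mult:
  assumes "p \<in> polys_in V" "q \<in> polys_in V"
  shows "p * q \<in> polys_in V"
  unfolding polys_in_def
proof safe
  fix \<mu> k assume "\<mu> \<in> Poly_Mapping.keys (p * q)" and k: "k \<in> Poly_Mapping.keys \<mu>"
  then obtain \<alpha> \<beta> where "\<alpha> \<in> Poly_Mapping.keys p" "\<beta> \<in> Poly_Mapping.keys q" "\<mu> = \<alpha> + \<beta>"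
    using keys_mult[of p q] by blast
  then show "k \<in> V"
    using assms k keys_add[of \<alpha> \<beta>] unfolding polys_in_def by blast
qed

lemma polys_in_prod: "(\<And>a. a \<in> A \<Longrightarrow> p a \<in> polys_in V) \<Longrightarrow> (\<Prod>a\<in>A. p a) \<in> polys_in V"
  by (induction A rule: infinite_finite_induct) (auto intro: polys_in_mult)

lemma polys_in_diff:
  fixes p q :: "'c::ab_group_add mpoly"
  assumes "p \<in> polys_in V" "q \<in> polys_in V"
  shows "p - q \<in> polys_in V"
proof -
  have "Poly_Mapping.keys (p - q) \<subseteq> Poly_Mapping.keys p \<union> Poly_Mapping.keys q"
    by (auto simp: in_keys_iff lookup_minus)
  with assms show ?thesis
    unfolding polys_in_def by blast
qed

text \<open>Freeness is expressed with \<open>ratconst\<close>, the numerators with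
  \<open>of_int\<close>; this identity links the two.\<close>

lemma ratconst_of_int: "ratconst (of_int c) = of_int c"
proof -
  have "(of_int c :: ratfun) = Fraction_Field.Fract (of_int c) 1"
  proof (cases c rule: int_diff_cases)
    case (diff k l)
    have "(of_int c :: ratfun) = of_nat k - of_nat l"
      by (simp add: diff)
    also have "\<dots> = Fraction_Field.Fract (of_int c) 1"
      by (simp add: of_nat_fract diff)
    finally show ?thesis .
  qed
  then show ?thesis
    by (simp add: ratconst_def)
qed

lemma lookup_map_of_int:
  "Poly_Mapping.lookup (Poly_Mapping.map of_int p) \<mu> = (of_int (Poly_Mapping.lookup p \<mu>) :: rat)"
  by (simp add: map.rep_eq when_def)

text \<open>Algebraic independence is stated over the rationals. No nonzero integer becomes zero
  there, so an integer polynomial keeps its monomials when it is read as a rational one.\<close>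

lemma peval_eq_0_iff:
  assumes free: "free_generating m x" and p: "p \<in> polys_in {1..m}"
  shows "peval of_int x p = 0 \<longleftrightarrow> p = 0"
proof
  let ?q = "Poly_Mapping.map of_int p :: rat mpoly"
  assume 0: "peval of_int x p = 0"
  have keys: "Poly_Mapping.keys ?q = Poly_Mapping.keys p"
    by (auto simp: in_keys_iff lookup_map_of_int)
  have "peval ratconst x ?q = peval of_int x p"
    unfolding peval_def keys lookup_map_of_int ratconst_of_int ..
  with 0 have "?q = 0"
    using free p unfolding free_generating_def by (auto simp: polys_in_def keys)
  then show "p = 0"
    using keys by (metis keys_eq_empty keys_zero)
qed simp

lemma peval_inj:
  assumes "free_generating m x" "p \<in> polys_in {1..m}" "q \<in> polys_in {1..m}"
    and "peval of_int x p = peval of_int x q"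
  shows "p = (q :: int mpoly)"
proof -
  have "peval of_int x p = peval of_int x (p - q) + peval of_int x q"
    by (simp flip: peval_add)
  with assms show ?thesis
    using peval_eq_0_iff[OF assms(1) polys_in_diff[OF assms(2,3)]] by simp
qed

section \<open>Divisibility by a single variable\<close>

lemma Var_neq_0 [simp]: "Var k \<noteq> (0 :: int mpoly)"
  using keys_single[of "Poly_Mapping.single k 1" "1::int"] unfolding Var_def by fastforce

lemma lookup_Var_mult:
  "Poly_Mapping.lookup (Var k * p) (\<mu> + Poly_Mapping.single k (Suc 0)) = Poly_Mapping.lookup p (\<mu> :: nat \<Rightarrow>\<^sub>0 nat)"
  for p :: "int mpoly"
proof -
  have "Var k * p = (\<Sum>\<nu>\<in>Poly_Mapping.keys p.
      Poly_Mapping.single (\<nu> + Poly_Mapping.single k (Suc 0)) (Poly_Mapping.lookup p \<nu>))"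
    by (subst poly_mapping_sum_single[of p])
      (simp add: sum_distrib_left Var_def mult_single add.commute)
  also have "Poly_Mapping.lookup \<dots> (\<mu> + Poly_Mapping.single k (Suc 0)) =
      (\<Sum>\<nu>\<in>Poly_Mapping.keys p. if \<nu> = \<mu> then Poly_Mapping.lookup p \<nu> else 0)"
    by (simp add: lookup_sum lookup_single when_def)
  also have "\<dots> = Poly_Mapping.lookup p \<mu>"
    by (simp add: in_keys_iff)
  finally show ?thesis .
qed

text \<open>Multiplication by a variable only shifts exponents, so monomials cannot interfere with
  each other. This criterion does the work of primality of \<open>Var k\<close> in the lemmas
  below.\<close>

lemma Var_dvd_iff:
  fixes p :: "int mpoly"
  shows "Var k dvd p \<longleftrightarrow> (\<forall>\<mu> \<in> Poly_Mapping.keys p. k \<in> Poly_Mapping.keys \<mu>)"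
proof
  assume "Var k dvd p"
  then obtain q where p: "p = Var k * q" ..
  show "\<forall>\<mu> \<in> Poly_Mapping.keys p. k \<in> Poly_Mapping.keys \<mu>"
  proof
    fix \<mu> assume "\<mu> \<in> Poly_Mapping.keys p"
    then obtain \<nu> where "\<mu> = Poly_Mapping.single k 1 + \<nu>"
      using keys_mult[of "Var k" q] unfolding p Var_def by auto
    then show "k \<in> Poly_Mapping.keys \<mu>"
      by (simp add: in_keys_iff lookup_add)
  qed
next
  assume *: "\<forall>\<mu> \<in> Poly_Mapping.keys p. k \<in> Poly_Mapping.keys \<mu>"
  have "Var k dvd (\<Sum>\<mu>\<in>Poly_Mapping.keys p. Poly_Mapping.single \<mu> (Poly_Mapping.lookup p \<mu>))"
  proof (rule dvd_sum)
    fix \<mu> assume "\<mu> \<in> Poly_Mapping.keys p"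
    then have "Poly_Mapping.lookup \<mu> k \<noteq> 0"
      using * by (auto simp: in_keys_iff)
    \<comment> \<open>The truncated subtraction of exponents is exact because the exponent of
      \<open>k\<close> is positive.\<close>
    then have "\<mu> = Poly_Mapping.single k 1 + (\<mu> - Poly_Mapping.single k 1)"
      by (intro poly_mapping_eqI) (auto simp: lookup_add lookup_minus lookup_single when_def)
    then have "Poly_Mapping.single \<mu> (Poly_Mapping.lookup p \<mu>) =
        Var k * Poly_Mapping.single (\<mu> - Poly_Mapping.single k 1) (Poly_Mapping.lookup p \<mu>)"
      unfolding Var_def mult_single by simp
    then show "Var k dvd Poly_Mapping.single \<mu> (Poly_Mapping.lookup p \<mu>)" ..
  qed
  then show "Var k dvd p"
    using poly_mapping_sum_single[of p] by simp
qed

lemma Var_dvd_Var_mult: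
  fixes p :: "int mpoly"
  assumes "Var k dvd Var l * p" "k \<noteq> l"
  shows "Var k dvd p"
  unfolding Var_dvd_iff
proof
  fix \<mu> assume "\<mu> \<in> Poly_Mapping.keys p"
  then have "\<mu> + Poly_Mapping.single l 1 \<in> Poly_Mapping.keys (Var l * p)"
    by (simp add: in_keys_iff lookup_Var_mult)
  then have "k \<in> Poly_Mapping.keys (\<mu> + Poly_Mapping.single l 1)"
    using assms(1) unfolding Var_dvd_iff by blast
  with \<open>k \<noteq> l\<close> show "k \<in> Poly_Mapping.keys \<mu>"
    by (auto simp: in_keys_iff lookup_add lookup_single)
qed

lemma Var_dvd_prod_Var_mult:
  fixes p :: "int mpoly"
  assumes "Var k dvd (\<Prod>l\<in>A. Var l) * p" "k \<notin> A"
  shows "Var k dvd p"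
  using assms
  by (induction A rule: infinite_finite_induct) (auto simp: mult.assoc dest: Var_dvd_Var_mult)

text \<open>The equation compares \<open>p\<close> over the product of \<open>B\<close> with
  \<open>q\<close> over the product of \<open>A\<close>. A variable in only one of the products
  would have to divide the numerator standing over it.\<close>

lemma prod_Var_cancel:
  fixes p q :: "int mpoly"
  assumes eq: "p * (\<Prod>k\<in>A. Var k) = q * (\<Prod>k\<in>B. Var k)" and fin: "finite A" "finite B"
    and p: "\<And>k. k \<in> B \<Longrightarrow> \<not> Var k dvd p" and q: "\<And>k. k \<in> A \<Longrightarrow> \<not> Var k dvd q"
  shows "A = B" "p = q"
proof -
  have "k \<in> B" if "k \<in> A" for k
  proof (rule ccontr)
    assume "k \<notin> B"
    have "Var k dvd p * (\<Prod>k\<in>A. Var k)"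
      using that fin by (simp add: dvd_prodI)
    then show False
      using Var_dvd_prod_Var_mult[of k B q] \<open>k \<notin> B\<close> q[OF that] by (simp add: eq mult.commute)
  qed
  moreover have "k \<in> A" if "k \<in> B" for k
  proof (rule ccontr)
    assume "k \<notin> A"
    have "Var k dvd q * (\<Prod>k\<in>B. Var k)"
      using that fin by (simp add: dvd_prodI)
    then show False
      using Var_dvd_prod_Var_mult[of k A p] \<open>k \<notin> A\<close> p[OF that] by (simp add: eq[symmetric] mult.commute)
  qed
  ultimately show "A = B" by blast
  with eq fin show "p = q" by (auto simp: prod_zero_iff)
qed

section \<open>Maximal discrete sets along a path\<close>

text \<open>Along the path, diagonal \<open>k\<close> lies in a triangle towards \<open>k - 1\<close> with other sides
  \<open>lo k\<close> and \<open>li k\<close>, and in a triangle towards \<open>k + 1\<close> with other sides \<open>ro k\<close> and \<open>ri k\<close>.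
  The arrows at \<open>k\<close> are \<open>k \<rightarrow> lo k\<close>, \<open>li k \<rightarrow> k\<close>, \<open>k \<rightarrow> ro k\<close> and \<open>ri k \<rightarrow> k\<close>.\<close>

locale path_labels =
  fixes n :: nat and lo li ro ri :: "nat \<Rightarrow> nat"
  assumes distinct_sides: "k \<in> {1..n} \<Longrightarrow> distinct [lo k, li k, ro k, ri k]"
    and step: "1 \<le> k \<Longrightarrow> k < n \<Longrightarrow>
      ro k = Suc k \<and> ri k > n \<and> lo (Suc k) = ri k \<and> li (Suc k) = k \<or>
      ri k = Suc k \<and> ro k > n \<and> li (Suc k) = ro k \<and> lo (Suc k) = k"
    and first: "lo 1 > n" "li 1 > n"
    and last: "ro n > n" "ri n > n"
begin

lemma left_cases:
  assumes "1 \<le> k" "k \<le> n"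
  obtains "k = 1" "lo k > n" "li k > n"
  | m where "k = Suc m" "1 \<le> m" "m < n" "ro m = k" "ri m > n" "lo k = ri m" "li k = m"
  | m where "k = Suc m" "1 \<le> m" "m < n" "ri m = k" "ro m > n" "li k = ro m" "lo k = m"
proof (cases "k = 1")
  case True
  then show ?thesis using that(1) first by auto
next
  case False
  then obtain m where "k = Suc m" "1 \<le> m" "m < n"
    using assms by (metis One_nat_def Suc_le_lessD Suc_le_mono le_antisym not0_implies_Suc not_less_eq_eq le_zero_eq)
  then show ?thesis using step[of m] that(2,3) by auto
qed

lemma right_cases:
  assumes "1 \<le> k" "k \<le> n"
  obtains "k = n" "ro k > n" "ri k > n"
  | "k < n" "ro k = Suc k" "ri k > n" "lo (Suc k) = ri k" "li (Suc k) = k"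
  | "k < n" "ri k = Suc k" "ro k > n" "li (Suc k) = ro k" "lo (Suc k) = k"
proof (cases "k = n")
  case True
  then show ?thesis using that(1) last by auto
next
  case False
  then show ?thesis using step[of k] assms that(2,3) by auto
qed

text \<open>A label up to \<open>n\<close> belongs to a diagonal, and the only further diagonal
  possible in the triangle towards \<open>k - 1\<close> is \<open>k - 1\<close> itself.\<close>

lemma lo_inner: "1 \<le> k \<Longrightarrow> k \<le> n \<Longrightarrow> lo k \<le> n \<Longrightarrow> Suc (lo k) = k \<and> ri (lo k) = k"
  by (rule left_cases[of k]; (linarith | metis))

lemma li_inner: "1 \<le> k \<Longrightarrow> k \<le> n \<Longrightarrow> li k \<le> n \<Longrightarrow> Suc (li k) = k \<and> ro (li k) = k"
  by (rule left_cases[of k]; (linarith | metis))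

lemma ro_inner: "1 \<le> k \<Longrightarrow> k \<le> n \<Longrightarrow> ro k \<le> n \<Longrightarrow> ro k = Suc k"
  by (rule right_cases[of k]; linarith)

lemma ri_inner: "1 \<le> k \<Longrightarrow> k \<le> n \<Longrightarrow> ri k \<le> n \<Longrightarrow> ri k = Suc k"
  by (rule right_cases[of k]; linarith)

lemma ro_gt: "1 \<le> k \<Longrightarrow> k \<le> n \<Longrightarrow> k < ro k"
  by (rule right_cases[of k]; linarith)

lemma ri_gt: "1 \<le> k \<Longrightarrow> k \<le> n \<Longrightarrow> k < ri k"
  by (rule right_cases[of k]; linarith)

text \<open>An arrow between two neighbouring diagonals occurs twice in this union, once from each
  of its ends.\<close>

definition path_arcs :: "nat \<Rightarrow> nat \<Rightarrow> (nat \<times> nat) set" where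
  "path_arcs i j = (\<Union>k\<in>{i..j}. {(k, lo k), (li k, k), (k, ro k), (ri k, k)})"

text \<open>These are the sets closed under the arrows of the non-frozen subquiver. Such arrows join
  only \<open>k\<close> and \<open>Suc k\<close>, and \<open>ro k = Suc k\<close> or
  \<open>ri k = Suc k\<close> tells their direction.\<close>

definition up_sets :: "nat \<Rightarrow> nat \<Rightarrow> nat set set" where
  "up_sets i j = {U. U \<subseteq> {i..j} \<and> (\<forall>k. i \<le> k \<and> k < j \<longrightarrow>
     (ro k = Suc k \<longrightarrow> k \<in> U \<longrightarrow> Suc k \<in> U) \<and> (ri k = Suc k \<longrightarrow> Suc k \<in> U \<longrightarrow> k \<in> U))}"

text \<open>A frozen tail counts as outside of \<open>U\<close> and a frozen head as inside, because
  no path of the non-frozen subquiver meets a frozen vertex.\<close>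

definition cut_arcs :: "nat \<Rightarrow> nat \<Rightarrow> nat set \<Rightarrow> (nat \<times> nat) set" where
  "cut_arcs i j U = {(p, q) \<in> path_arcs i j. p \<notin> U \<and> (q \<in> {i..j} \<longrightarrow> q \<in> U)}"

context
  fixes i j :: nat
  assumes ij: "1 \<le> i" "i \<le> j" "j \<le> n"
begin

lemma up_setsD:
  assumes "U \<in> up_sets i j" "(p, q) \<in> path_arcs i j" "p \<in> U" "q \<in> {i..j}"
  shows "q \<in> U"
proof -
  have "p \<in> {i..j}" using assms by (auto simp: up_sets_def)
  then have p: "1 \<le> p" "p \<le> n" and q: "1 \<le> q" "q \<le> n" using assms(4) ij by auto
  have up: "ro k = Suc k \<Longrightarrow> k \<in> U \<Longrightarrow> Suc k \<in> U" "ri k = Suc k \<Longrightarrow> Suc k \<in> U \<Longrightarrow> k \<in> U"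
    if "i \<le> k" "k < j" for k
    using assms(1) that unfolding up_sets_def by blast+
  from assms(2) consider "q = lo p" | "p = li q" | "q = ro p" | "p = ri q"
    unfolding path_arcs_def by auto
  then show ?thesis
  proof cases
    case 1
    then have "Suc q = p" "ri q = p" using lo_inner[OF p] q by auto
    then show ?thesis using up(2)[of q] assms \<open>p \<in> {i..j}\<close> by auto
  next
    case 2
    then have "Suc p = q" "ro p = q" using li_inner[OF q] p by auto
    then show ?thesis using up(1)[of p] assms \<open>p \<in> {i..j}\<close> by auto
  next
    case 3
    then have "ro p = Suc p" "q = Suc p" using ro_inner[OF p] q by auto
    then show ?thesis using up(1)[of p] assms \<open>p \<in> {i..j}\<close> by auto
  next
    case 4
    then have "ri q = Suc q" "p = Suc q" using ri_inner[OF q] p by auto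
    then show ?thesis using up(2)[of q] assms \<open>p \<in> {i..j}\<close> by auto
  qed
qed

lemma up_setsI:
  assumes "U \<subseteq> {i..j}" "\<And>p q. (p, q) \<in> path_arcs i j \<Longrightarrow> p \<in> U \<Longrightarrow> q \<in> {i..j} \<Longrightarrow> q \<in> U"
  shows "U \<in> up_sets i j"
  unfolding up_sets_def
proof (intro CollectI conjI allI impI)
  fix k assume k: "i \<le> k \<and> k < j"
  {
    assume *: "ro k = Suc k" "k \<in> U"
    have "(k, ro k) \<in> path_arcs i j" using k by (auto simp: path_arcs_def)
    then show "Suc k \<in> U" using assms(2)[of k "Suc k"] * k by auto
  next
    assume *: "ri k = Suc k" "Suc k \<in> U"
    have "(ri k, k) \<in> path_arcs i j" using k by (auto simp: path_arcs_def)
    then show "k \<in> U" using assms(2)[of "Suc k" k] * k by auto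
  }
qed (fact assms(1))

text \<open>Assuming only an inclusion gives maximality of the cuts along with injectivity. The set
  is recovered downwards from \<open>j\<close>: whenever closure does not settle \<open>k\<close>
  from the status of \<open>Suc k\<close>, the arrow \<open>(ri k, k)\<close> or
  \<open>(k, ro k)\<close> is in the cut and reveals it.\<close>

lemma cut_arcs_inj:
  assumes U: "U \<in> up_sets i j" and V: "V \<in> up_sets i j" and sub: "cut_arcs i j U \<subseteq> cut_arcs i j V"
  shows "U = V"
proof -
  have "k \<in> U \<longleftrightarrow> k \<in> V" if "k \<in> {i..j}" for k
    using that
  proof (induction "j - k" arbitrary: k)
    case (0 k)
    then have k: "k = j" by simp
    with ij have "ro k \<notin> {i..j}" "ri k \<notin> {i..j}"
      using right_cases[of k] by force+
    moreover have "(k, ro k) \<in> path_arcs i j" "(ri k, k) \<in> path_arcs i j"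
      using 0 unfolding path_arcs_def by auto
    ultimately show ?case using sub U V 0
      unfolding cut_arcs_def up_sets_def by blast
  next
    case (Suc d k)
    then have k: "i \<le> k" "k < j" by auto
    then have IH: "Suc k \<in> U \<longleftrightarrow> Suc k \<in> V" using Suc.hyps(1)[of "Suc k"] Suc.hyps(2) by auto
    have arcs: "(k, ro k) \<in> path_arcs i j" "(ri k, k) \<in> path_arcs i j"
      using k unfolding path_arcs_def by auto
    have *: "ro k \<notin> {i..j} \<or> ro k = Suc k" "ri k \<notin> {i..j} \<or> ri k = Suc k"
      using right_cases[of k] k ij by force+
    show ?case
    proof
      assume "k \<in> U"
      show "k \<in> V"
      proof (cases "ri k = Suc k \<and> Suc k \<in> U")
        case True
        then show ?thesis using IH V k unfolding up_sets_def by blast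
      next
        case False
        then have "(ri k, k) \<in> cut_arcs i j U"
          using \<open>k \<in> U\<close> arcs *(2) U unfolding cut_arcs_def up_sets_def by auto
        then show ?thesis using sub k unfolding cut_arcs_def by auto
      qed
    next
      assume "k \<in> V"
      show "k \<in> U"
      proof (rule ccontr)
        assume "k \<notin> U"
        show False
        proof (cases "ro k = Suc k \<and> Suc k \<notin> U")
          case True
          then show ?thesis using IH V k \<open>k \<in> V\<close> unfolding up_sets_def by blast
        next
          case False
          then have "(k, ro k) \<in> cut_arcs i j U"
            using \<open>k \<notin> U\<close> arcs *(1) U unfolding cut_arcs_def up_sets_def by auto
          then show ?thesis using sub \<open>k \<in> V\<close> unfolding cut_arcs_def by auto
        qed
      qed
    qed
  qed
  then show ?thesis using U V unfolding up_sets_def by blast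
qed

section \<open>Maximal discrete sets as cuts\<close>

context
  fixes G :: "(nat, nat \<times> nat) pre_digraph"
  assumes G: "arcs G = path_arcs i j" "tail G = fst" "head G = snd"
begin

text \<open>A path inside the interval cannot leave the closed set \<open>U\<close>, while every cut
  arrow has its tail outside of it. A frozen head starts no path at all.\<close>

lemma discrete_cut_arcs:
  assumes U: "U \<in> up_sets i j"
  shows "discrete G {i..j} (cut_arcs i j U)"
  unfolding discrete_def
proof (intro conjI ballI notI)
  show "cut_arcs i j U \<subseteq> arcs G" by (auto simp: cut_arcs_def G)
  fix \<alpha> \<beta> assume \<alpha>: "\<alpha> \<in> cut_arcs i j U" and \<beta>: "\<beta> \<in> cut_arcs i j U"
    and "head G \<alpha> \<rightarrow>\<^sup>*\<^bsub>G \<restriction> {i..j}\<^esub> tail G \<beta>"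
  then have "(head G \<alpha>, tail G \<beta>) \<in> rtrancl_on {i..j} (arcs_ends (G \<restriction> {i..j}))"
    by (simp add: reachable_def)
  then have "tail G \<beta> \<in> U"
  proof (induction rule: rtrancl_on_induct)
    case base
    then show ?case using \<alpha> by (auto simp: cut_arcs_def G)
  next
    case (step y z)
    then show ?case using up_setsD[OF U, of y z] by (auto simp: arcs_ends_def arc_to_ends_def G)
  qed
  then show False using \<beta> by (auto simp: cut_arcs_def G)
qed

text \<open>Discreteness says precisely that no tail of \<open>D\<close> is reachable from a head of
  \<open>D\<close>. Paths of length 0 put the non-frozen heads themselves into the reachable
  set.\<close>

lemma discrete_subset_cut_arcs:
  assumes D: "discrete G {i..j} D"
  obtains U where "U \<in> up_sets i j" "D \<subseteq> cut_arcs i j U"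
proof
  let ?U = "{v. \<exists>\<alpha>\<in>D. head G \<alpha> \<rightarrow>\<^sup>*\<^bsub>G \<restriction> {i..j}\<^esub> v}"
  show "?U \<in> up_sets i j"
  proof (rule up_setsI)
    show "?U \<subseteq> {i..j}" unfolding reachable_def by (auto dest: in_rtrancl_on_in_F)
    fix p q assume pq: "(p, q) \<in> path_arcs i j" "p \<in> ?U" "q \<in> {i..j}"
    then obtain \<alpha> where \<alpha>: "\<alpha> \<in> D" "head G \<alpha> \<rightarrow>\<^sup>*\<^bsub>G \<restriction> {i..j}\<^esub> p" by auto
    then have "p \<in> {i..j}" by (auto simp: reachable_def dest: in_rtrancl_on_in_F)
    then have "(p, q) \<in> arcs_ends (G \<restriction> {i..j})"
      using pq unfolding arcs_ends_def arc_to_ends_def by (force simp: G)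
    then have "head G \<alpha> \<rightarrow>\<^sup>*\<^bsub>G \<restriction> {i..j}\<^esub> q"
      using \<alpha> pq(3) unfolding reachable_def by (auto intro: rtrancl_on_into_rtrancl_on)
    then show "q \<in> ?U" using \<alpha> by blast
  qed
  show "D \<subseteq> cut_arcs i j ?U"
  proof
    fix \<alpha> assume \<alpha>: "\<alpha> \<in> D"
    then have "\<alpha> \<in> path_arcs i j" "tail G \<alpha> \<notin> ?U"
      using D by (auto simp: discrete_def G)
    moreover have "head G \<alpha> \<in> ?U" if "head G \<alpha> \<in> {i..j}"
      using \<alpha> that by (auto simp: reachable_def intro!: bexI[of _ \<alpha>])
    ultimately show "\<alpha> \<in> cut_arcs i j ?U"
      by (cases \<alpha>) (auto simp: cut_arcs_def G)
  qed
qed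

lemma max_discrete_eq: "max_discrete G {i..j} = cut_arcs i j ` up_sets i j"
proof (intro equalityI subsetI)
  fix D assume "D \<in> max_discrete G {i..j}"
  then have D: "discrete G {i..j} D" and max: "\<And>D'. discrete G {i..j} D' \<Longrightarrow> D \<subseteq> D' \<Longrightarrow> D' = D"
    by (auto simp: max_discrete_def)
  from D obtain U where "U \<in> up_sets i j" "D \<subseteq> cut_arcs i j U"
    by (rule discrete_subset_cut_arcs)
  then show "D \<in> cut_arcs i j ` up_sets i j"
    using max[OF discrete_cut_arcs] by blast
next
  fix D assume "D \<in> cut_arcs i j ` up_sets i j"
  then obtain U where U: "U \<in> up_sets i j" and D: "D = cut_arcs i j U" by blast
  have "D' = D" if D': "discrete G {i..j} D'" and sub: "D \<subseteq> D'" for D'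
  proof -
    from D' obtain V where V: "V \<in> up_sets i j" "D' \<subseteq> cut_arcs i j V"
      by (rule discrete_subset_cut_arcs)
    with sub D have "U = V" using cut_arcs_inj[OF U] by blast
    with V sub D show ?thesis by blast
  qed
  then show "D \<in> max_discrete G {i..j}"
    using discrete_cut_arcs[OF U] D by (auto simp: max_discrete_def)
qed

end

text \<open>A cut contains exactly one arrow of every triangle: \<open>cut_arc j U k\<close> is the one in the
  triangle with sides \<open>k\<close>, \<open>ro k\<close>, \<open>ri k\<close>.\<close>

definition cut_arc :: "nat set \<Rightarrow> nat \<Rightarrow> nat \<times> nat" where
  "cut_arc U k = (if k \<in> U then if ri k \<in> U then (ro k, ri k) else (ri k, k)
     else if ro k \<in> {i..j} - U then (ro k, ri k) else (k, ro k))"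

definition first_cut_arc :: "nat set \<Rightarrow> nat \<times> nat" where
  "first_cut_arc U = (if i \<in> U then (li i, i) else (i, lo i))"

text \<open>Around a triangle the sides follow each other as \<open>k\<close>, \<open>ro k\<close>,
  \<open>ri k\<close>, \<open>k\<close>, and closedness of \<open>U\<close> leaves exactly one arrow
  in the cut. The left triangle of every diagonal but \<open>i\<close> is the right triangle of its
  predecessor, so only the triangle to the left of \<open>i\<close> has to be added.\<close>

lemma cut_arcs_eq:
  assumes U: "U \<in> up_sets i j"
  shows "cut_arcs i j U = insert (first_cut_arc U) (cut_arc U ` {i..j})"
proof (intro equalityI subsetI)
  fix \<alpha> assume \<alpha>: "\<alpha> \<in> cut_arcs i j U"
  then obtain k where k: "k \<in> {i..j}" "\<alpha> \<in> {(k, lo k), (li k, k), (k, ro k), (ri k, k)}"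
    unfolding cut_arcs_def path_arcs_def by blast
  then have kn: "1 \<le> k" "k \<le> n" using ij by auto
  have \<alpha>': "fst \<alpha> \<notin> U" "snd \<alpha> \<in> {i..j} \<Longrightarrow> snd \<alpha> \<in> U"
    using \<alpha> by (auto simp: cut_arcs_def)
  have Usub: "U \<subseteq> {i..j}" using U by (auto simp: up_sets_def)
  from k(2) consider "\<alpha> = (k, ro k)" | "\<alpha> = (ri k, k)" | "\<alpha> = (k, lo k)" | "\<alpha> = (li k, k)" by blast
  then show "\<alpha> \<in> insert (first_cut_arc U) (cut_arc U ` {i..j})"
  proof cases
    case 1
    then have "\<alpha> = cut_arc U k" using \<alpha>' by (auto simp: cut_arc_def)
    with k show ?thesis by blast
  next
    case 2
    then have "\<alpha> = cut_arc U k" using \<alpha>' k by (auto simp: cut_arc_def)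
    with k show ?thesis by blast
  next
    case 3
    show ?thesis
    proof (cases "k = i")
      case True
      then show ?thesis using 3 \<alpha>' by (auto simp: first_cut_arc_def)
    next
      case False
      from kn have "\<alpha> \<in> cut_arc U ` {i..j}"
      proof (cases rule: left_cases)
        case 1 then show ?thesis using False k ij by auto
      next
        case (2 m)
        then have m: "m \<in> {i..j}" using k False by auto
        \<comment> \<open>The quiver has an arrow from \<open>m\<close> to \<open>k\<close>, and
          \<open>k\<close>, the tail of a cut arrow, is outside of \<open>U\<close>.\<close>
        have "m \<notin> U" using 2 3 m k \<alpha>' U unfolding up_sets_def by force
        then have "\<alpha> = cut_arc U m" using 2 3 \<alpha>' k by (auto simp: cut_arc_def)
        with m show ?thesis by blast
      next
        case (3 m)
        then have m: "m \<in> {i..j}" using k False by auto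
        then have "\<alpha> = cut_arc U m" using 3 \<open>\<alpha> = (k, lo k)\<close> \<alpha>' k by (auto simp: cut_arc_def)
        with m show ?thesis by blast
      qed
      then show ?thesis by blast
    qed
  next
    case 4
    show ?thesis
    proof (cases "k = i")
      case True
      then show ?thesis using 4 \<alpha>' k by (auto simp: first_cut_arc_def)
    next
      case False
      from kn have "\<alpha> \<in> cut_arc U ` {i..j}"
      proof (cases rule: left_cases)
        case 1 then show ?thesis using False k ij by auto
      next
        case (2 m)
        then have m: "m \<in> {i..j}" using k False by auto
        then have "\<alpha> = cut_arc U m" using 2 4 \<alpha>' k by (auto simp: cut_arc_def)
        with m show ?thesis by blast
      next
        case (3 m)
        then have m: "m \<in> {i..j}" using k False by auto
        have "m \<in> U" using 3 4 m k \<alpha>' U unfolding up_sets_def by force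
        then have "\<alpha> = cut_arc U m" using 3 4 \<alpha>' k by (auto simp: cut_arc_def)
        with m show ?thesis by blast
      qed
      then show ?thesis by blast
    qed
  qed
next
  have Usub: "U \<subseteq> {i..j}" using U by (auto simp: up_sets_def)
  fix \<alpha> assume "\<alpha> \<in> insert (first_cut_arc U) (cut_arc U ` {i..j})"
  then consider "\<alpha> = first_cut_arc U" | k where "k \<in> {i..j}" "\<alpha> = cut_arc U k" by blast
  then show "\<alpha> \<in> cut_arcs i j U"
  proof cases
    case 1
    have i: "1 \<le> i" "i \<le> n" using ij by auto
    have "lo i \<notin> {i..j}" "li i \<notin> {i..j}"
      using left_cases[OF i] ij by force+
    moreover have "(i, lo i) \<in> path_arcs i j" "(li i, i) \<in> path_arcs i j"
      using ij by (auto simp: path_arcs_def)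
    ultimately show ?thesis using 1 Usub by (auto simp: cut_arcs_def first_cut_arc_def)
  next
    case (2 k)
    have arcs: "(k, ro k) \<in> path_arcs i j" "(ri k, k) \<in> path_arcs i j"
      using 2 by (auto simp: path_arcs_def)
    have kn: "1 \<le> k" "k \<le> n" using 2 ij by auto
    show ?thesis
    proof (cases "k \<in> U")
      case True
      show ?thesis
      proof (cases "ri k \<in> U")
        case rU: True
        from kn show ?thesis
        proof (cases rule: right_cases)
          case 3
          then have "Suc k \<in> {i..j}" using rU Usub by auto
          then have "(li (Suc k), Suc k) \<in> path_arcs i j"
            unfolding path_arcs_def by blast
          then show ?thesis using 2(2) 3 rU True Usub ij by (auto simp: cut_arcs_def cut_arc_def)
        qed (use rU Usub ij in auto)
      next
        case False
        then show ?thesis using 2 True arcs by (auto simp: cut_arcs_def cut_arc_def)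
      qed
    next
      case kU: False
      show ?thesis
      proof (cases "ro k \<in> {i..j} - U")
        case rU: True
        from kn show ?thesis
        proof (cases rule: right_cases)
          case 2
          then have "Suc k \<in> {i..j}" using rU by auto
          then have "(Suc k, lo (Suc k)) \<in> path_arcs i j"
            unfolding path_arcs_def by blast
          then show ?thesis using \<open>\<alpha> = _\<close> 2 rU kU Usub ij by (auto simp: cut_arcs_def cut_arc_def)
        qed (use rU Usub ij in auto)
      next
        case False
        then show ?thesis using 2 kU arcs by (auto simp: cut_arcs_def cut_arc_def)
      qed
    qed
  qed
qed

text \<open>An arrow has an end among the diagonals, so it determines its triangle.\<close>

lemma cut_arc_inj:
  assumes U: "U \<in> up_sets i j"
  shows "inj_on (cut_arc U) {i..j}" "first_cut_arc U \<notin> cut_arc U ` {i..j}"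
proof -
  define X where "X k = {k, ro k, ri k}" for k
  have Usub: "U \<subseteq> {i..j}" using U by (auto simp: up_sets_def)
  have X: "fst (cut_arc U k) \<in> X k" "snd (cut_arc U k) \<in> X k"
    and nf: "fst (cut_arc U k) \<le> n \<or> snd (cut_arc U k) \<le> n"
    and ne: "fst (cut_arc U k) \<noteq> snd (cut_arc U k)" if "k \<in> {i..j}" for k
  proof -
    have k: "1 \<le> k" "k \<le> n" using that ij by auto
    show "fst (cut_arc U k) \<in> X k" "snd (cut_arc U k) \<in> X k"
      by (auto simp: cut_arc_def X_def)
    show "fst (cut_arc U k) \<le> n \<or> snd (cut_arc U k) \<le> n"
      using that ij Usub by (auto simp: cut_arc_def)
    have "ro k \<noteq> ri k" using distinct_sides k by simp
    moreover have "k \<noteq> ro k" "k \<noteq> ri k" using ro_inner[OF k] ri_inner[OF k] k by auto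
    ultimately show "fst (cut_arc U k) \<noteq> snd (cut_arc U k)"
      by (auto simp: cut_arc_def)
  qed
  have bound: "x \<in> {k, Suc k}" if "x \<in> X k" "x \<le> n" "k \<in> {i..j}" for x k
    using that ro_inner[of k] ri_inner[of k] ij by (auto simp: X_def)
  have *: "cut_arc U k \<noteq> cut_arc U l" if kl: "k \<in> {i..j}" "l \<in> {i..j}" "k < l" for k l
  proof
    assume eq: "cut_arc U k = cut_arc U l"
    obtain x where "x \<in> X k" "x \<in> X l" "x \<le> n"
      using X[OF kl(1)] X[OF kl(2)] nf[OF kl(1)] unfolding eq by blast
    then have l: "l = Suc k"
      using bound[of x k] bound[of x l] kl by auto
    have k: "1 \<le> k" "k < n" using kl ij by auto
    have d: "distinct [lo l, li l, ro l, ri l]" using distinct_sides k l by simp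
    have "l < ro l" "l < ri l" using ro_inner[of l] ri_inner[of l] k l by force+
    \<comment> \<open>Right triangles of consecutive diagonals share only the later diagonal,
      whereas an arrow has two different ends.\<close>
    then have "X k \<inter> X l \<subseteq> {l}"
      using step[OF k] d l k unfolding X_def by auto
    then have "fst (cut_arc U l) = l" "snd (cut_arc U l) = l"
      using X[OF kl(1)] X[OF kl(2)] unfolding eq by blast+
    then show False using ne[OF kl(2)] by simp
  qed
  show "inj_on (cut_arc U) {i..j}"
    by (rule linorder_inj_onI) (use * in auto)
  show "first_cut_arc U \<notin> cut_arc U ` {i..j}"
  proof
    assume "first_cut_arc U \<in> cut_arc U ` {i..j}"
    then obtain l where l: "l \<in> {i..j}" and eq: "first_cut_arc U = cut_arc U l" by blast
    have i: "1 \<le> i" "i \<le> n" using ij by auto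
    define Y where "Y = {i, lo i, li i}"
    have Y: "fst (first_cut_arc U) \<in> Y" "snd (first_cut_arc U) \<in> Y"
      by (auto simp: first_cut_arc_def Y_def)
    have Y_bound: "x \<le> i" if "x \<in> Y" "x \<le> n" for x
      using that lo_inner[OF i] li_inner[OF i] by (auto simp: Y_def)
    obtain x where "x \<in> X l" "x \<in> Y" "x \<le> n"
      using X[OF l] Y nf[OF l] unfolding eq by blast
    then have "l = i" using bound[of x l] Y_bound[of x] l by auto
    have d: "distinct [lo i, li i, ro i, ri i]" using distinct_sides i by simp
    have "i < ro i" "i < ri i" using ro_inner[OF i] ri_inner[OF i] i by force+
    then have "X i \<inter> Y \<subseteq> {i}"
      using lo_inner[OF i] li_inner[OF i] d unfolding X_def Y_def by auto
    then have "fst (cut_arc U i) = i" "snd (cut_arc U i) = i"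
      using X[OF l] Y unfolding eq \<open>l = i\<close> by blast+
    then show False using ne[OF l] \<open>l = i\<close> by simp
  qed
qed

end

subsection \<open>Summation over the cuts\<close>

definition left_weight :: "(nat \<Rightarrow> 'a) \<Rightarrow> nat \<Rightarrow> nat set \<Rightarrow> 'a" where
  "left_weight z i U = (if i \<in> U then z (lo i) else z (li i))"

text \<open>The variable of the side opposite to \<open>cut_arc\<close>. For
  \<open>i <= k < j\<close> the test on \<open>{i..j}\<close> used there amounts to the one here,
  which mentions no interval and so survives the passage from \<open>j\<close> to
  \<open>Suc j\<close>.\<close>

definition step_weight :: "(nat \<Rightarrow> 'a) \<Rightarrow> nat set \<Rightarrow> nat \<Rightarrow> 'a" where
  "step_weight z U k = (if k \<in> U then if ri k \<in> U then z k else z (ro k)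
     else if ro k = Suc k \<and> Suc k \<notin> U then z k else z (ri k))"

text \<open>The components of \<open>transfer z i d\<close> are the sums over the sets \<open>U\<close> with \<open>i + d \<notin> U\<close> and with
  \<open>i + d \<in> U\<close>.\<close>

fun transfer :: "(nat \<Rightarrow> 'a::comm_semiring_1) \<Rightarrow> nat \<Rightarrow> nat \<Rightarrow> 'a \<times> 'a" where
  "transfer z i 0 = (z (li i), z (lo i))"
| "transfer z i (Suc d) = (let k = i + d; (a, b) = transfer z i d in
     if ro k = Suc k then (z k * a, z (ri k) * a + z (Suc k) * b)
     else (z (Suc k) * a + z (ro k) * b, z k * b))"

text \<open>The last factors come from the triangle beyond \<open>j\<close>, whose cut arrow is
  \<open>(j, ro j)\<close> or \<open>(ri j, j)\<close>.\<close>

definition cut_sum :: "(nat \<Rightarrow> 'a::comm_semiring_1) \<Rightarrow> nat \<Rightarrow> nat \<Rightarrow> 'a" where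
  "cut_sum z i j = fst (transfer z i (j - i)) * z (ri j) + snd (transfer z i (j - i)) * z (ro j)"

lemma finite_up_sets: "finite (up_sets i j)"
  by (rule finite_subset[of _ "Pow {i..j}"]) (auto simp: up_sets_def)

lemma up_sets_Suc:
  assumes "i \<le> j"
  shows "up_sets i (Suc j) =
    {U \<in> up_sets i j. ro j = Suc j \<longrightarrow> j \<notin> U} \<union>
    insert (Suc j) ` {U \<in> up_sets i j. ri j = Suc j \<longrightarrow> j \<in> U}" (is "?L = ?A \<union> ?B")
proof (intro equalityI subsetI)
  fix U assume U: "U \<in> ?L"
  then have *: "U \<subseteq> {i..Suc j}" "\<And>k. i \<le> k \<Longrightarrow> k \<le> j \<Longrightarrow> ro k = Suc k \<Longrightarrow> k \<in> U \<Longrightarrow> Suc k \<in> U"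
    "\<And>k. i \<le> k \<Longrightarrow> k \<le> j \<Longrightarrow> ri k = Suc k \<Longrightarrow> Suc k \<in> U \<Longrightarrow> k \<in> U"
    by (auto simp: up_sets_def)
  show "U \<in> ?A \<union> ?B"
  proof (cases "Suc j \<in> U")
    case False
    then have "U \<in> ?A"
      using * assms by (auto simp: up_sets_def atLeastAtMostSuc_conv)
    then show ?thesis ..
  next
    case True
    have "U - {Suc j} \<in> {U \<in> up_sets i j. ri j = Suc j \<longrightarrow> j \<in> U}"
      using * assms True by (auto simp: up_sets_def)
    moreover have "U = insert (Suc j) (U - {Suc j})" using True by auto
    ultimately show ?thesis by blast
  qed
next
  fix U assume "U \<in> ?A \<union> ?B"
  then consider "U \<in> ?A" | V where "V \<in> up_sets i j" "ri j = Suc j \<longrightarrow> j \<in> V" "U = insert (Suc j) V"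
    by blast
  then show "U \<in> ?L"
  proof cases
    case 1
    then show ?thesis unfolding up_sets_def by (fastforce simp: less_Suc_eq)
  next
    case 2
    then have "V \<subseteq> {i..j}" "\<And>k. i \<le> k \<Longrightarrow> k < j \<Longrightarrow> ro k = Suc k \<Longrightarrow> k \<in> V \<Longrightarrow> Suc k \<in> V"
      "\<And>k. i \<le> k \<Longrightarrow> k < j \<Longrightarrow> ri k = Suc k \<Longrightarrow> Suc k \<in> V \<Longrightarrow> k \<in> V"
      by (auto simp: up_sets_def)
    with 2 assms show ?thesis
      unfolding up_sets_def by (fastforce simp: less_Suc_eq)
  qed
qed

text \<open>The end values \<open>h0\<close> and \<open>h1\<close> stay arbitrary. The weight of the
  triangle between \<open>j\<close> and \<open>Suc j\<close> depends only on which of these two lie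
  in \<open>U\<close>; summing over the status of \<open>Suc j\<close> therefore leaves a sum over
  the smaller interval with new end values.\<close>

lemma sum_up_sets:
  assumes "1 \<le> i" "i + d \<le> n"
  shows "(\<Sum>U\<in>up_sets i (i + d). left_weight z i U * (\<Prod>k\<in>{i..<i + d}. step_weight z U k) *
      (if i + d \<in> U then h1 else h0)) =
    fst (transfer z i d) * h0 + snd (transfer z i d) * h1"
  using assms(2)
proof (induction d arbitrary: h0 h1)
  case 0
  have "up_sets i i = {{}, {i}}" by (auto simp: up_sets_def)
  then show ?case by (simp add: left_weight_def)
next
  case (Suc d)
  define j where "j = i + d"
  have j: "1 \<le> j" "i \<le> j" "j < n" using Suc assms by (auto simp: j_def)
  let ?P = "\<lambda>U. left_weight z i U * (\<Prod>k\<in>{i..<j}. step_weight z U k)"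
  let ?F = "\<lambda>U. left_weight z i U * (\<Prod>k\<in>{i..<Suc j}. step_weight z U k) * (if Suc j \<in> U then h1 else h0)"
  let ?A = "{U \<in> up_sets i j. ro j = Suc j \<longrightarrow> j \<notin> U}"
  let ?B = "{U \<in> up_sets i j. ri j = Suc j \<longrightarrow> j \<in> U}"
  have fin: "finite ?A" "finite ?B" using finite_up_sets by auto
  have sub: "U \<subseteq> {i..j}" if "U \<in> up_sets i j" for U using that by (auto simp: up_sets_def)
  have inj: "inj_on (insert (Suc j)) ?B"
    by (rule inj_on_inverseI[where g = "\<lambda>U. U - {Suc j}"]) (use sub in fastforce)
  have P: "?P (insert (Suc j) U) = ?P U" if "U \<in> up_sets i j" for U
  proof -
    have "step_weight z (insert (Suc j) U) k = step_weight z U k" if k: "k \<in> {i..<j}" for k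
    proof -
      have "ri k \<noteq> Suc j" "k \<noteq> j" using ri_inner[of k] k j assms by force+
      then show ?thesis using k by (auto simp: step_weight_def)
    qed
    moreover have "left_weight z i (insert (Suc j) U) = left_weight z i U"
      using j by (simp add: left_weight_def)
    ultimately show ?thesis by simp
  qed
  have F0: "?F U = ?P U * (step_weight z U j * h0)" if "U \<in> up_sets i j" for U
    using sub[OF that] j by (auto simp: mult_ac)
  have F1: "?F (insert (Suc j) U) = ?P U * (step_weight z (insert (Suc j) U) j * h1)" if "U \<in> up_sets i j" for U
  proof -
    have "?F (insert (Suc j) U) = ?P (insert (Suc j) U) * (step_weight z (insert (Suc j) U) j * h1)"
      using j by (simp add: mult_ac)
    then show ?thesis by (simp only: P[OF that])
  qed
  have "(\<Sum>U\<in>up_sets i (Suc j). ?F U) = (\<Sum>U\<in>?A. ?F U) + (\<Sum>U\<in>insert (Suc j) ` ?B. ?F U)"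
    unfolding up_sets_Suc[OF j(2)]
  proof (rule sum.union_disjoint)
    have "Suc j \<notin> U" if "U \<in> up_sets i j" for U using sub[OF that] by auto
    then show "?A \<inter> insert (Suc j) ` ?B = {}" by blast
  qed (use fin in auto)
  also have "(\<Sum>U\<in>insert (Suc j) ` ?B. ?F U) = (\<Sum>U\<in>?B. ?F (insert (Suc j) U))"
    using inj by (simp add: sum.reindex)
  also have "(\<Sum>U\<in>?A. ?F U) = (\<Sum>U\<in>up_sets i j. if ro j = Suc j \<longrightarrow> j \<notin> U then ?P U * (step_weight z U j * h0) else 0)"
    by (subst sum.inter_filter[OF finite_up_sets, symmetric]) (intro sum.cong F0, auto)
  also have "(\<Sum>U\<in>?B. ?F (insert (Suc j) U)) =
      (\<Sum>U\<in>up_sets i j. if ri j = Suc j \<longrightarrow> j \<in> U then ?P U * (step_weight z (insert (Suc j) U) j * h1) else 0)"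
    by (subst sum.inter_filter[OF finite_up_sets, symmetric]) (intro sum.cong F1, auto)
  finally have sum: "(\<Sum>U\<in>up_sets i (Suc j). ?F U) = (\<Sum>U\<in>up_sets i j.
      (if ro j = Suc j \<longrightarrow> j \<notin> U then ?P U * (step_weight z U j * h0) else 0) +
      (if ri j = Suc j \<longrightarrow> j \<in> U then ?P U * (step_weight z (insert (Suc j) U) j * h1) else 0))"
    by (simp only: sum.distrib)
  obtain a b where ab: "transfer z i d = (a, b)" by fastforce
  note IH = Suc.IH[unfolded j_def[symmetric] ab]
  show ?case
  proof (cases "ro j = Suc j")
    case True
    then have "ri j > n" using step[OF j(1,3)] j by linarith
    then have ri: "ri j \<noteq> Suc j" "\<And>U. U \<in> up_sets i j \<Longrightarrow> ri j \<notin> U" using j sub by fastforce+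
    have nU: "Suc j \<notin> U" if "U \<in> up_sets i j" for U using sub[OF that] by auto
    have "(\<Sum>U\<in>up_sets i (Suc j). ?F U) = (\<Sum>U\<in>up_sets i j. ?P U *
        (if j \<in> U then z (Suc j) * h1 else z j * h0 + z (ri j) * h1))"
      unfolding sum using ri nU True
      by (intro sum.cong) (auto simp: step_weight_def algebra_simps)
    also have "\<dots> = a * (z j * h0 + z (ri j) * h1) + b * (z (Suc j) * h1)"
      using IH j by simp
    finally show ?thesis
      using True ab by (simp add: j_def Let_def algebra_simps)
  next
    case False
    then have ri: "ri j = Suc j" and ro: "ro j > n" using step[OF j(1,3)] by blast+
    have nU: "Suc j \<notin> U" if "U \<in> up_sets i j" for U using sub[OF that] by auto
    have "(\<Sum>U\<in>up_sets i (Suc j). ?F U) = (\<Sum>U\<in>up_sets i j. ?P U *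
        (if j \<in> U then z (ro j) * h0 + z j * h1 else z (Suc j) * h0))"
      unfolding sum using ri nU False
      by (intro sum.cong) (auto simp: step_weight_def algebra_simps)
    also have "\<dots> = a * (z (Suc j) * h0) + b * (z (ro j) * h0 + z j * h1)"
      using IH j by simp
    finally show ?thesis
      using False ab by (simp add: j_def Let_def algebra_simps)
  qed
qed

lemma sum_max_discrete:
  assumes ij: "1 \<le> i" "i \<le> j" "j \<le> n"
    and G: "arcs G = path_arcs i j" "tail G = fst" "head G = snd"
    and w: "\<And>k. k \<in> {i..j} \<Longrightarrow> w (k, lo k) = z (li k)" "\<And>k. k \<in> {i..j} \<Longrightarrow> w (li k, k) = z (lo k)"
      "\<And>k. k \<in> {i..j} \<Longrightarrow> w (k, ro k) = z (ri k)" "\<And>k. k \<in> {i..j} \<Longrightarrow> w (ri k, k) = z (ro k)"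
  shows "(\<Sum>D\<in>max_discrete G {i..j}. \<Prod>\<alpha>\<in>D. w \<alpha>) = cut_sum z i j"
proof -
  have prod: "(\<Prod>\<alpha>\<in>cut_arcs i j U. w \<alpha>) = left_weight z i U * (\<Prod>k\<in>{i..<j}. step_weight z U k) *
      (if j \<in> U then z (ro j) else z (ri j))" if U: "U \<in> up_sets i j" for U
  proof -
    have Usub: "U \<subseteq> {i..j}" using U by (auto simp: up_sets_def)
    have first: "w (first_cut_arc i U) = left_weight z i U"
      using w ij by (auto simp: first_cut_arc_def[OF ij] left_weight_def)
    have step: "w (cut_arc i j U k) = step_weight z U k" if k: "k \<in> {i..<j}" for k
    proof -
      have kn: "1 \<le> k" "k < n" using k ij by auto
      have ro: "ro k \<in> {i..j} \<longleftrightarrow> ro k = Suc k" using step[OF kn] k ij by auto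
      \<comment> \<open>The arrow opposite to \<open>k\<close> is attached to \<open>Suc k\<close>,
        so the hypotheses at \<open>Suc k\<close> supply its weight.\<close>
      have third: "w (ro k, ri k) = z k" if "ri k = Suc k \<or> ro k = Suc k"
        using step[OF kn] that w(1,2)[of "Suc k"] k ij by auto
      have ri: "ri k = Suc k" if "ri k \<in> U" using step[OF kn] that Usub ij by auto
      have k': "k \<in> {i..j}" using k by simp
      show ?thesis
      proof (cases "k \<in> U")
        case True
        then show ?thesis
          using third ri w(4)[OF k'] by (cases "ri k \<in> U") (simp_all add: cut_arc_def[OF ij] step_weight_def)
      next
        case False
        then show ?thesis
          using third w(3)[OF k'] unfolding cut_arc_def[OF ij] step_weight_def Diff_iff ro
          by (cases "ro k = Suc k \<and> Suc k \<notin> U") auto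
      qed
    qed
    have last: "w (cut_arc i j U j) = (if j \<in> U then z (ro j) else z (ri j))"
    proof -
      have "j < ro j" using ro_gt[of j] ij by linarith
      moreover have "j < ri j" using ri_gt[of j] ij by linarith
      ultimately have "ro j \<notin> {i..j}" "ri j \<notin> {i..j}" by auto
      then show ?thesis using w(3,4)[of j] Usub ij by (auto simp: cut_arc_def[OF ij])
    qed
    have "(\<Prod>\<alpha>\<in>cut_arcs i j U. w \<alpha>) = w (first_cut_arc i U) * (\<Prod>k\<in>{i..j}. w (cut_arc i j U k))"
      unfolding cut_arcs_eq[OF ij U] using cut_arc_inj[OF ij U]
      by (simp add: prod.reindex)
    also have "{i..j} = insert j {i..<j}" using ij by auto
    finally show ?thesis using first step last by (simp add: mult_ac)
  qed
  have "inj_on (cut_arcs i j) (up_sets i j)"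
    using cut_arcs_inj[OF ij] by (auto intro!: inj_onI)
  then have "(\<Sum>D\<in>max_discrete G {i..j}. \<Prod>\<alpha>\<in>D. w \<alpha>) =
      (\<Sum>U\<in>up_sets i j. left_weight z i U * (\<Prod>k\<in>{i..<j}. step_weight z U k) *
        (if j \<in> U then z (ro j) else z (ri j)))"
    unfolding max_discrete_eq[OF ij G] by (simp add: sum.reindex prod)
  also have "\<dots> = cut_sum z i j"
    using sum_up_sets[of i "j - i" z "z (ro j)" "z (ri j)"] ij by (simp add: cut_sum_def)
  finally show ?thesis .
qed

text \<open>A positive value at a point with \<open>x\<^sub>m = 0\<close> shows that \<open>x\<^sub>m\<close> does not divide the polynomial.\<close>

lemma transfer_pos:
  fixes m :: nat
  defines "z \<equiv> \<lambda>l. if l = m then 0 else (1 :: int)"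
  assumes "1 \<le> i" "i + d \<le> n" "m \<le> n"
  shows "fst (transfer z i d) \<ge> 0 \<and> snd (transfer z i d) \<ge> 0 \<and>
    fst (transfer z i d) + snd (transfer z i d) > 0 \<and>
    (i + d \<le> m \<or> Suc m < i \<longrightarrow> fst (transfer z i d) > 0 \<and> snd (transfer z i d) > 0)"
  using assms(3)
\<comment> \<open>A component can vanish only if \<open>Suc m = i\<close> or
  \<open>i <= m < i + d\<close>. Until then both are positive, and this carries the sum across the
  steps in which \<open>z m = 0\<close> enters.\<close>
proof (induction d)
  case 0
  have "lo i \<noteq> li i" using distinct_sides[of i] assms 0 by simp
  moreover have "Suc (lo i) = i \<or> lo i > n" "Suc (li i) = i \<or> li i > n"
    using lo_inner[of i] li_inner[of i] assms 0 by force+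
  ultimately show ?case using assms by (auto simp: z_def)
next
  case (Suc d)
  define k where "k = i + d"
  obtain a b where ab: "transfer z i d = (a, b)" by fastforce
  have k: "1 \<le> k" "k < n" using Suc assms by (auto simp: k_def)
  have z: "z l \<in> {0, 1}" for l by (auto simp: z_def)
  from step[OF k] show ?case
  proof (elim disjE conjE)
    assume *: "ro k = Suc k" "ri k > n"
    then have "z (ri k) = 1" using assms(4) by (auto simp: z_def)
    then show ?thesis using Suc * ab z[of k] z[of "Suc k"]
      by (auto simp: k_def[symmetric]) (auto simp: z_def k_def split: if_splits)
  next
    assume *: "ri k = Suc k" "ro k > n"
    then have "z (ro k) = 1" "ro k \<noteq> Suc k" using assms(4) k by (auto simp: z_def)
    then show ?thesis using Suc * ab z[of k] z[of "Suc k"]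
      by (auto simp: k_def[symmetric]) (auto simp: z_def k_def split: if_splits)
  qed
qed

text \<open>One of the factors at \<open>ro j\<close> and \<open>ri j\<close> can vanish only for
  \<open>m = Suc j\<close>, where both components of \<open>transfer\<close> are still positive;
  otherwise it is enough that their sum is.\<close>

lemma cut_sum_pos:
  assumes ij: "1 \<le> i" "i \<le> j" "j \<le> n" and m: "m \<le> n"
  shows "cut_sum (\<lambda>l. if l = m then 0 else (1 :: int)) i j > 0"
proof -
  let ?z = "\<lambda>l. if l = m then 0 else (1 :: int)"
  obtain a b where ab: "transfer ?z i (j - i) = (a, b)" by fastforce
  have pos: "a \<ge> 0" "b \<ge> 0" "a + b > 0" "j \<le> m \<or> Suc m < i \<Longrightarrow> a > 0 \<and> b > 0"
    using transfer_pos[of i "j - i" m] ij m ab by auto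
  have "ro j \<noteq> ri j" using distinct_sides[of j] ij by simp
  moreover have "ro j = Suc j \<or> ro j > n" "ri j = Suc j \<or> ri j > n"
    using ro_inner[of j] ri_inner[of j] ij by force+
  ultimately show ?thesis
    using pos m ij unfolding cut_sum_def ab by auto
qed

end

section \<open>Triangulations of polygons\<close>

text \<open>Invariance under rotation frees the arguments from the place where the numbering of the
  vertices starts.\<close>

definition cyc :: "nat \<Rightarrow> nat \<Rightarrow> nat \<Rightarrow> bool" where
  "cyc a b c \<longleftrightarrow> a < b \<and> b < c \<or> b < c \<and> c < a \<or> c < a \<and> a < b"

lemma cyc_rotate: "cyc a b c \<Longrightarrow> cyc b c a"
  by (auto simp: cyc_def)

lemma cyc_distinct: "cyc a b c \<Longrightarrow> a \<noteq> b \<and> b \<noteq> c \<and> a \<noteq> c"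
  by (auto simp: cyc_def)

lemma cyc_trans: "cyc a b c \<Longrightarrow> cyc a c d \<Longrightarrow> cyc a b d \<and> cyc b c d"
  by (auto simp: cyc_def)

lemma crossing_iff:
  "crossing {a, b} {c, d} \<longleftrightarrow> cyc a c b \<and> cyc a b d \<or> cyc a d b \<and> cyc a b c"
proof
  assume "crossing {a, b} {c, d}"
  then show "cyc a c b \<and> cyc a b d \<or> cyc a d b \<and> cyc a b c"
    unfolding crossing_def by (auto simp: doubleton_eq_iff cyc_def)
next
  assume "cyc a c b \<and> cyc a b d \<or> cyc a d b \<and> cyc a b c"
  \<comment> \<open>The eight linear arrangements in which the two pairs alternate.\<close>
  then have "a < c \<and> c < b \<and> b < d \<or> d < a \<and> a < c \<and> c < b \<or> b < d \<and> d < a \<and> a < c \<or> c < b \<and> b < d \<and> d < a \<or>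
      a < d \<and> d < b \<and> b < c \<or> c < a \<and> a < d \<and> d < b \<or> b < c \<and> c < a \<and> a < d \<or> d < b \<and> b < c \<and> c < a"
    unfolding cyc_def by (elim disjE conjE) simp_all
  moreover have I: "crossing {p, q} {r, s}" "crossing {r, s} {p, q}" if "p < r" "r < q" "q < s" for p q r s
    unfolding crossing_def using that by blast+
  ultimately show "crossing {a, b} {c, d}"
    using I[of a c b d] I[of d a c b] I[of b d a c] I[of c b d a] I[of a d b c] I[of c a d b] I[of b c a d] I[of d b c a]
    by (simp add: insert_commute) (elim disjE; simp add: insert_commute)
qed

text \<open>The end of \<open>{u, w}\<close> on the side of \<open>b\<close> must be
  \<open>b\<close>: strictly between \<open>a\<close> and \<open>b\<close>, or between
  \<open>b\<close> and \<open>c\<close>, it would make the chord cross that side. The same argument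
  applies to \<open>d\<close>.\<close>

lemma crossing_quadrilateral:
  assumes "cyc a b c" "cyc a c d" "crossing {a, c} {u, w}"
    and "\<not> crossing {a, b} {u, w}" "\<not> crossing {b, c} {u, w}"
      "\<not> crossing {c, d} {u, w}" "\<not> crossing {d, a} {u, w}"
  shows "{u, w} = {b, d}"
proof -
  have *: "u = b \<and> w = d" if "cyc a u c" "cyc a c w" "\<not> crossing {a, b} {u, w}" "\<not> crossing {b, c} {u, w}"
      "\<not> crossing {c, d} {u, w}" "\<not> crossing {d, a} {u, w}" for u w
  proof -
    have 1: "\<not> (cyc a u b \<and> cyc a b w)" "\<not> (cyc b u c \<and> cyc b c w)" "\<not> (cyc c w d \<and> cyc c d u)" "\<not> (cyc d w a \<and> cyc d a u)"
      using that(3-6) by (auto simp: crossing_iff)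
    have "u = b"
    proof (rule ccontr)
      assume "u \<noteq> b"
      then have "cyc a u b \<or> cyc b u c" using that(1) assms(1) unfolding cyc_def by linarith
      moreover have "cyc a b w" "cyc b c w" using that(2) assms(1) cyc_trans cyc_rotate by blast+
      ultimately show False using 1 by blast
    qed
    moreover have "w = d"
    proof (rule ccontr)
      assume "w \<noteq> d"
      then have "cyc c w d \<or> cyc d w a" using that(2) assms(2) unfolding cyc_def by linarith
      moreover have "cyc c d u" "cyc d a u" using that(1) assms(2) unfolding cyc_def by linarith+
      ultimately show False using 1 by blast
    qed
    ultimately show ?thesis by blast
  qed
  from assms(3)[unfolded crossing_iff] show ?thesis
  proof
    assume "cyc a u c \<and> cyc a c w"
    then show ?thesis using *[of u w] assms(4-7) by simp
  next
    assume "cyc a w c \<and> cyc a c u"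
    then show ?thesis using *[of w u] assms(4-7) by (simp add: insert_commute)
  qed
qed

locale polygon_triangulation =
  fixes N :: nat and T :: "nat set set"
  assumes N: "N \<ge> 3" and triangulation: "triangulation N T"
begin

definition edges :: "nat set set" where
  "edges = T \<union> polygon_sides N"

text \<open>Unlike the sorted triples of \<open>triangles\<close>, these may be rotated.\<close>

definition tri :: "nat \<Rightarrow> nat \<Rightarrow> nat \<Rightarrow> bool" where
  "tri a b c \<longleftrightarrow> cyc a b c \<and> {a, b} \<in> edges \<and> {b, c} \<in> edges \<and> {c, a} \<in> edges"

lemma T_diagonals: "T \<subseteq> polygon_diagonals N"
  using triangulation by (auto simp: triangulation_def noncrossing_def)

lemma diagonals_sides_disjoint: "T \<inter> polygon_sides N = {}"
  using T_diagonals by (auto simp: polygon_diagonals_def)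

lemma pair_cases:
  assumes "a \<noteq> b" "a < N" "b < N"
  shows "{a, b} \<in> polygon_sides N \<or> {a, b} \<in> polygon_diagonals N"
proof -
  have "{a, b} \<in> {{a, b} | a b. a < b \<and> b < N}"
  proof (cases "a < b")
    case False
    then have "b < a" using assms by simp
    with assms show ?thesis by (intro CollectI exI[of _ b] exI[of _ a]) (auto simp: insert_commute)
  qed (use assms in blast)
  then show ?thesis unfolding polygon_diagonals_def by blast
qed

lemma side_cases:
  assumes "e \<in> polygon_sides N"
  obtains k where "Suc k < N" "e = {k, Suc k}" | "e = {0, N - 1}"
proof -
  from assms obtain k where k: "k < N" "e = {k, Suc k mod N}"
    by (auto simp: polygon_sides_def)
  show ?thesis
  proof (cases "Suc k < N")
    case True
    with k show ?thesis using that(1) by simp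
  next
    case False
    with k have "k = N - 1" "Suc k = N" by auto
    with k show ?thesis using that(2) by (simp add: insert_commute)
  qed
qed

lemma side_Suc: "Suc k < N \<Longrightarrow> {k, Suc k} \<in> edges"
  unfolding edges_def polygon_sides_def by (force intro!: exI[of _ k])

lemma side_last: "{0, N - 1} \<in> polygon_sides N"
proof -
  have "{0, N - 1} = {N - 1, Suc (N - 1) mod N}" using N by (auto simp: insert_commute)
  then show ?thesis unfolding polygon_sides_def using N by fastforce
qed

lemma edge_bounds:
  assumes "{a, b} \<in> edges"
  shows "a < N" "b < N" "a \<noteq> b"
proof -
  have "\<exists>c d. {a, b} = {c, d} \<and> c < d \<and> d < N"
  proof (cases "{a, b} \<in> T")
    case True
    then show ?thesis using T_diagonals by (auto simp: polygon_diagonals_def)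
  next
    case False
    with assms have "{a, b} \<in> polygon_sides N" by (simp add: edges_def)
    then show ?thesis by (cases rule: side_cases) (use N in force)+
  qed
  then show "a < N" "b < N" "a \<noteq> b" by (auto simp: doubleton_eq_iff)
qed

lemma edge_pair: "e \<in> edges \<Longrightarrow> \<exists>a b. e = {a, b} \<and> a < b \<and> b < N"
proof -
  assume e: "e \<in> edges"
  have "\<exists>a b. e = {a, b}"
  proof (cases "e \<in> T")
    case True
    then show ?thesis using T_diagonals unfolding polygon_diagonals_def by blast
  next
    case False
    with e show ?thesis by (auto simp: edges_def polygon_sides_def)
  qed
  then obtain a b where "e = {a, b}" by blast
  then show ?thesis using edge_bounds[of a b] e
    by (metis insert_commute linorder_neqE_nat)
qed

lemma side_not_crossing:
  assumes "e \<in> polygon_sides N" "c < N" "d < N"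
  shows "\<not> crossing e {c, d}"
  using assms(1) by (cases rule: side_cases) (use assms in \<open>auto simp: crossing_iff cyc_def\<close>)

lemma crossing_sym: "crossing d e \<longleftrightarrow> crossing e d"
  unfolding crossing_def by blast

lemma edges_not_crossing:
  assumes "e \<in> edges" "f \<in> edges"
  shows "\<not> crossing e f"
proof -
  obtain a b c d where *: "e = {a, b}" "f = {c, d}" "a < N" "b < N" "c < N" "d < N"
    using edge_pair[OF assms(1)] edge_pair[OF assms(2)] by (metis less_trans)
  show ?thesis
  proof (cases "e \<in> polygon_sides N \<or> f \<in> polygon_sides N")
    case True
    then show ?thesis using side_not_crossing * crossing_sym by metis
  next
    case False
    then show ?thesis using assms triangulation
      by (auto simp: edges_def triangulation_def noncrossing_def)
  qed
qed

lemma edges_noncrossing: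
  "{a, b} \<in> edges \<Longrightarrow> {c, d} \<in> edges \<Longrightarrow> cyc a c b \<Longrightarrow> \<not> cyc a b d"
  using edges_not_crossing[of "{a, b}" "{c, d}"] by (auto simp: crossing_iff)

text \<open>A chord crossed by no edge can be adjoined to \<open>T\<close>, so maximality puts it
  there already. Letting \<open>c\<close> and \<open>d\<close> range over ordered pairs covers both
  alternatives of \<open>crossing_iff\<close>.\<close>

lemma edges_maximal:
  assumes ab: "a \<noteq> b" "a < N" "b < N" and nc: "\<And>c d. {c, d} \<in> edges \<Longrightarrow> \<not> (cyc a c b \<and> cyc a b d)"
  shows "{a, b} \<in> edges"
proof (cases "{a, b} \<in> polygon_sides N")
  case False
  then have diag: "{a, b} \<in> polygon_diagonals N" using pair_cases ab by blast
  have nc': "\<not> crossing {a, b} e" if "e \<in> T" for e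
  proof -
    have e: "e \<in> edges" using that by (simp add: edges_def)
    then obtain c d where "e = {c, d}" using edge_pair by blast
    then show ?thesis using nc[of c d] nc[of d c] e by (auto simp: crossing_iff insert_commute)
  qed
  have "\<not> crossing {a, b} {a, b}" by (auto simp: crossing_iff cyc_def)
  then have "noncrossing N (insert {a, b} T)"
    using triangulation diag nc' crossing_sym unfolding triangulation_def noncrossing_def by blast
  then have "insert {a, b} T = T" using triangulation unfolding triangulation_def by blast
  then show ?thesis by (auto simp: edges_def)
qed (simp add: edges_def)

text \<open>The apex is the last neighbour \<open>c\<close> of \<open>a\<close> before
  \<open>b\<close>. An edge crossing \<open>{c, b}\<close> would also cross \<open>{a, c}\<close> or
  \<open>{a, b}\<close>, or else end at \<open>a\<close> and contradict the choice of
  \<open>c\<close>.\<close>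

lemma inner_triangle:
  assumes ab: "{a, b} \<in> edges" "Suc a < b"
  obtains c where "a < c" "c < b" "{a, c} \<in> edges" "{c, b} \<in> edges"
proof -
  define C where "C = {c. a < c \<and> c < b \<and> {a, c} \<in> edges}"
  have bN: "b < N" using edge_bounds[OF ab(1)] by simp
  have "finite C" by (rule finite_subset[of _ "{..b}"]) (auto simp: C_def)
  moreover have "Suc a \<in> C" using side_Suc[of a] ab bN by (auto simp: C_def)
  ultimately have c: "Max C \<in> C" and max: "\<And>c'. c' \<in> C \<Longrightarrow> c' \<le> Max C"
    using Max_in[of C] Max_ge[of C] by blast+
  define c where "c = Max C"
  have c: "a < c" "c < b" "{a, c} \<in> edges"
    using c unfolding c_def[symmetric] by (auto simp: C_def)
  have max: "{a, c'} \<notin> edges" if "c < c'" "c' < b" for c'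
    using max[of c'] that c unfolding c_def[symmetric] by (auto simp: C_def)
  have "{c, b} \<in> edges"
  proof (rule edges_maximal)
    fix u v assume uv: "{u, v} \<in> edges"
    show "\<not> (cyc c u b \<and> cyc c b v)"
    proof
      assume *: "cyc c u b \<and> cyc c b v"
      then have u: "c < u" "u < b" and v: "v < c \<or> b < v" using c by (auto simp: cyc_def)
      consider "v = a" | "a < v" "v < c" | "v < a" | "b < v" using v by linarith
      then show False
      proof cases
        case 1
        then show ?thesis using max[of u] u uv by (simp add: insert_commute)
      next
        case 2
        then have "cyc a v c" "cyc a c u" using u c by (auto simp: cyc_def)
        then show ?thesis using edges_noncrossing[OF c(3), of v u] uv by (simp add: insert_commute)
      next
        case 3
        then have "cyc a u b" "cyc a b v" using u c by (auto simp: cyc_def)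
        then show ?thesis using edges_noncrossing[OF ab(1), of u v] uv by simp
      next
        case 4
        then have "cyc a u b" "cyc a b v" using u c by (auto simp: cyc_def)
        then show ?thesis using edges_noncrossing[OF ab(1), of u v] uv by simp
      qed
    qed
  qed (use c bN in auto)
  then show ?thesis using that c by blast
qed

text \<open>The triangle on the outer side of \<open>ab\<close> lies below the shortest edge that properly covers \<open>ab\<close>.\<close>

lemma outer_triangle:
  assumes ab: "{a, b} \<in> edges" "a < b" "{a, b} \<noteq> {0, N - 1}"
  obtains c where "c < a \<or> b < c" "{a, c} \<in> edges" "{c, b} \<in> edges"
proof -
  define P where "P w \<longleftrightarrow> (\<exists>u v. {u, v} \<in> edges \<and> u \<le> a \<and> b \<le> v \<and> (u, v) \<noteq> (a, b) \<and> w = v - u)" for w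
  have "b < N" using edge_bounds[OF ab(1)] by simp
  then have "P (N - 1)" unfolding P_def edges_def using side_last ab by (intro exI[of _ 0] exI[of _ "N - 1"]) auto
  then have "P (LEAST w. P w)" by (rule LeastI)
  then obtain u v where uv: "{u, v} \<in> edges" "u \<le> a" "b \<le> v" "(u, v) \<noteq> (a, b)" "(LEAST w. P w) = v - u"
    unfolding P_def by blast
  have min: "v - u \<le> v' - u'" if "{u', v'} \<in> edges" "u' \<le> a" "b \<le> v'" "(u', v') \<noteq> (a, b)" for u' v'
    using Least_le[of P "v' - u'"] that uv(5) unfolding P_def by auto
  have "Suc u < v" using uv ab by auto
  then obtain c where c: "u < c" "c < v" "{u, c} \<in> edges" "{c, v} \<in> edges"
    using inner_triangle[OF uv(1)] by blast
  consider "c \<le> a" | "b \<le> c" | "a < c" "c < b" by linarith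
  then show ?thesis
  proof cases
    case 1
    then have "(c, v) = (a, b)" using min[OF c(4) _ uv(3)] c by fastforce
    then show ?thesis using that[of u] c uv by (auto simp: insert_commute)
  next
    case 2
    then have "(u, c) = (a, b)" using min[OF c(3) uv(2)] c by fastforce
    then show ?thesis using that[of v] c uv by (auto simp: insert_commute)
  next
    case 3
    \<comment> \<open>With the apex strictly between \<open>a\<close> and \<open>b\<close>, the
      edges \<open>{u, c}\<close> and \<open>{c, v}\<close> avoid crossing \<open>{a, b}\<close>
      only if \<open>u = a\<close> and \<open>v = b\<close>, the excluded pair.\<close>
    then have "u = a"
      using edges_noncrossing[OF ab(1), of c u] c(3) uv(2) by (auto simp: cyc_def insert_commute)
    moreover have "v = b"
      using 3 edges_noncrossing[OF ab(1), of c v] c(4) uv(3) by (auto simp: cyc_def insert_commute)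
    ultimately show ?thesis using uv by simp
  qed
qed

lemma tri_rotate: "tri a b c \<Longrightarrow> tri b c a"
  using cyc_rotate by (auto simp: tri_def)

lemma triD:
  assumes "tri a b c"
  shows "{a, b} \<in> edges" "{b, c} \<in> edges" "{c, a} \<in> edges" "cyc a b c"
  using assms by (auto simp: tri_def)

text \<open>Orientation picks the side: for \<open>a < b\<close> the apex comes from
  \<open>outer_triangle\<close>, for \<open>b < a\<close> from \<open>inner_triangle\<close>. Both
  orders together give the two triangles at a diagonal.\<close>

lemma tri_exists:
  assumes "{a, b} \<in> T"
  obtains c where "tri a b c"
proof -
  have e: "{a, b} \<in> edges" using assms by (simp add: edges_def)
  have ns: "{a, b} \<notin> polygon_sides N" using assms diagonals_sides_disjoint by blast
  have *: "\<exists>c. tri x y c" if xy: "{x, y} = {a, b}" "x < y" for x y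
  proof -
    have "{x, y} \<noteq> {0, N - 1}" using ns side_last xy(1) by metis
    then obtain c where "c < x \<or> y < c" "{x, c} \<in> edges" "{c, y} \<in> edges"
      using outer_triangle[of x y] e xy by metis
    then show ?thesis using e xy by (auto simp: tri_def cyc_def insert_commute)
  qed
  have **: "\<exists>c. tri y x c" if xy: "{x, y} = {a, b}" "x < y" for x y
  proof -
    have "Suc x \<noteq> y" 
    proof
      assume "Suc x = y"
      moreover have "y < N" using edge_bounds(2)[of x y] e xy by simp
      ultimately have "{x, y} \<in> polygon_sides N" unfolding polygon_sides_def by force
      then show False using ns xy by simp
    qed
    then obtain c where "x < c" "c < y" "{x, c} \<in> edges" "{c, y} \<in> edges"
      using inner_triangle[of x y] e xy by (metis Suc_lessI)
    then show ?thesis using e xy by (auto simp: tri_def cyc_def insert_commute)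
  qed
  have "a \<noteq> b" using edge_bounds[OF e] by simp
  then have "\<exists>c. tri a b c"
    using *[of a b] **[of b a] by (metis insert_commute linorder_neqE_nat)
  then show ?thesis using that by blast
qed

text \<open>Given two apices on the same side of \<open>{a, b}\<close>, the edge from
  \<open>b\<close> to one of them would cross the edge from \<open>a\<close> to the other.\<close>

lemma tri_unique:
  assumes "tri a b c" "tri a b d"
  shows "c = d"
proof (rule ccontr)
  assume "c \<noteq> d"
  have cyc: "cyc a b c" "cyc a b d" using assms by (auto simp: tri_def)
  with \<open>c \<noteq> d\<close> have "cyc b c d \<and> cyc b d a \<or> cyc b d c \<and> cyc b c a" unfolding cyc_def by linarith
  then show False
  proof
    assume "cyc b c d \<and> cyc b d a"
    then show ?thesis using edges_noncrossing[of b d c a] assms by (auto simp: tri_def)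
  next
    assume "cyc b d c \<and> cyc b c a"
    then show ?thesis using edges_noncrossing[of b c d a] assms by (auto simp: tri_def)
  qed
qed

lemma triangles_iff:
  "(e, f) \<in> \<Union> (clockwise ` triangles N T) \<longleftrightarrow> (\<exists>a b c. tri a b c \<and> e = {a, b} \<and> f = {b, c})"
proof
  assume "(e, f) \<in> \<Union> (clockwise ` triangles N T)"
  then obtain a b c where "(a, b, c) \<in> triangles N T" and ef: "(e, f) \<in> clockwise (a, b, c)" by auto
  then have "tri a b c" by (auto simp: triangles_def tri_def edges_def cyc_def)
  then show "\<exists>a b c. tri a b c \<and> e = {a, b} \<and> f = {b, c}"
    using ef tri_rotate unfolding clockwise_def by blast
next
  assume "\<exists>a b c. tri a b c \<and> e = {a, b} \<and> f = {b, c}"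
  then obtain a b c where abc: "tri a b c" and ef: "e = {a, b}" "f = {b, c}" by blast
  have tr: "(x, y, z) \<in> triangles N T" if "tri x y z" "x < y" "y < z" for x y z
    using that edge_bounds[of z x] by (auto simp: triangles_def tri_def edges_def)
  consider "a < b" "b < c" | "b < c" "c < a" | "c < a" "a < b"
    using abc by (auto simp: tri_def cyc_def)
  then have "\<exists>\<tau>\<in>triangles N T. (e, f) \<in> clockwise \<tau>"
  proof cases
    case 1
    with tr[OF abc] show ?thesis unfolding ef by (intro bexI[of _ "(a, b, c)"]) (auto simp: clockwise_def)
  next
    case 2
    with tr[of b c a] tri_rotate[OF abc] show ?thesis
      unfolding ef by (intro bexI[of _ "(b, c, a)"]) (auto simp: clockwise_def)
  next
    case 3
    with tr[of c a b] tri_rotate[OF tri_rotate[OF abc]] show ?thesis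
      unfolding ef by (intro bexI[of _ "(c, a, b)"]) (auto simp: clockwise_def)
  qed
  then show "(e, f) \<in> \<Union> (clockwise ` triangles N T)" by blast
qed

end

section \<open>Chord lengths\<close>

text \<open>The vertices of the polygon are sent to vectors \<open>(v a, w a)\<close>; the determinants of pairs of
  vectors satisfy the three-term Pluecker relation, which is the exchange relation of a flip.\<close>

definition chord :: "(nat \<Rightarrow> 'a::field) \<Rightarrow> (nat \<Rightarrow> 'a) \<Rightarrow> nat set \<Rightarrow> 'a" where
  "chord v w e = v (Min e) * w (Max e) - v (Max e) * w (Min e)"

lemma chord_less: "a < b \<Longrightarrow> chord v w {a, b} = v a * w b - v b * w a"
  by (simp add: chord_def)

lemma chord_singleton [simp]: "chord v w {a} = 0"
  by (simp add: chord_def)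

text \<open>As \<open>chord\<close> sorts the end points, all signs are plus and the relation is
  invariant under rotating the four points; only the sorted case needs a computation.\<close>

lemma ptolemy:
  assumes "cyc a b c" "cyc a c d"
  shows "chord v w {a, c} * chord v w {b, d} =
    chord v w {a, b} * chord v w {c, d} + chord v w {b, c} * chord v w {d, a}"
proof -
  have *: "chord v w {a, c} * chord v w {b, d} =
      chord v w {a, b} * chord v w {c, d} + chord v w {b, c} * chord v w {a, d}"
    if "a < b" "b < c" "c < d" for a b c d
    using that by (simp add: chord_less algebra_simps)
  consider "a < b" "b < c" "c < d" | "b < c" "c < d" "d < a" | "c < d" "d < a" "a < b" | "d < a" "a < b" "b < c"
    using assms that unfolding cyc_def by (elim disjE conjE) simp_all
  then show ?thesis
    using *[of a b c d] *[of b c d a] *[of c d a b] *[of d a b c]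
    by cases (simp_all add: insert_commute algebra_simps)
qed

context polygon_triangulation
begin

text \<open>The triangle below \<open>{a, b}\<close> splits the interval at its apex
  \<open>c\<close>. The vector at \<open>c\<close> is forced by those at \<open>a\<close> and
  \<open>b\<close>, and the two parts are filled independently: an edge other than
  \<open>{a, b}\<close> passing over \<open>c\<close> would cross \<open>{a, c}\<close> or
  \<open>{c, b}\<close>.\<close>

lemma vectors_below_edge:
  fixes X :: "nat set \<Rightarrow> 'a::field"
  assumes X: "\<And>e. e \<in> edges \<Longrightarrow> X e \<noteq> 0"
  assumes "{a, b} \<in> edges" "a < b" "va * wb - vb * wa = X {a, b}"
  shows "\<exists>v w. v a = va \<and> w a = wa \<and> v b = vb \<and> w b = wb \<and>
    (\<forall>c d. a \<le> c \<longrightarrow> c < d \<longrightarrow> d \<le> b \<longrightarrow> {c, d} \<in> edges \<longrightarrow> v c * w d - v d * w c = X {c, d})"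
  using assms(2-4)
proof (induction "b - a" arbitrary: a b va wa vb wb rule: less_induct)
  case less
  show ?case
  proof (cases "b = Suc a")
    case True
    let ?v = "\<lambda>k. if k = a then va else vb" and ?w = "\<lambda>k. if k = a then wa else wb"
    have "?v c * ?w d - ?v d * ?w c = X {c, d}" if "a \<le> c" "c < d" "d \<le> b" for c d
    proof -
      have "c = a" "d = b" using that True by auto
      then show ?thesis using less.prems by simp
    qed
    then show ?thesis using less.prems(2) by (intro exI[of _ ?v] exI[of _ ?w]) auto
  next
    case False
    with less.prems obtain c where c: "a < c" "c < b" "{a, c} \<in> edges" "{c, b} \<in> edges"
      using inner_triangle[of a b] by (metis Suc_lessI)
    \<comment> \<open>Cramer's rule for the two determinants at \<open>c\<close>; here
      \<open>X {a, b}\<close> must be nonzero.\<close>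
    define s where "s = X {c, b} / X {a, b}"
    define t where "t = X {a, c} / X {a, b}"
    define vc where "vc = s * va + t * vb"
    define wc where "wc = s * wa + t * wb"
    have "va * wc - vc * wa = t * (va * wb - vb * wa)" "vc * wb - vb * wc = s * (va * wb - vb * wa)"
      by (simp_all add: vc_def wc_def algebra_simps)
    then have ac: "va * wc - vc * wa = X {a, c}" and cb: "vc * wb - vb * wc = X {c, b}"
      using less.prems X by (simp_all add: s_def t_def)
    obtain v1 w1 where vw1: "v1 a = va" "w1 a = wa" "v1 c = vc" "w1 c = wc"
      and det1: "\<And>x y. a \<le> x \<Longrightarrow> x < y \<Longrightarrow> y \<le> c \<Longrightarrow> {x, y} \<in> edges \<Longrightarrow> v1 x * w1 y - v1 y * w1 x = X {x, y}"
      using less.hyps[of c a va wc vc wa] c ac by force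
    obtain v2 w2 where vw2: "v2 c = vc" "w2 c = wc" "v2 b = vb" "w2 b = wb"
      and det2: "\<And>x y. c \<le> x \<Longrightarrow> x < y \<Longrightarrow> y \<le> b \<Longrightarrow> {x, y} \<in> edges \<Longrightarrow> v2 x * w2 y - v2 y * w2 x = X {x, y}"
      using less.hyps[of b c vc wb vb wc] c cb by force
    let ?v = "\<lambda>k. if k \<le> c then v1 k else v2 k" and ?w = "\<lambda>k. if k \<le> c then w1 k else w2 k"
    have "?v x * ?w y - ?v y * ?w x = X {x, y}"
      if xy: "a \<le> x" "x < y" "y \<le> b" "{x, y} \<in> edges" for x y
    proof -
      consider "y \<le> c" | "c \<le> x" | "x = a" "y = b" | "x < c" "c < y" "a < x \<or> y < b"
        using xy by linarith
      then show ?thesis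
      proof cases
        case 1
        then show ?thesis using xy det1[of x y] by auto
      next
        case 2
        then show ?thesis using xy vw1 vw2 det2[of x y] by (cases "x = c") auto
      next
        case 3
        then show ?thesis using c less.prems vw1 vw2 by auto
      next
        case 4
        then have False
          using edges_noncrossing[OF c(3), of x y] edges_noncrossing[OF c(4), of y x] xy c
          by (auto simp: cyc_def insert_commute)
        then show ?thesis ..
      qed
    qed
    then show ?thesis
      using c vw1 vw2 by (intro exI[of _ ?v] exI[of _ ?w]) auto
  qed
qed

lemma exists_chords:
  fixes X :: "nat set \<Rightarrow> 'a::field"
  assumes X: "\<And>e. e \<in> edges \<Longrightarrow> X e \<noteq> 0"
  obtains v w where "\<And>e. e \<in> edges \<Longrightarrow> chord v w e = X e"
proof -
  have "{0, N - 1} \<in> edges" using side_last by (simp add: edges_def)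
  \<comment> \<open>The starting vectors are (1, 0) at vertex 0 and (0, \<open>X {0, N - 1}\<close>)
    at vertex \<open>N - 1\<close>.\<close>
  then obtain v w where vw: "\<And>c d. c < d \<Longrightarrow> d \<le> N - 1 \<Longrightarrow> {c, d} \<in> edges \<Longrightarrow> v c * w d - v d * w c = X {c, d}"
    using vectors_below_edge[of X 0 "N - 1" 1 "X {0, N - 1}" 0 0] X N by auto
  have "chord v w e = X e" if e: "e \<in> edges" for e
  proof -
    obtain a b where "e = {a, b}" "a < b" "b < N" using edge_pair[OF e] by blast
    then show ?thesis using vw[of a b] e by (simp add: chord_less)
  qed
  then show ?thesis using that by blast
qed

end

section \<open>Labelled triangulations and their quivers\<close>

locale labelled_polygon =
  fixes n :: nat and E :: "nat \<Rightarrow> nat set" and T :: "nat set set"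
  assumes labelled: "labelled_triangulation n E T"
begin

sublocale polygon_triangulation "n + 3" T
  using labelled by unfold_locales (auto simp: labelled_triangulation_def)

lemma E_bij: "bij_betw E {1..2*n+3} edges"
proof -
  have "{1..2*n+3} = {1..n} \<union> {n+1..2*n+3}" by auto
  then show ?thesis
    using labelled diagonals_sides_disjoint unfolding labelled_triangulation_def edges_def
    by (auto intro: bij_betw_combine)
qed

definition lab :: "nat set \<Rightarrow> nat" where
  "lab e = inv_into {1..2*n+3} E e"

lemma lab_E: "k \<in> {1..2*n+3} \<Longrightarrow> lab (E k) = k"
  using E_bij by (simp add: lab_def bij_betw_inv_into_left)

lemma E_lab: "e \<in> edges \<Longrightarrow> E (lab e) = e"
  using E_bij by (simp add: lab_def bij_betw_inv_into_right)

lemma lab_range: "e \<in> edges \<Longrightarrow> lab e \<in> {1..2*n+3}"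
  using E_bij unfolding lab_def by (metis bij_betw_imp_surj_on inv_into_into)

lemma E_edges: "k \<in> {1..2*n+3} \<Longrightarrow> E k \<in> edges"
  using E_bij by (auto simp: bij_betw_def)

lemma lab_eq_iff: "e \<in> edges \<Longrightarrow> f \<in> edges \<Longrightarrow> lab e = lab f \<longleftrightarrow> e = f"
  using E_lab by metis

lemma E_diagonal: "k \<in> {1..n} \<Longrightarrow> E k \<in> T"
  using labelled by (auto simp: labelled_triangulation_def bij_betw_def)

lemma lab_diagonal: "e \<in> T \<Longrightarrow> lab e \<in> {1..n}"
proof -
  assume "e \<in> T"
  then obtain k where k: "k \<in> {1..n}" "e = E k"
    using labelled by (auto simp: labelled_triangulation_def bij_betw_def)
  then have "lab (E k) = k" by (intro lab_E) auto
  with k show ?thesis by simp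
qed

lemma tri_edge_distinct:
  assumes "tri a b c"
  shows "{a, b} \<noteq> {b, c}" "{b, c} \<noteq> {c, a}" "{c, a} \<noteq> {a, b}"
  using triD(4)[OF assms] cyc_distinct by (auto simp: doubleton_eq_iff)

section \<open>Arrows read off from oriented triangles\<close>

definition arrow :: "nat \<Rightarrow> nat \<Rightarrow> bool" where
  "arrow p q \<longleftrightarrow> (\<exists>a b c. tri a b c \<and> p = lab {a, b} \<and> q = lab {b, c})"

lemma follows_iff:
  "(p, q) \<in> follows n E (triangles (n + 3) T) \<longleftrightarrow> arrow p q"
proof
  assume "(p, q) \<in> follows n E (triangles (n + 3) T)"
  then have pq: "p \<in> {1..2*n+3}" "q \<in> {1..2*n+3}"
    and "(E p, E q) \<in> \<Union> (clockwise ` triangles (n + 3) T)"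
    by (auto simp: follows_def)
  then obtain a b c where "tri a b c" "E p = {a, b}" "E q = {b, c}"
    unfolding triangles_iff by blast
  then show "arrow p q" unfolding arrow_def using lab_E pq by metis
next
  assume "arrow p q"
  then obtain a b c where *: "tri a b c" "p = lab {a, b}" "q = lab {b, c}" by (auto simp: arrow_def)
  then have "E p = {a, b}" "E q = {b, c}" "p \<in> {1..2*n+3}" "q \<in> {1..2*n+3}"
    using E_lab lab_range triD by auto
  moreover from this have "(E p, E q) \<in> \<Union> (clockwise ` triangles (n + 3) T)"
    unfolding triangles_iff using * by blast
  ultimately show "(p, q) \<in> follows n E (triangles (n + 3) T)"
    unfolding follows_def by auto
qed

lemma num_arrows_Qbar:
  "num_arrows (Qbar_T n E T) p q = of_bool (arrow p q \<and> (p \<in> {1..n} \<or> q \<in> {1..n}))"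
proof -
  have "{a \<in> arcs (Qbar_T n E T). tail (Qbar_T n E T) a = p \<and> head (Qbar_T n E T) a = q} =
      (if arrow p q \<and> (p \<in> {1..n} \<or> q \<in> {1..n}) then {(p, q)} else {})"
    by (auto simp: Qbar_T_def ice_quiver_of_def follows_iff)
  then show ?thesis by (simp add: num_arrows_def)
qed

lemma num_arrows_Q:
  "num_arrows (Q_T n E T) p q = of_bool (arrow p q \<and> p \<in> {1..n} \<and> q \<in> {1..n})"
proof -
  have "{a \<in> arcs (Q_T n E T). tail (Q_T n E T) a = p \<and> head (Q_T n E T) a = q} =
      (if arrow p q \<and> p \<in> {1..n} \<and> q \<in> {1..n} then {(p, q)} else {})"
    by (auto simp: Q_T_def quiver_of_def follows_iff)
  then show ?thesis by (simp add: num_arrows_def)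
qed

text \<open>By \<open>tri_unique\<close> there is one triangle on each side of
  \<open>{l, r}\<close>, and each contributes one outgoing arrow.\<close>

lemma arrow_from:
  assumes "tri p l r" "tri l q r"
  shows "arrow (lab {l, r}) v \<longleftrightarrow> v = lab {r, p} \<or> v = lab {l, q}"
proof
  assume "arrow (lab {l, r}) v"
  then obtain a b c where abc: "tri a b c" "lab {l, r} = lab {a, b}" "v = lab {b, c}"
    by (auto simp: arrow_def)
  then have "{l, r} = {a, b}"
    using lab_eq_iff[of "{l, r}" "{a, b}"] triD[OF assms(1)] triD[OF abc(1)] by simp
  then consider "a = l" "b = r" | "a = r" "b = l" by (auto simp: doubleton_eq_iff)
  then show "v = lab {r, p} \<or> v = lab {l, q}"
  proof cases
    case 1
    then have "c = p" using tri_unique[of l r c p] abc tri_rotate[OF assms(1)] by simp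
    then show ?thesis using abc 1 by simp
  next
    case 2
    then have "c = q" using tri_unique[of r l c q] abc tri_rotate[OF tri_rotate[OF assms(2)]] by simp
    then show ?thesis using abc 2 by simp
  qed
next
  assume "v = lab {r, p} \<or> v = lab {l, q}"
  then show "arrow (lab {l, r}) v"
    unfolding arrow_def using tri_rotate[OF assms(1)] tri_rotate[OF tri_rotate[OF assms(2)]]
    by (metis insert_commute)
qed

lemma arrow_to:
  assumes "tri p l r" "tri l q r"
  shows "arrow v (lab {l, r}) \<longleftrightarrow> v = lab {p, l} \<or> v = lab {q, r}"
proof
  assume "arrow v (lab {l, r})"
  then obtain a b c where abc: "tri a b c" "lab {l, r} = lab {b, c}" "v = lab {a, b}"
    by (auto simp: arrow_def)
  then have "{l, r} = {b, c}"
    using lab_eq_iff[of "{l, r}" "{b, c}"] triD[OF assms(1)] triD[OF abc(1)] by simp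
  then consider "b = l" "c = r" | "b = r" "c = l" by (auto simp: doubleton_eq_iff)
  then show "v = lab {p, l} \<or> v = lab {q, r}"
  proof cases
    case 1
    then have "a = p" using tri_unique[of l r a p] tri_rotate[OF abc(1)] tri_rotate[OF assms(1)] by simp
    then show ?thesis using abc 1 by simp
  next
    case 2
    then have "a = q"
      using tri_unique[of r l a q] tri_rotate[OF abc(1)] tri_rotate[OF tri_rotate[OF assms(2)]] by simp
    then show ?thesis using abc 2 by simp
  qed
next
  assume "v = lab {p, l} \<or> v = lab {q, r}"
  then show "arrow v (lab {l, r})"
    unfolding arrow_def using assms(1) tri_rotate[OF assms(2)] by (metis insert_commute)
qed

text \<open>The ends of two distinct sides are all three vertices, so a triangle with these two
  sides has no choice for the third.\<close>

lemma third_side_tri: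
  assumes abc: "tri a b c"
  shows "third_side n E T (lab {a, b}) (lab {b, c}) = lab {c, a}"
  unfolding third_side_def
proof (rule the_equality)
  have "E (lab {a, b}) = {a, b}" "E (lab {b, c}) = {b, c}" "E (lab {c, a}) = {c, a}"
    using triD[OF abc] E_lab by auto
  note E = this
  have "({a, b}, {b, c}) \<in> \<Union> (clockwise ` triangles (n + 3) T)"
    unfolding triangles_iff using abc by blast
  then obtain \<tau> where \<tau>: "\<tau> \<in> triangles (n + 3) T" "({a, b}, {b, c}) \<in> clockwise \<tau>" by blast
  have third: "{c, a} \<in> tri_sides (u, v, w)" if "{a, b} \<in> tri_sides (u, v, w)" "{b, c} \<in> tri_sides (u, v, w)" for u v w
    using that cyc_distinct[OF triD(4)[OF abc]] by (auto simp: tri_sides_def doubleton_eq_iff)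
  obtain u v w where \<tau>_eq: "\<tau> = (u, v, w)" by (cases \<tau>)
  have sides: "{a, b} \<in> tri_sides \<tau>" "{b, c} \<in> tri_sides \<tau>"
    using \<tau>(2) unfolding \<tau>_eq tri_sides_def clockwise_def by blast+
  have "{c, a} \<in> tri_sides \<tau>" using third sides unfolding \<tau>_eq by blast
  then have "{{a, b}, {b, c}, {c, a}} \<subseteq> tri_sides \<tau>" using sides by blast
  moreover have "card {{a, b}, {b, c}, {c, a}} = 3" using tri_edge_distinct[OF abc] by simp
  moreover have "finite (tri_sides \<tau>)" "card (tri_sides \<tau>) \<le> 3"
    by (auto simp: \<tau>_eq tri_sides_def card_insert_if)
  ultimately have "tri_sides \<tau> = {{a, b}, {b, c}, {c, a}}"
    by (metis card_seteq)
  then show "lab {c, a} \<in> {1..2*n+3} \<and> (\<exists>\<tau>\<in>triangles (n + 3) T.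
      tri_sides \<tau> = {E (lab {a, b}), E (lab {b, c}), E (lab {c, a})})"
    using \<tau> lab_range triD[OF abc] E by auto
  fix r assume r: "r \<in> {1..2*n+3} \<and> (\<exists>\<tau>\<in>triangles (n + 3) T.
      tri_sides \<tau> = {E (lab {a, b}), E (lab {b, c}), E r})"
  then obtain u v w where uvw: "tri_sides (u, v, w) = {{a, b}, {b, c}, E r}" using E by auto
  have "{c, a} \<in> tri_sides (u, v, w)" by (rule third) (simp_all add: uvw)
  then have "E r = {c, a}" unfolding uvw using tri_edge_distinct[OF abc] by simp
  then show "r = lab {c, a}" using lab_E r by metis
qed

end

section \<open>Flips and mutations\<close>

locale flippable = labelled_polygon +
  fixes k a b c d :: nat
  assumes k: "k \<in> {1..n}" and E_k: "E k = {a, c}" and abc: "tri a b c" and cda: "tri c d a"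
begin

definition E' :: "nat \<Rightarrow> nat set" where "E' = E(k := {b, d})"
definition T' :: "nat set set" where "T' = insert {b, d} (T - {{a, c}})"

lemma ac: "{a, c} \<in> T"
  using E_diagonal[OF k] by (simp add: E_k)

lemma cycs: "cyc a b c" "cyc a c d" "cyc b c d" "cyc b d a"
  using triD(4)[OF abc] triD(4)[OF cda] unfolding cyc_def by auto

lemma abcd_distinct: "a \<noteq> b" "a \<noteq> c" "a \<noteq> d" "b \<noteq> c" "b \<noteq> d" "c \<noteq> d"
  using cycs cyc_distinct by blast+

lemma quad_edges: "{a, b} \<in> edges" "{b, c} \<in> edges" "{c, d} \<in> edges" "{d, a} \<in> edges"
  using triD[OF abc] triD[OF cda] by auto

lemma bounds: "a < n + 3" "b < n + 3" "c < n + 3" "d < n + 3"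
  using edge_bounds[OF quad_edges(1)] edge_bounds[OF quad_edges(3)] by auto

lemma crossing_ac_bd: "crossing {a, c} {b, d}" "crossing {b, d} {a, c}"
  using cycs cyc_rotate crossing_iff crossing_sym by blast+

lemma bd_not_side: "{b, d} \<notin> polygon_sides (n + 3)"
  using side_not_crossing[of "{b, d}" a c] bounds crossing_ac_bd by blast

lemma bd_diagonal: "{b, d} \<in> polygon_diagonals (n + 3)"
  using pair_cases[of b d] abcd_distinct bounds bd_not_side by blast

lemma bd_not_edge: "{b, d} \<notin> edges"
  using edges_not_crossing[of "{b, d}" "{a, c}"] crossing_ac_bd ac by (auto simp: edges_def)

lemma bd_not_crossing:
  assumes "e \<in> T - {{a, c}}"
  shows "\<not> crossing {b, d} e"
proof
  assume cr: "crossing {b, d} e"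
  have e: "e \<in> edges" using assms by (simp add: edges_def)
  then obtain u w where uw: "e = {u, w}" using edge_pair by blast
  have "{u, w} = {c, a}"
    using crossing_quadrilateral[OF cycs(3,4) cr[unfolded uw]] edges_not_crossing[OF _ e] quad_edges
    unfolding uw by simp
  then show False using assms uw by (simp add: insert_commute)
qed

lemma noncrossing_T': "noncrossing (n + 3) T'"
proof -
  have "\<not> crossing {b, d} {b, d}" by (auto simp: crossing_iff cyc_def)
  moreover have "\<not> crossing e {b, d}" "\<not> crossing {b, d} e" if "e \<in> T - {{a, c}}" for e
    using bd_not_crossing[OF that] crossing_sym by simp_all
  moreover have "\<not> crossing e f" if "e \<in> T - {{a, c}}" "f \<in> T - {{a, c}}" for e f
    using edges_not_crossing[of e f] that by (simp add: edges_def)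
  ultimately have "\<not> crossing e f" if "e \<in> T'" "f \<in> T'" for e f
    using that unfolding T'_def by (elim insertE) simp_all
  moreover have "T' \<subseteq> polygon_diagonals (n + 3)"
    using bd_diagonal T_diagonals by (auto simp: T'_def)
  ultimately show ?thesis by (simp add: noncrossing_def)
qed

text \<open>A diagonal compatible with \<open>T'\<close> that crosses \<open>{a, c}\<close> can only
  be \<open>{b, d}\<close>, by \<open>crossing_quadrilateral\<close>; one that does not cross it is
  compatible with \<open>T\<close> and lies in \<open>T\<close> by maximality.\<close>

lemma triangulation_T': "triangulation (n + 3) T'"
  unfolding triangulation_def
proof (intro conjI allI impI)
  show "noncrossing (n + 3) T'" by (rule noncrossing_T')
  fix U assume U: "noncrossing (n + 3) U \<and> T' \<subseteq> U"
  have "e \<in> T'" if e: "e \<in> U" for e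
  proof -
    have ediag: "e \<in> polygon_diagonals (n + 3)" using U e by (auto simp: noncrossing_def)
    then obtain u w where uw: "e = {u, w}" "u < w" "w < n + 3" by (auto simp: polygon_diagonals_def)
    have nc: "\<not> crossing f e" if "f \<in> edges" "f \<noteq> {a, c}" for f
    proof (cases "f \<in> T")
      case True
      then have "f \<in> U" using U that by (auto simp: T'_def)
      then show ?thesis using U e by (auto simp: noncrossing_def)
    next
      case False
      then show ?thesis using that side_not_crossing[of f u w] uw by (auto simp: edges_def)
    qed
    have bd: "{b, d} \<in> U" using U by (auto simp: T'_def)
    show ?thesis
    proof (cases "crossing {a, c} e")
      case True
      have "{a, b} \<noteq> {a, c}" "{b, c} \<noteq> {a, c}" "{c, d} \<noteq> {a, c}" "{d, a} \<noteq> {a, c}"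
        using abcd_distinct by (auto simp: doubleton_eq_iff)
      then have "{u, w} = {b, d}"
        using crossing_quadrilateral[OF cycs(1,2) True[unfolded uw]] nc quad_edges unfolding uw(1) by simp
      then show ?thesis using uw by (simp add: T'_def)
    next
      case False
      have "\<not> crossing e e" using U e by (auto simp: noncrossing_def)
      moreover have "\<not> crossing f e" if "f \<in> T" for f
        using nc[of f] False that by (cases "f = {a, c}") (auto simp: edges_def)
      ultimately have "noncrossing (n + 3) (insert e T)"
        using triangulation ediag crossing_sym unfolding triangulation_def noncrossing_def by blast
      then have "insert e T = T" using triangulation unfolding triangulation_def by blast
      then have "e \<in> T" by blast
      moreover have "e \<noteq> {a, c}" using crossing_ac_bd U e bd by (auto simp: noncrossing_def)
      ultimately show ?thesis by (simp add: T'_def)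
    qed
  qed
  then show "U = T'" using U by blast
qed

lemma labelled': "labelled_triangulation n E' T'"
  unfolding labelled_triangulation_def
proof (intro conjI)
  show "triangulation (n + 3) T'" by (rule triangulation_T')
  have bij: "bij_betw E {1..n} T" "bij_betw E {n+1..2*n+3} (polygon_sides (n + 3))"
    using labelled by (auto simp: labelled_triangulation_def)
  have "bij_betw E ({1..n} - {k}) (T - {{a, c}})"
    using bij(1) k E_k by (metis bij_betw_DiffI bij_betw_singletonI empty_subsetI insert_subset ac)
  then have "bij_betw E' ({1..n} - {k}) (T - {{a, c}})"
    by (rule bij_betw_cong[THEN iffD1, rotated]) (simp add: E'_def)
  moreover have "bij_betw E' {k} {{b, d}}" by (simp add: E'_def)
  moreover have "(T - {{a, c}}) \<inter> {{b, d}} = {}" using bd_not_edge by (auto simp: edges_def)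
  ultimately have "bij_betw E' (({1..n} - {k}) \<union> {k}) ((T - {{a, c}}) \<union> {{b, d}})"
    by (rule bij_betw_combine)
  moreover have "({1..n} - {k}) \<union> {k} = {1..n}" using k by blast
  ultimately show "bij_betw E' {1..n} T'" by (simp add: T'_def)
  have "E' l = E l" if "l \<in> {n+1..2*n+3}" for l using that k by (auto simp: E'_def)
  then show "bij_betw E' {n+1..2*n+3} (polygon_sides (n + 3))"
    using bij(2) bij_betw_cong by blast
qed

section \<open>Quivers before and after a flip\<close>

sublocale L': labelled_polygon n E' T'
  by unfold_locales (rule labelled')

lemma edges': "L'.edges = insert {b, d} (edges - {{a, c}})"
proof -
  have "{a, c} \<notin> polygon_sides (n + 3)" using ac diagonals_sides_disjoint by blast
  then show ?thesis unfolding L'.edges_def edges_def unfolding T'_def by blast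
qed

lemma lab'_eq: "e \<in> edges \<Longrightarrow> e \<noteq> {a, c} \<Longrightarrow> L'.lab e = lab e"
proof -
  assume e: "e \<in> edges" "e \<noteq> {a, c}"
  have "lab e \<in> {1..2*n+3}" "E (lab e) = e" using e lab_range E_lab by auto
  moreover have "lab e \<noteq> k" using \<open>E (lab e) = e\<close> e E_k by auto
  ultimately have "E' (lab e) = e" by (simp add: E'_def)
  then show ?thesis using L'.lab_E[OF \<open>lab e \<in> _\<close>] by simp
qed

lemma k_range: "k \<in> {1..2*n+3}"
  using k by auto

lemma lab_ac: "lab {a, c} = k"
  using lab_E[OF k_range] by (simp add: E_k)

lemma tri'_bcd: "L'.tri b c d" and tri'_dab: "L'.tri d a b"
  using cycs cyc_rotate quad_edges abcd_distinct
  unfolding L'.tri_def edges' by (auto simp: doubleton_eq_iff insert_commute)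

text \<open>The arrows from triangles without the side \<open>{a, c}\<close>, which the flip leaves
  in place.\<close>

definition common :: "nat \<Rightarrow> nat \<Rightarrow> bool" where
  "common p q \<longleftrightarrow> (\<exists>x y z. tri x y z \<and> {a, c} \<notin> {{x, y}, {y, z}, {z, x}} \<and> p = lab {x, y} \<and> q = lab {y, z})"

lemma arrow_iff_common:
  assumes "p \<noteq> k" "q \<noteq> k"
  shows "arrow p q \<longleftrightarrow> common p q \<or> (p, q) = (lab {a, b}, lab {b, c}) \<or> (p, q) = (lab {c, d}, lab {d, a})"
proof
  assume "arrow p q"
  then obtain x y z where xyz: "tri x y z" "p = lab {x, y}" "q = lab {y, z}" by (auto simp: arrow_def)
  then have ne: "{x, y} \<noteq> {a, c}" "{y, z} \<noteq> {a, c}" using assms lab_ac by auto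
  show "common p q \<or> (p, q) = (lab {a, b}, lab {b, c}) \<or> (p, q) = (lab {c, d}, lab {d, a})"
  proof (cases "{z, x} = {a, c}")
    case False
    then show ?thesis using xyz ne unfolding common_def by blast
  next
    case True
    then consider "z = a" "x = c" | "z = c" "x = a" by (auto simp: doubleton_eq_iff)
    then show ?thesis
    proof cases
      case 1
      then have "y = d" using tri_unique[of a c y d] tri_rotate xyz(1) cda by blast
      then show ?thesis using 1 xyz by simp
    next
      case 2
      then have "y = b" using tri_unique[of c a y b] tri_rotate xyz(1) abc by blast
      then show ?thesis using 2 xyz by simp
    qed
  qed
next
  assume "common p q \<or> (p, q) = (lab {a, b}, lab {b, c}) \<or> (p, q) = (lab {c, d}, lab {d, a})"
  then show "arrow p q" unfolding common_def arrow_def using abc cda by blast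
qed

text \<open>If two sides of the quadrilateral lie in one triangle, the third side is
  \<open>{a, c}\<close>, which \<open>common\<close> excludes, or \<open>{b, d}\<close>, which is
  not an edge. Hence no further arrow joins them when mutation adds or cancels arrows there.\<close>

lemma not_common_quad:
  assumes "p \<in> {lab {a, b}, lab {b, c}, lab {c, d}, lab {d, a}}"
    and "q \<in> {lab {a, b}, lab {b, c}, lab {c, d}, lab {d, a}}"
  shows "\<not> common p q"
proof
  assume "common p q"
  then obtain x y z where xyz: "tri x y z" "{z, x} \<noteq> {a, c}" "p = lab {x, y}" "q = lab {y, z}"
    by (auto simp: common_def)
  have "{x, y} \<in> {{a, b}, {b, c}, {c, d}, {d, a}}"
    using assms(1) lab_eq_iff[OF triD(1)[OF xyz(1)]] quad_edges unfolding xyz by auto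
  moreover have "{y, z} \<in> {{a, b}, {b, c}, {c, d}, {d, a}}"
    using assms(2) lab_eq_iff[OF triD(2)[OF xyz(1)]] quad_edges unfolding xyz by auto
  moreover have "z \<noteq> x" using triD(4)[OF xyz(1)] cyc_distinct by blast
  ultimately have "{z, x} = {a, c} \<or> {z, x} = {b, d}"
    using abcd_distinct by (auto simp: doubleton_eq_iff)
  then show False using xyz(2) triD(3)[OF xyz(1)] bd_not_edge by auto
qed

lemma arrow_k: "arrow k v \<longleftrightarrow> v = lab {a, b} \<or> v = lab {c, d}"
  and arrow_k': "arrow v k \<longleftrightarrow> v = lab {b, c} \<or> v = lab {d, a}"
  using arrow_from[of b c a d v] arrow_to[of b c a d v] tri_rotate[OF abc] cda lab_ac
  by (simp_all add: insert_commute)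

text \<open>Two sides fix the three vertices, and the reverse arrow would need the opposite
  orientation.\<close>

lemma arrow_asym: "arrow p q \<Longrightarrow> \<not> arrow q p"
proof
  assume "arrow p q" "arrow q p"
  then obtain x y z u v w where *: "tri x y z" "tri u v w" "lab {x, y} = lab {v, w}" "lab {y, z} = lab {u, v}"
    by (auto simp: arrow_def)
  then have "{x, y} = {v, w}" "{y, z} = {u, v}"
    using lab_eq_iff triD(1,2)[OF *(1)] triD(1,2)[OF *(2)] by auto
  then have "u = z \<and> v = y \<and> w = x"
    using cyc_distinct[OF triD(4)[OF *(1)]] by (auto simp: doubleton_eq_iff)
  then show False
    using triD(4)[OF *(1)] triD(4)[OF *(2)] by (auto simp: cyc_def)
qed

end

context flippable
begin

text \<open>The flip can be undone, with the corners rotated by one place. All statements about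
  arrows thus become available on both sides of the flip.\<close>

interpretation F': flippable n E' T' k b c d a
  by unfold_locales (use k tri'_bcd tri'_dab in \<open>auto simp: E'_def\<close>)

lemma lab'_quad: "L'.lab {a, b} = lab {a, b}" "L'.lab {b, c} = lab {b, c}"
  "L'.lab {c, d} = lab {c, d}" "L'.lab {d, a} = lab {d, a}"
  using lab'_eq quad_edges abcd_distinct by (auto simp: doubleton_eq_iff)

lemma common': "F'.common p q \<longleftrightarrow> common p q"
proof -
  have "e \<in> L'.edges \<and> {b, d} \<noteq> e \<longleftrightarrow> e \<in> edges \<and> {a, c} \<noteq> e" for e
    using bd_not_edge unfolding edges' by blast
  then have "L'.tri x y z \<and> {b, d} \<notin> {{x, y}, {y, z}, {z, x}} \<longleftrightarrow>
      tri x y z \<and> {a, c} \<notin> {{x, y}, {y, z}, {z, x}}" for x y z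
    unfolding L'.tri_def tri_def insert_iff empty_iff by metis
  moreover have "L'.lab {x, y} = lab {x, y}" "L'.lab {y, z} = lab {y, z}"
    if "tri x y z" "{a, c} \<notin> {{x, y}, {y, z}, {z, x}}" for x y z
    using lab'_eq[OF triD(1)[OF that(1)]] lab'_eq[OF triD(2)[OF that(1)]] that(2) by auto
  ultimately show ?thesis unfolding F'.common_def common_def by metis
qed

lemma quad_labels_distinct: "distinct [k, lab {a, b}, lab {b, c}, lab {c, d}, lab {d, a}]"
proof -
  have "distinct [{a, c}, {a, b}, {b, c}, {c, d}, {d, a}]"
    using abcd_distinct by (auto simp: doubleton_eq_iff)
  moreover have "set [{a, c}, {a, b}, {b, c}, {c, d}, {d, a}] \<subseteq> edges"
    using quad_edges ac by (auto simp: edges_def)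
  moreover have "inj_on lab edges" using lab_eq_iff by (auto simp: inj_on_def)
  ultimately have "distinct (map lab [{a, c}, {a, b}, {b, c}, {c, d}, {d, a}])"
    by (metis distinct_map inj_on_subset)
  then show ?thesis by (simp add: lab_ac)
qed

lemma quad_labels_distinct': "distinct [lab {d, a}, lab {c, d}, lab {b, c}, lab {a, b}, k]"
  using quad_labels_distinct by auto

text \<open>Four paths run through \<open>k\<close>. Two of them oppose an arrow between the sides
  of an old triangle, \<open>{a, b}\<close> to \<open>{b, c}\<close> or \<open>{c, d}\<close> to
  \<open>{d, a}\<close>, and cancel it. The other two create the corresponding arrows of the new
  triangles, \<open>{b, c}\<close> to \<open>{c, d}\<close> and \<open>{d, a}\<close> to
  \<open>{a, b}\<close>.\<close>

lemma mutate_quiver_flip: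
  assumes R: "\<And>p q. p \<in> {1..2*n+3} \<Longrightarrow> q \<in> {1..2*n+3} \<Longrightarrow> R p q = num_arrows (Qbar_T n E T) p q"
    and p: "p \<in> {1..2*n+3}" and q: "q \<in> {1..2*n+3}"
  shows "mutate_quiver n k R p q = num_arrows (Qbar_T n E' T') p q"
proof (cases "p > n \<and> q > n")
  case True
  then show ?thesis by (simp add: mutate_quiver_def L'.num_arrows_Qbar)
next
  case False
  then have nf: "p \<in> {1..n} \<or> q \<in> {1..n}" using p q by auto
  have irr: "\<not> arrow x x" for x using arrow_asym by blast
  have R_in: "R x k = of_bool (arrow x k)" "R k x = of_bool (arrow k x)" if "x \<in> {1..2*n+3}" for x
    using R[OF that k_range] R[OF k_range that] k by (auto simp: num_arrows_Qbar)
  have R_pq: "R p q = of_bool (arrow p q)" "R q p = of_bool (arrow q p)"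
    using R p q nf by (auto simp: num_arrows_Qbar)
  have R': "num_arrows (Qbar_T n E' T') p q = of_bool (L'.arrow p q)"
    using nf by (simp add: L'.num_arrows_Qbar)
  have out: "L'.arrow k x \<longleftrightarrow> arrow x k" "L'.arrow x k \<longleftrightarrow> arrow k x" for x
    using arrow_k arrow_k' F'.arrow_k F'.arrow_k' lab'_quad by auto
  have Rkk: "R k k = 0" using R_in(1)[OF k_range] irr by simp
  consider "p = k" | "q = k" "p \<noteq> k" | "p \<noteq> k" "q \<noteq> k" by blast
  then show ?thesis
  proof cases
    case 1
    then have "mutate_quiver n k R p q = R q k - R k q"
      using False by (auto simp: mutate_quiver_def Rkk)
    then show ?thesis using R' 1 out R_in[OF q] arrow_asym[of q k] by (auto simp: of_bool_def)
  next
    case 2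
    then have "mutate_quiver n k R p q = R k p - R p k"
      using False by (auto simp: mutate_quiver_def Rkk)
    then show ?thesis using R' 2 out R_in[OF p] arrow_asym[of k p] by (auto simp: of_bool_def)
  next
    case 3
    then have C: "mutate_quiver n k R p q = (of_bool (arrow p q) + of_bool (arrow p k \<and> arrow k q)) -
        (of_bool (arrow q p) + of_bool (arrow q k \<and> arrow k p))"
      using False R_in[OF p] R_in[OF q] R_pq by (auto simp: mutate_quiver_def of_bool_def)
    have arr: "arrow p q \<longleftrightarrow> common p q \<or> (p, q) = (lab {a, b}, lab {b, c}) \<or> (p, q) = (lab {c, d}, lab {d, a})"
      "arrow q p \<longleftrightarrow> common q p \<or> (q, p) = (lab {a, b}, lab {b, c}) \<or> (q, p) = (lab {c, d}, lab {d, a})"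
      using 3 arrow_iff_common by blast+
    have arr': "L'.arrow p q \<longleftrightarrow> common p q \<or> (p, q) = (lab {b, c}, lab {c, d}) \<or> (p, q) = (lab {d, a}, lab {a, b})"
      using 3 F'.arrow_iff_common[of p q] lab'_quad common' by simp
    consider "arrow p k" "arrow k q" | "arrow q k" "arrow k p"
      | "\<not> (arrow p k \<and> arrow k q)" "\<not> (arrow q k \<and> arrow k p)" by blast
    then show ?thesis
    proof cases
      case 1
      then have p': "p = lab {b, c} \<or> p = lab {d, a}" and q': "q = lab {a, b} \<or> q = lab {c, d}"
        using arrow_k arrow_k' by simp_all
      then have "\<not> common p q" "\<not> common q p"
        by (intro not_common_quad; blast)+
      moreover have "mutate_quiver n k R p q = Suc (of_bool (arrow p q)) - of_bool (arrow q p)"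
        using C 1 arrow_asym[OF 1(1)] by simp
      ultimately show ?thesis
        using p' q' arr arr' R' quad_labels_distinct quad_labels_distinct' by (elim disjE) simp_all
    next
      case 2
      then have p': "p = lab {a, b} \<or> p = lab {c, d}" and q': "q = lab {b, c} \<or> q = lab {d, a}"
        using arrow_k arrow_k' by simp_all
      then have "\<not> common p q"
        by (intro not_common_quad; blast)
      then have "\<not> L'.arrow p q"
        using p' q' arr' quad_labels_distinct quad_labels_distinct' by (elim disjE) simp_all
      moreover have "mutate_quiver n k R p q = 0"
        using C 2 arrow_asym[OF 2(2)] by (cases "arrow p q") simp_all
      ultimately show ?thesis using R' by simp
    next
      case 3
      then have "arrow p q \<longleftrightarrow> common p q"
        using arr(1) arrow_k[of p] arrow_k'[of q] by auto
      moreover have "L'.arrow p q \<longleftrightarrow> common p q"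
        using 3 arr' arrow_k'[of p] arrow_k[of q] by auto
      moreover have "mutate_quiver n k R p q = of_bool (arrow p q) - of_bool (arrow q p)"
        using C 3 by simp
      ultimately show ?thesis using R' arrow_asym[of p q] by (cases "arrow p q") simp_all
    qed
  qed
qed

end

section \<open>Seeds attached to labelled triangulations\<close>

definition realizes :: "(nat \<Rightarrow> ratfun) \<Rightarrow> (nat \<Rightarrow> ratfun) \<Rightarrow> nat \<Rightarrow> seed \<Rightarrow> (nat \<Rightarrow> nat set) \<Rightarrow> nat set set \<Rightarrow> bool" where
  "realizes v w n S E T \<longleftrightarrow> labelled_triangulation n E T \<and>
     (\<forall>l\<in>{1..2*n+3}. fst S l = chord v w (E l)) \<and>
     (\<forall>p\<in>{1..2*n+3}. \<forall>q\<in>{1..2*n+3}. snd S p q = num_arrows (Qbar_T n E T) p q)"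

text \<open>The arrows into and out of \<open>k\<close> are the two pairs of opposite sides of the
  quadrilateral, so the exchange relation is \<open>ptolemy\<close>. The vectors \<open>v\<close>
  and \<open>w\<close> do not change; \<open>nz\<close> allows the division.\<close>

lemma (in flippable) realizes_mutate:
  assumes S: "realizes v w n S E T" and nz: "chord v w {a, c} \<noteq> 0"
  shows "realizes v w n (mutate n (2*n+3) k S) E' T'"
proof -
  obtain x R where SxR: "S = (x, R)" by fastforce
  have x: "\<And>l. l \<in> {1..2*n+3} \<Longrightarrow> x l = chord v w (E l)"
    and R: "\<And>p q. p \<in> {1..2*n+3} \<Longrightarrow> q \<in> {1..2*n+3} \<Longrightarrow> R p q = num_arrows (Qbar_T n E T) p q"
    using S by (auto simp: realizes_def SxR)
  have lab: "lab e \<in> {1..2*n+3}" "x (lab e) = chord v w e" if "e \<in> edges" for e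
    using lab_range[OF that] x[of "lab e"] E_lab[OF that] by auto
  have R_in: "R j k = of_bool (j = lab {b, c} \<or> j = lab {d, a})"
    and R_out: "R k j = of_bool (j = lab {a, b} \<or> j = lab {c, d})" if "j \<in> {1..2*n+3}" for j
    using R[OF that k_range] R[OF k_range that] k arrow_k arrow_k' by (simp_all add: num_arrows_Qbar)
  have "(\<Prod>j = 1..2*n+3. x j ^ R j k) = (\<Prod>j\<in>{lab {b, c}, lab {d, a}}. x j)"
  proof (rule prod.mono_neutral_cong_right)
    show "{lab {b, c}, lab {d, a}} \<subseteq> {1..2*n+3}" using lab quad_edges by blast
    show "\<forall>j\<in>{1..2*n+3} - {lab {b, c}, lab {d, a}}. x j ^ R j k = 1" using R_in by simp
    show "x j ^ R j k = x j" if "j \<in> {lab {b, c}, lab {d, a}}" for j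
      using that R_in[of j] lab(1) quad_edges by auto
  qed simp
  also have "\<dots> = chord v w {b, c} * chord v w {d, a}"
    using quad_labels_distinct lab quad_edges by simp
  finally have in_prod: "(\<Prod>j = 1..2*n+3. x j ^ R j k) = chord v w {b, c} * chord v w {d, a}" .
  have "(\<Prod>j = 1..2*n+3. x j ^ R k j) = (\<Prod>j\<in>{lab {a, b}, lab {c, d}}. x j)"
  proof (rule prod.mono_neutral_cong_right)
    show "{lab {a, b}, lab {c, d}} \<subseteq> {1..2*n+3}" using lab quad_edges by blast
    show "\<forall>j\<in>{1..2*n+3} - {lab {a, b}, lab {c, d}}. x j ^ R k j = 1" using R_out by simp
    show "x j ^ R k j = x j" if "j \<in> {lab {a, b}, lab {c, d}}" for j
      using that R_out[of j] lab(1) quad_edges by auto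
  qed simp
  also have "\<dots> = chord v w {a, b} * chord v w {c, d}"
    using quad_labels_distinct lab quad_edges by simp
  finally have out_prod: "(\<Prod>j = 1..2*n+3. x j ^ R k j) = chord v w {a, b} * chord v w {c, d}" .
  have "x k = chord v w {a, c}" using x[OF k_range] E_k by simp
  then have new: "((\<Prod>j = 1..2*n+3. x j ^ R j k) + (\<Prod>j = 1..2*n+3. x j ^ R k j)) / x k = chord v w {b, d}"
    unfolding in_prod out_prod using ptolemy[OF cycs(1,2), of v w] nz by (simp add: field_simps)
  show ?thesis
    unfolding realizes_def SxR mutate_def
    using labelled' mutate_quiver_flip[OF R] new x by (auto simp: E'_def)
qed

lemma (in labelled_polygon) flippable_exists:
  assumes k: "k \<in> {1..n}"
  obtains a b c d where "flippable n E T k a b c d"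
proof -
  obtain a c where ac: "E k = {a, c}"
    using edge_pair E_edges k by (metis E_diagonal UnCI edges_def)
  then have T: "{a, c} \<in> T" "{c, a} \<in> T" using E_diagonal[OF k] by (auto simp: insert_commute)
  obtain d b where "tri a c d" "tri c a b" using tri_exists T by metis
  then have "flippable n E T k a b c d"
    using k ac tri_rotate by unfold_locales blast+
  then show ?thesis by (rule that)
qed

lemma seeds_realized:
  assumes nz: "\<And>e. e \<in> polygon_diagonals (n + 3) \<Longrightarrow> chord v w e \<noteq> 0"
    and S0: "realizes v w n S0 E0 T0" and S: "S \<in> seeds n (2*n+3) S0"
  shows "\<exists>E T. realizes v w n S E T"
  using S
proof induction
  case initial
  then show ?case using S0 by blast
next
  case (mutation S k)
  then obtain E T where ET: "realizes v w n S E T" by blast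
  then interpret labelled_polygon n E T by unfold_locales (simp add: realizes_def)
  obtain a b c d where "flippable n E T k a b c d" using flippable_exists mutation by blast
  then interpret flippable n E T k a b c d .
  show ?case using realizes_mutate[OF ET] nz ac T_diagonals by blast
qed

text \<open>Flipping an edge opposite to \<open>p\<close> produces an edge at \<open>p\<close>, which does not cross \<open>pq\<close>.\<close>

lemma (in labelled_polygon) flip_towards:
  assumes pq: "{p, q} \<in> polygon_diagonals (n + 3)" "{p, q} \<notin> T" "p < q"
  obtains k a c d where "flippable n E T k a p c d" "crossing {a, c} {p, q}"
proof -
  have bq: "q < n + 3" and ns: "{p, q} \<notin> polygon_sides (n + 3)"
    using pq by (auto simp: polygon_diagonals_def doubleton_eq_iff)
  then have npq: "{p, q} \<notin> edges" using pq by (simp add: edges_def)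
  define A where "A = {a. p < a \<and> a < q \<and> {p, a} \<in> edges}"
  have "finite A" by (rule finite_subset[of _ "{..q}"]) (auto simp: A_def)
  have Suc_p: "{p, Suc p} \<in> edges" using side_Suc[of p] pq(3) bq by simp
  then have "Suc p \<noteq> q" using npq by auto
  then have "Suc p \<in> A" using Suc_p pq(3) by (auto simp: A_def)
  \<comment> \<open>Taking the last neighbour of \<open>p\<close> before \<open>q\<close> makes the
    chord to \<open>q\<close> start inside the triangle beyond \<open>{p, a}\<close>, so it crosses
    the side opposite to \<open>p\<close>.\<close>
  define a where "a = Max A"
  have "a \<in> A" and max: "\<And>c. c \<in> A \<Longrightarrow> c \<le> a"
    unfolding a_def using \<open>finite A\<close> \<open>Suc p \<in> A\<close> Max_in[of A] Max_ge[of A] by blast+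
  then have a: "p < a" "a < q" "{p, a} \<in> edges" by (auto simp: A_def)
  have "{p, a} \<noteq> {0, n + 3 - 1}" using a bq by (auto simp: doubleton_eq_iff)
  then obtain c where c: "c < p \<or> a < c" "{p, c} \<in> edges" "{c, a} \<in> edges"
    by (rule outer_triangle[OF a(3,1)])
  have "c < p \<or> q < c"
  proof (rule ccontr)
    assume "\<not> (c < p \<or> q < c)"
    moreover have "c \<noteq> q" using c(2) npq by auto
    ultimately have "c \<in> A" "a < c" using c a by (auto simp: A_def)
    then show False using max by force
  qed
  then have cyc: "cyc p a c" and cr: "crossing {c, a} {p, q}"
    using a unfolding crossing_iff by (auto simp: cyc_def)
  have pac: "tri p a c" using cyc a c by (auto simp: tri_def insert_commute)
  have "{c, a} \<notin> polygon_sides (n + 3)"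
    using cr side_not_crossing[of "{c, a}" p q] pq(3) bq by auto
  then have T: "{c, a} \<in> T" using c(3) by (simp add: edges_def)
  then obtain d where d: "tri c a d" by (rule tri_exists)
  have "E (lab {c, a}) = {c, a}" using E_lab c by blast
  then have "flippable n E T (lab {c, a}) c p a d"
    using lab_diagonal[OF T] tri_rotate pac d by unfold_locales blast+
  then show ?thesis using that cr by blast
qed

text \<open>Each flip towards \<open>p\<close> replaces a diagonal crossing \<open>{p, q}\<close> by
  one that does not, so the number of crossings decreases until \<open>{p, q}\<close> itself is
  present.\<close>

lemma diagonal_reached:
  assumes nz: "\<And>e. e \<in> polygon_diagonals (n + 3) \<Longrightarrow> chord v w e \<noteq> 0"
    and S0: "realizes v w n S0 E0 T0" and e: "e \<in> polygon_diagonals (n + 3)"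
  shows "chord v w e \<in> cluster_variables n (2*n+3) S0"
proof -
  obtain p q where pq: "e = {p, q}" "p < q" using e by (auto simp: polygon_diagonals_def)
  have "\<exists>S\<in>seeds n (2*n+3) S0. \<exists>E T. realizes v w n S E T \<and> {p, q} \<in> T"
    if "S \<in> seeds n (2*n+3) S0" "realizes v w n S E T" for S E T
    using that
  proof (induction "card {f \<in> T. crossing f {p, q}}" arbitrary: S E T rule: less_induct)
    case less
    show ?case
    proof (cases "{p, q} \<in> T")
      case True
      then show ?thesis using less.prems by blast
    next
      case False
      interpret labelled_polygon n E T by unfold_locales (use less.prems in \<open>simp add: realizes_def\<close>)
      obtain k a c d where fl: "flippable n E T k a p c d" and cr: "crossing {a, c} {p, q}"
        by (rule flip_towards[OF _ False pq(2)]) (use e pq(1) in simp)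
      interpret flippable n E T k a p c d by (rule fl)
      have "\<not> crossing {p, d} {p, q}" by (auto simp: crossing_iff cyc_def)
      then have "{f \<in> T'. crossing f {p, q}} \<subseteq> {f \<in> T. crossing f {p, q}} - {{a, c}}"
        by (auto simp: T'_def)
      moreover have "{a, c} \<in> {f \<in> T. crossing f {p, q}}" using ac cr by simp
      moreover have "finite T"
        using labelled bij_betw_finite by (auto simp: labelled_triangulation_def)
      ultimately have "card {f \<in> T'. crossing f {p, q}} < card {f \<in> T. crossing f {p, q}}"
        by (intro psubset_card_mono) auto
      moreover have "mutate n (2*n+3) k S \<in> seeds n (2*n+3) S0"
        using less.prems k by (simp add: seeds.mutation)
      moreover have "realizes v w n (mutate n (2*n+3) k S) E' T'"
        using realizes_mutate less.prems nz ac T_diagonals by blast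
      ultimately show ?thesis using less.hyps by blast
    qed
  qed
  then obtain S E T where S: "S \<in> seeds n (2*n+3) S0" "realizes v w n S E T" "{p, q} \<in> T"
    using S0 seeds.initial by blast
  then obtain l where l: "l \<in> {1..n}" "E l = {p, q}"
    by (auto simp: realizes_def labelled_triangulation_def bij_betw_def)
  then have "fst S l = chord v w e" using S pq by (auto simp: realizes_def)
  then show ?thesis unfolding cluster_variables_def using S l
    by (intro CollectI exI[of _ "fst S"] exI[of _ "snd S"] exI[of _ l]) simp
qed

lemma cluster_variables_eq:
  assumes nz: "\<And>e. e \<in> polygon_diagonals (n + 3) \<Longrightarrow> chord v w e \<noteq> 0"
    and S0: "realizes v w n S0 E0 T0"
  shows "cluster_variables n (2*n+3) S0 = chord v w ` polygon_diagonals (n + 3)"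
proof (intro equalityI subsetI)
  fix y assume "y \<in> cluster_variables n (2*n+3) S0"
  then obtain x R k where y: "y = x k" "(x, R) \<in> seeds n (2*n+3) S0" "k \<in> {1..n}"
    by (auto simp: cluster_variables_def)
  then obtain E T where ET: "realizes v w n (x, R) E T" using seeds_realized[OF nz S0] by blast
  then interpret labelled_polygon n E T by unfold_locales (simp add: realizes_def)
  have "x k = chord v w (E k)" using ET y(3) by (simp add: realizes_def)
  then show "y \<in> chord v w ` polygon_diagonals (n + 3)"
    using y E_diagonal T_diagonals by blast
next
  fix y assume "y \<in> chord v w ` polygon_diagonals (n + 3)"
  then show "y \<in> cluster_variables n (2*n+3) S0" using diagonal_reached[OF nz S0] by blast
qed

section \<open>Path quivers\<close>

lemma (in labelled_polygon) arrow_tri: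
  assumes "tri a b c"
  shows "arrow (lab {a, b}) (lab {b, c})" "arrow (lab {b, c}) (lab {c, a})" "arrow (lab {c, a}) (lab {a, b})"
  unfolding arrow_def using assms tri_rotate by blast+

text \<open>Diagonal \<open>k\<close> joins \<open>l k\<close> and \<open>r k\<close>; the apices of its two triangles are \<open>p k\<close> towards
  diagonal \<open>k - 1\<close> and \<open>q k\<close> towards diagonal \<open>k + 1\<close>.\<close>

locale path_frame = labelled_polygon +
  fixes l r p q :: "nat \<Rightarrow> nat"
  assumes path: "underlying_path n (Q_T n E T)"
    and E_lr: "k \<in> {1..n} \<Longrightarrow> E k = {l k, r k}"
    and tri_lqr: "k \<in> {1..n} \<Longrightarrow> tri (l k) (q k) (r k)"
    and tri_plr: "k \<in> {1..n} \<Longrightarrow> tri (p k) (l k) (r k)"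
    and frame_step: "1 \<le> k \<Longrightarrow> k < n \<Longrightarrow>
      l (Suc k) = l k \<and> r (Suc k) = q k \<and> p (Suc k) = r k \<or>
      l (Suc k) = q k \<and> r (Suc k) = r k \<and> p (Suc k) = l k"

lemma (in labelled_polygon) path_adjacent:
  assumes path: "underlying_path n (Q_T n E T)"
    and "arrow s t \<or> arrow t s" "s \<in> {1..n}" "t \<in> {1..n}"
  shows "t = Suc s \<or> s = Suc t"
proof -
  have "num_arrows (Q_T n E T) s t + num_arrows (Q_T n E T) t s = (if t = Suc s \<or> s = Suc t then 1 else 0)"
    using path assms(3,4) by (simp add: underlying_path_def)
  then show ?thesis
    using assms(2-4) unfolding num_arrows_Q by (auto split: if_splits)
qed

text \<open>The apex \<open>q\<close> has to point away from \<open>k - 1\<close>. For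
  \<open>k < n\<close> it belongs to the triangle shared with \<open>Suc k\<close>, which cannot
  contain \<open>k - 1\<close> because \<open>k - 1\<close> and \<open>k + 1\<close> are not
  adjacent. For \<open>k = n\<close> one of the two triangles avoiding \<open>n - 1\<close> is
  chosen.\<close>

lemma (in labelled_polygon) path_frame_at:
  assumes path: "underlying_path n (Q_T n E T)" and k: "k \<in> {1..n}"
  shows "\<exists>l q r. E k = {l, r} \<and> tri l q r \<and>
    (k < n \<longrightarrow> E (Suc k) = {l, q} \<or> E (Suc k) = {q, r}) \<and>
    (\<forall>m\<in>{1..n}. Suc m = k \<longrightarrow> E m \<noteq> {l, q} \<and> E m \<noteq> {q, r})"
proof (cases "k < n")
  case True
  then have k': "Suc k \<in> {1..n}" by simp
  have "num_arrows (Q_T n E T) k (Suc k) + num_arrows (Q_T n E T) (Suc k) k = 1"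
    using path k k' by (simp add: underlying_path_def)
  then have "arrow k (Suc k) \<or> arrow (Suc k) k"
    unfolding num_arrows_Q by (rule contrapos_pp) simp
  then have "\<exists>l q r. E k = {l, r} \<and> tri l q r \<and> (E (Suc k) = {l, q} \<or> E (Suc k) = {q, r})"
  proof
    assume "arrow k (Suc k)"
    then obtain a b c where abc: "tri a b c" "k = lab {a, b}" "Suc k = lab {b, c}" by (auto simp: arrow_def)
    then have "E k = {b, a}" "E (Suc k) = {b, c}"
      using E_lab[OF triD(1)[OF abc(1)]] E_lab[OF triD(2)[OF abc(1)]] by (auto simp: insert_commute)
    then show ?thesis using tri_rotate[OF abc(1)] by blast
  next
    assume "arrow (Suc k) k"
    then obtain a b c where abc: "tri a b c" "Suc k = lab {a, b}" "k = lab {b, c}" by (auto simp: arrow_def)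
    then have "E k = {c, b}" "E (Suc k) = {a, b}"
      using E_lab[OF triD(1)[OF abc(1)]] E_lab[OF triD(2)[OF abc(1)]] by (auto simp: insert_commute)
    then show ?thesis using tri_rotate[OF tri_rotate[OF abc(1)]] by blast
  qed
  then obtain l q r where lqr: "E k = {l, r}" "tri l q r" "E (Suc k) = {l, q} \<or> E (Suc k) = {q, r}" by blast
  have "E m \<noteq> {l, q} \<and> E m \<noteq> {q, r}" if m: "m \<in> {1..n}" "Suc m = k" for m
  proof (rule ccontr)
    assume "\<not> ?thesis"
    then have mem: "E m = {l, q} \<or> E m = {q, r}" by blast
    have "E m \<noteq> E (Suc k)" using lab_E[of m] lab_E[of "Suc k"] m k' by force
    moreover have "m = lab (E m)" "Suc k = lab (E (Suc k))" using lab_E m k' by auto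
    ultimately have "arrow m (Suc k) \<or> arrow (Suc k) m"
      using mem lqr(3) arrow_tri(1)[OF lqr(2)] by metis
    then show False using path_adjacent[OF path _ m(1) k'] m by auto
  qed
  then show ?thesis using lqr by blast
next
  case False
  then have kn: "k = n" using k by simp
  obtain a b c d where "flippable n E T k a b c d" using flippable_exists k by blast
  then interpret flippable n E T k a b c d .
  show ?thesis
  proof (cases "\<exists>m\<in>{1..n}. Suc m = k \<and> (E m = {a, b} \<or> E m = {b, c})")
    case False
    then show ?thesis using E_k abc kn by blast
  next
    case True
    then obtain m where m: "Suc m = k" "E m = {a, b} \<or> E m = {b, c}" by blast
    then have "E m \<noteq> {c, d} \<and> E m \<noteq> {d, a}"
      using abcd_distinct by (auto simp: doubleton_eq_iff)
    then have "\<forall>m\<in>{1..n}. Suc m = k \<longrightarrow> E m \<noteq> {c, d} \<and> E m \<noteq> {d, a}" using m by blast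
    moreover have "E k = {c, a}" using E_k by (simp add: insert_commute)
    ultimately show ?thesis using cda kn by blast
  qed
qed

lemma (in labelled_polygon) path_frame_exists:
  assumes path: "underlying_path n (Q_T n E T)"
  obtains l r p q where "path_frame n E T l r p q"
proof -
  obtain l q r where lqr: "\<And>k. k \<in> {1..n} \<Longrightarrow> E k = {l k, r k}" "\<And>k. k \<in> {1..n} \<Longrightarrow> tri (l k) (q k) (r k)"
    "\<And>k. k \<in> {1..n} \<Longrightarrow> k < n \<Longrightarrow> E (Suc k) = {l k, q k} \<or> E (Suc k) = {q k, r k}"
    "\<And>k. k \<in> {1..n} \<Longrightarrow> Suc k \<in> {1..n} \<Longrightarrow> E k \<noteq> {l (Suc k), q (Suc k)} \<and> E k \<noteq> {q (Suc k), r (Suc k)}"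
    using path_frame_at[OF path] by metis
  have "\<exists>p. tri p (l k) (r k)" if "k \<in> {1..n}" for k
  proof -
    have "{l k, r k} \<in> T" using E_diagonal[OF that] lqr(1)[OF that] by simp
    then obtain c where "tri (l k) (r k) c" by (rule tri_exists)
    then show ?thesis using tri_rotate by blast
  qed
  then obtain p where p: "\<And>k. k \<in> {1..n} \<Longrightarrow> tri (p k) (l k) (r k)" by metis
  have "path_frame n E T l r p q"
  proof unfold_locales
    fix k assume k: "1 \<le> k" "k < n"
    then have k1: "k \<in> {1..n}" and k2: "Suc k \<in> {1..n}" by auto
    have tri': "tri (l k) (r k) (p k)" "tri (r k) (l k) (q k)"
      "tri (l (Suc k)) (r (Suc k)) (p (Suc k))" "tri (r (Suc k)) (l (Suc k)) (q (Suc k))"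
      "tri (q k) (r k) (l k)"
      using tri_rotate lqr(2) p k1 k2 by blast+
    note prev = lqr(4)[OF k1 k2, unfolded lqr(1)[OF k1]]
    from lqr(3)[OF k1 k(2)] have "{l (Suc k), r (Suc k)} = {l k, q k} \<or> {l (Suc k), r (Suc k)} = {q k, r k}"
      using lqr(1)[OF k2] by simp
    \<comment> \<open>In the two matchings that reverse the orientation, the triangle ahead of
      \<open>Suc k\<close> would be the one just left and would have \<open>k\<close> as a side,
      against \<open>prev\<close>.\<close>
    then consider "l (Suc k) = l k" "r (Suc k) = q k" | "l (Suc k) = q k" "r (Suc k) = l k"
      | "l (Suc k) = q k" "r (Suc k) = r k" | "l (Suc k) = r k" "r (Suc k) = q k"
      by (auto simp: doubleton_eq_iff)
    then show "l (Suc k) = l k \<and> r (Suc k) = q k \<and> p (Suc k) = r k \<or>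
      l (Suc k) = q k \<and> r (Suc k) = r k \<and> p (Suc k) = l k"
    proof cases
      case 1
      then have "p (Suc k) = r k" using tri_unique tri' lqr(2)[OF k1] by metis
      then show ?thesis using 1 by simp
    next
      case 2
      then have "q (Suc k) = r k" using tri_unique tri' lqr(2)[OF k1] by metis
      then show ?thesis using prev 2 by (auto simp: insert_commute)
    next
      case 3
      then have "p (Suc k) = l k" using tri_unique tri' by metis
      then show ?thesis using 3 by simp
    next
      case 4
      then have "q (Suc k) = l k" using tri_unique tri' by metis
      then show ?thesis using prev 4 by (auto simp: insert_commute)
    qed
  qed (use path lqr p in auto)
  then show ?thesis by (rule that)
qed

context path_frame
begin

section \<open>Labels of the sides around a diagonal\<close>

definition lo :: "nat \<Rightarrow> nat" where "lo k = lab {r k, p k}"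
definition li :: "nat \<Rightarrow> nat" where "li k = lab {p k, l k}"
definition ro :: "nat \<Rightarrow> nat" where "ro k = lab {l k, q k}"
definition ri :: "nat \<Rightarrow> nat" where "ri k = lab {q k, r k}"

lemma frame_edges:
  assumes "k \<in> {1..n}"
  shows "{l k, r k} \<in> edges" "{r k, p k} \<in> edges" "{p k, l k} \<in> edges" "{l k, q k} \<in> edges" "{q k, r k} \<in> edges"
  using triD[OF tri_lqr[OF assms]] triD[OF tri_plr[OF assms]] by (auto simp: insert_commute)

lemma lab_lr: "k \<in> {1..n} \<Longrightarrow> lab {l k, r k} = k"
  using lab_E[of k] E_lr[of k] by simp

lemma sides_distinct:
  assumes k: "k \<in> {1..n}"
  shows "distinct [lo k, li k, ro k, ri k]"
proof -
  have "cyc (p k) (l k) (r k)" "cyc (l k) (q k) (r k)" using triD(4) tri_plr tri_lqr k by auto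
  then have "distinct [{r k, p k}, {p k, l k}, {l k, q k}, {q k, r k}]"
    by (auto simp: doubleton_eq_iff cyc_def)
  then show ?thesis
    using lab_eq_iff frame_edges[OF k] by (simp add: lo_def li_def ro_def ri_def)
qed

lemma arrow_out: "k \<in> {1..n} \<Longrightarrow> arrow k t \<longleftrightarrow> t = lo k \<or> t = ro k"
  using arrow_from[OF tri_plr tri_lqr, of k t] lab_lr by (simp add: lo_def ro_def)

lemma arrow_in: "k \<in> {1..n} \<Longrightarrow> arrow t k \<longleftrightarrow> t = li k \<or> t = ri k"
  using arrow_to[OF tri_plr tri_lqr, of k t] lab_lr by (simp add: li_def ri_def)

lemma sides_adjacent:
  assumes "k \<in> {1..n}" "t \<in> {lo k, li k, ro k, ri k}"
  shows "t = Suc k \<or> k = Suc t \<or> t > n"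
proof (cases "t \<in> {1..n}")
  case True
  then show ?thesis
    using path_adjacent[OF path _ assms(1) True] assms arrow_out[OF assms(1)] arrow_in[OF assms(1)] by blast
next
  case False
  have "t \<in> {1..2*n+3}"
    using assms lab_range frame_edges[OF assms(1)] unfolding lo_def li_def ro_def ri_def by blast
  then show ?thesis using False by auto
qed

lemma labels_step:
  assumes k: "1 \<le> k" "k < n"
  shows "ro k = Suc k \<and> ri k > n \<and> lo (Suc k) = ri k \<and> li (Suc k) = k \<or>
    ri k = Suc k \<and> ro k > n \<and> li (Suc k) = ro k \<and> lo (Suc k) = k"
proof -
  have k1: "k \<in> {1..n}" and k2: "Suc k \<in> {1..n}" using k by auto
  have d: "distinct [lo k, li k, ro k, ri k]" "distinct [lo (Suc k), li (Suc k), ro (Suc k), ri (Suc k)]"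
    using sides_distinct k1 k2 by blast+
  have lr: "lab {r k, l k} = k" using lab_lr[OF k1] by (simp add: insert_commute)
  from frame_step[OF k] show ?thesis
  proof (elim disjE conjE)
    assume *: "l (Suc k) = l k" "r (Suc k) = q k" "p (Suc k) = r k"
    then have "lo (Suc k) = ri k" "li (Suc k) = k" "ro k = Suc k"
      using lr lab_lr[OF k2] by (auto simp: lo_def li_def ri_def ro_def)
    \<comment> \<open>The remaining side of the shared triangle is adjacent to both \<open>k\<close>
      and \<open>Suc k\<close>, which is impossible for a diagonal on the path.\<close>
    moreover have "ri k > n"
      using sides_adjacent[OF k1, of "ri k"] sides_adjacent[OF k2, of "lo (Suc k)"] calculation d by auto
    ultimately show ?thesis by blast
  next
    assume *: "l (Suc k) = q k" "r (Suc k) = r k" "p (Suc k) = l k"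
    then have "li (Suc k) = ro k" "lo (Suc k) = k" "ri k = Suc k"
      using lr lab_lr[OF k1] lab_lr[OF k2] by (auto simp: lo_def li_def ri_def ro_def insert_commute)
    moreover have "ro k > n"
      using sides_adjacent[OF k1, of "ro k"] sides_adjacent[OF k2, of "li (Suc k)"] calculation d by auto
    ultimately show ?thesis by blast
  qed
qed

end

locale nonempty_path_frame = path_frame +
  assumes n: "n \<ge> 1"
begin

sublocale path_labels n lo li ro ri
proof unfold_locales
  fix k assume "k \<in> {1..n}"
  then show "distinct [lo k, li k, ro k, ri k]" by (rule sides_distinct)
next
  fix k assume "1 \<le> k" "k < n"
  then show "ro k = Suc k \<and> ri k > n \<and> lo (Suc k) = ri k \<and> li (Suc k) = k \<or>
    ri k = Suc k \<and> ro k > n \<and> li (Suc k) = ro k \<and> lo (Suc k) = k"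
    by (rule labels_step)
next
  have 1: "1 \<in> {1..n}" using n by simp
  \<comment> \<open>A diagonal on the left of 1 could only be 2, which is already a side of the
    right triangle.\<close>
  have "t > n" if t: "t \<in> {lo 1, li 1}" for t
  proof (rule ccontr)
    assume "\<not> t > n"
    moreover have "t \<in> {1..2*n+3}"
      using t lab_range frame_edges[OF 1] unfolding lo_def li_def by blast
    ultimately have "t = 2" "1 < n" using sides_adjacent[OF 1, of t] t by auto
    then show False using labels_step[of 1] sides_distinct[OF 1] t by auto
  qed
  then show "lo 1 > n" "li 1 > n" by auto
  have nn: "n \<in> {1..n}" using n by simp
  have "t > n" if t: "t \<in> {ro n, ri n}" for t
  proof (rule ccontr)
    assume nt: "\<not> t > n"
    moreover have "t \<in> {1..2*n+3}"
      using t lab_range frame_edges[OF nn] unfolding ro_def ri_def by blast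
    ultimately have "n = Suc t" "1 \<le> t" using sides_adjacent[OF nn, of t] t by auto
    then show False using labels_step[of t] sides_distinct[OF nn] t by auto
  qed
  then show "ro n > n" "ri n > n" by auto
qed

lemma label_ranges:
  assumes "k \<in> {1..n}"
  shows "lo k \<in> {1..2*n+3}" "li k \<in> {1..2*n+3}" "ro k \<in> {1..2*n+3}" "ri k \<in> {1..2*n+3}"
  using lab_range frame_edges[OF assms] unfolding lo_def li_def ro_def ri_def by blast+

text \<open>An arrow with an end in \<open>{i..j}\<close> comes from a triangle having that diagonal
  as a side, so restricting to the subpolygon loses none of these arrows.\<close>

lemma Qbar_sub_arcs:
  assumes ij: "1 \<le> i" "i \<le> j" "j \<le> n"
  shows "arcs (Qbar_sub n E T i j) = path_arcs i j"
proof -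
  have "(s, t) \<in> follows n E (subpolygon n E T i j) \<longleftrightarrow> arrow s t" if "s \<in> {i..j} \<or> t \<in> {i..j}" for s t
  proof -
    have "tri_sides \<tau> \<inter> E ` {i..j} \<noteq> {}" if "(E s, E t) \<in> clockwise \<tau>" for \<tau>
    proof -
      have "E s \<in> tri_sides \<tau>" "E t \<in> tri_sides \<tau>"
        using that by (cases \<tau>; auto simp: clockwise_def tri_sides_def)+
      then show ?thesis using \<open>s \<in> {i..j} \<or> t \<in> {i..j}\<close> by blast
    qed
    then have "\<tau> \<in> subpolygon n E T i j \<longleftrightarrow> \<tau> \<in> triangles (n + 3) T" if "(E s, E t) \<in> clockwise \<tau>" for \<tau>
      using that by (simp add: subpolygon_def)
    then show ?thesis
      unfolding follows_iff[symmetric] follows_def by blast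
  qed
  then have "arcs (Qbar_sub n E T i j) = {(s, t). arrow s t \<and> (s \<in> {i..j} \<or> t \<in> {i..j})}"
    unfolding Qbar_sub_def ice_quiver_of_def by auto
  also have "\<dots> = path_arcs i j"
  proof (intro equalityI subsetI)
    fix \<alpha> assume "\<alpha> \<in> {(s, t). arrow s t \<and> (s \<in> {i..j} \<or> t \<in> {i..j})}"
    then obtain s t where \<alpha>: "\<alpha> = (s, t)" "arrow s t" "s \<in> {i..j} \<or> t \<in> {i..j}" by blast
    from \<alpha>(3) show "\<alpha> \<in> path_arcs i j"
    proof
      assume s: "s \<in> {i..j}"
      then have "t = lo s \<or> t = ro s" using arrow_out[of s t] \<alpha>(2) ij by simp
      then show ?thesis using s \<alpha>(1) unfolding path_arcs_def by blast
    next
      assume t: "t \<in> {i..j}"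
      then have "s = li t \<or> s = ri t" using arrow_in[of t s] \<alpha>(2) ij by simp
      then show ?thesis using t \<alpha>(1) unfolding path_arcs_def by blast
    qed
  next
    fix \<alpha> assume "\<alpha> \<in> path_arcs i j"
    then obtain k where k: "k \<in> {i..j}" "\<alpha> \<in> {(k, lo k), (li k, k), (k, ro k), (ri k, k)}"
      unfolding path_arcs_def by blast
    then have "k \<in> {1..n}" using ij by auto
    then show "\<alpha> \<in> {(s, t). arrow s t \<and> (s \<in> {i..j} \<or> t \<in> {i..j})}"
      using k arrow_out[of k] arrow_in[of k] by auto
  qed
  finally show ?thesis .
qed

lemma third_sides:
  assumes k: "k \<in> {1..n}"
  shows "third_side n E T k (lo k) = li k" "third_side n E T (li k) k = lo k"
    "third_side n E T k (ro k) = ri k" "third_side n E T (ri k) k = ro k"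
proof -
  note plr = tri_plr[OF k] and lqr = tri_lqr[OF k]
  show "third_side n E T k (lo k) = li k"
    using third_side_tri[OF tri_rotate[OF plr]] lab_lr[OF k] by (simp add: lo_def li_def)
  show "third_side n E T (li k) k = lo k"
    using third_side_tri[OF plr] lab_lr[OF k] by (simp add: lo_def li_def)
  show "third_side n E T k (ro k) = ri k"
    using third_side_tri[OF tri_rotate[OF tri_rotate[OF lqr]]] lab_lr[OF k]
    by (simp add: ro_def ri_def insert_commute)
  show "third_side n E T (ri k) k = ro k"
    using third_side_tri[OF tri_rotate[OF lqr]] lab_lr[OF k]
    by (simp add: ro_def ri_def insert_commute)
qed

section \<open>The polynomial obtained from the cuts\<close>

definition cut_poly :: "nat \<Rightarrow> nat \<Rightarrow> int mpoly" where
  "cut_poly i j = cut_sum Var i j"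

lemma sum_max_discrete_Qbar_sub:
  assumes ij: "1 \<le> i" "i \<le> j" "j \<le> n"
  shows "(\<Sum>D \<in> max_discrete (Qbar_sub n E T i j) {i..j}.
      \<Prod>\<alpha> \<in> D. Var (third_side n E T (tail (Qbar_sub n E T i j) \<alpha>) (head (Qbar_sub n E T i j) \<alpha>))) = cut_poly i j"
  unfolding cut_poly_def
proof (rule sum_max_discrete[OF ij Qbar_sub_arcs[OF ij]])
  show "tail (Qbar_sub n E T i j) = fst" "head (Qbar_sub n E T i j) = snd"
    by (simp_all add: Qbar_sub_def ice_quiver_of_def)
  fix k assume "k \<in> {i..j}"
  then have k: "k \<in> {1..n}" using ij by simp
  show "Var (third_side n E T (tail (Qbar_sub n E T i j) (k, lo k)) (head (Qbar_sub n E T i j) (k, lo k))) = Var (li k)"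
    "Var (third_side n E T (tail (Qbar_sub n E T i j) (li k, k)) (head (Qbar_sub n E T i j) (li k, k))) = Var (lo k)"
    "Var (third_side n E T (tail (Qbar_sub n E T i j) (k, ro k)) (head (Qbar_sub n E T i j) (k, ro k))) = Var (ri k)"
    "Var (third_side n E T (tail (Qbar_sub n E T i j) (ri k, k)) (head (Qbar_sub n E T i j) (ri k, k))) = Var (ro k)"
    using third_sides[OF k] by (simp_all add: Qbar_sub_def ice_quiver_of_def)
qed

text \<open>The recursion is built from sums and products only, so it commutes with evaluation, both
  in the field of rational functions and at integer points.\<close>

lemma peval_transfer:
  fixes z :: "nat \<Rightarrow> 'a::comm_ring_1"
  shows "peval of_int z (fst (transfer Var i d)) = fst (transfer z i d) \<and>
    peval of_int z (snd (transfer Var i d)) = snd (transfer z i d)"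
  by (induction d) (simp_all add: peval_add peval_mult Let_def case_prod_beta)

lemma peval_cut_poly: "peval of_int z (cut_poly i j) = cut_sum (z :: nat \<Rightarrow> 'a::comm_ring_1) i j"
  unfolding cut_poly_def cut_sum_def by (simp add: peval_add peval_mult peval_transfer)

lemma cut_poly_in:
  assumes ij: "1 \<le> i" "i \<le> j" "j \<le> n"
  shows "cut_poly i j \<in> polys_in {1..2*n+3}"
proof -
  have tr: "fst (transfer Var i d :: int mpoly \<times> int mpoly) \<in> polys_in {1..2*n+3} \<and>
      snd (transfer Var i d :: int mpoly \<times> int mpoly) \<in> polys_in {1..2*n+3}" if "i + d \<le> n" for d
    using that
  proof (induction d)
    case 0
    then show ?case using label_ranges[of i] ij by simp
  next
    case (Suc d)
    have "i + d \<in> {1..n}" "i + d \<in> {1..2*n+3}" "Suc (i + d) \<in> {1..2*n+3}" using Suc.prems ij by auto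
    moreover obtain a b where "transfer Var i d = (a, b :: int mpoly)" by fastforce
    ultimately show ?case using Suc label_ranges[of "i + d"]
      by (auto simp: Let_def intro!: polys_in_add polys_in_mult polys_in_Var)
  qed
  have "j \<in> {1..n}" using ij by simp
  then show ?thesis
    unfolding cut_poly_def cut_sum_def using tr[of "j - i"] ij label_ranges[of j]
    by (intro polys_in_add polys_in_mult polys_in_Var) auto
qed

lemma Var_not_dvd_cut_poly:
  assumes ij: "1 \<le> i" "i \<le> j" "j \<le> n" and m: "m \<in> {1..n}"
  shows "\<not> Var m dvd cut_poly i j"
proof
  assume "Var m dvd cut_poly i j"
  then obtain h where "cut_poly i j = Var m * h" ..
  moreover define z where "z = (\<lambda>l. if l = m then 0 else (1 :: int))"
  ultimately have "cut_sum z i j = z m * peval of_int z h"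
    using peval_cut_poly[of z i j] by (simp only: peval_mult peval_Var)
  then have "cut_sum z i j = 0" by (simp add: z_def)
  then show False using cut_sum_pos[OF ij, of m] m by (simp add: z_def)
qed

lemma cut_poly_nonzero:
  assumes ij: "1 \<le> i" "i \<le> j" "j \<le> n"
  shows "cut_poly i j \<noteq> 0"
  using Var_not_dvd_cut_poly[OF ij, of i] ij by auto

section \<open>Chords seen from a fixed apex\<close>

lemma cyc_apex:
  assumes "1 \<le> i" "i + d \<le> n"
  shows "cyc (p i) (l (i + d)) (r (i + d))"
  using assms(2)
\<comment> \<open>The next diagonal replaces one end by the apex \<open>q (i + d)\<close>, which
  lies beyond the current diagonal, so \<open>p i\<close> remains behind it.\<close>
proof (induction d)
  case 0
  then show ?case using triD(4)[OF tri_plr[of i]] assms by simp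
next
  case (Suc d)
  then have "cyc (p i) (l (i + d)) (r (i + d))" "cyc (l (i + d)) (q (i + d)) (r (i + d))"
    using triD(4)[OF tri_lqr[of "i + d"]] assms by auto
  then show ?case
    using frame_step[of "i + d"] Suc.prems assms by (auto simp: cyc_def)
qed

context
  fixes x v w :: "nat \<Rightarrow> 'a::field"
  assumes x: "\<And>k. k \<in> {1..2*n+3} \<Longrightarrow> chord v w (E k) = x k"
begin

lemma x_lab: "e \<in> edges \<Longrightarrow> x (lab e) = chord v w e"
  using x[OF lab_range] E_lab by simp

text \<open>This is \<open>ptolemy\<close> for \<open>p i\<close>, \<open>l k\<close>,
  \<open>q k\<close>, \<open>r k\<close>; the factor \<open>x k\<close> is the chord of
  \<open>{l k, r k}\<close>.\<close>

lemma ptolemy_apex: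
  assumes "1 \<le> i" "i \<le> k" "k \<le> n"
  shows "chord v w {p i, q k} * x k = chord v w {p i, l k} * x (ri k) + chord v w {p i, r k} * x (ro k)"
proof -
  have k: "k \<in> {1..n}" using assms by simp
  have "cyc (p i) (l k) (r k)" "cyc (l k) (q k) (r k)"
    using cyc_apex[of i "k - i"] triD(4)[OF tri_lqr[OF k]] assms by auto
  then have "cyc (p i) (l k) (q k)" "cyc (p i) (q k) (r k)" by (auto simp: cyc_def)
  from ptolemy[OF this, of v w] show ?thesis
    using x_lab[OF frame_edges(1)[OF k]] x_lab[OF frame_edges(4)[OF k]] x_lab[OF frame_edges(5)[OF k]] lab_lr[OF k]
    by (simp add: ri_def ro_def insert_commute mult.commute)
qed

text \<open>The first component follows the end \<open>l\<close>, the second the end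
  \<open>r\<close>. The end kept by the next diagonal has an unchanged chord and only gains the
  factor \<open>x k\<close>; the other component is \<open>ptolemy_apex\<close>.\<close>

lemma transfer_chord:
  assumes "1 \<le> i" "i + d \<le> n"
  shows "transfer x i d = (chord v w {p i, l (i + d)} * (\<Prod>k\<in>{i..<i + d}. x k),
    chord v w {p i, r (i + d)} * (\<Prod>k\<in>{i..<i + d}. x k))"
  using assms(2)
proof (induction d)
  case 0
  have i: "i \<in> {1..n}" using assms by simp
  have "x (lo i) = chord v w {p i, r i}" "x (li i) = chord v w {p i, l i}"
    unfolding lo_def li_def using x_lab[OF frame_edges(2)[OF i]] x_lab[OF frame_edges(3)[OF i]]
    by (simp_all add: insert_commute)
  then show ?case by simp
next
  case (Suc d)
  define k where "k = i + d"
  have k: "1 \<le> i" "i \<le> k" "k \<le> n" "1 \<le> k" "k < n" using Suc.prems assms by (auto simp: k_def)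
  have k2: "Suc k \<in> {1..n}" using k by simp
  note pt = ptolemy_apex[OF k(1-3)]
  have IH: "transfer x i d = (chord v w {p i, l k} * (\<Prod>k\<in>{i..<k}. x k), chord v w {p i, r k} * (\<Prod>k\<in>{i..<k}. x k))"
    using Suc by (simp add: k_def)
  define P where "P = (\<Prod>k\<in>{i..<k}. x k)"
  have prod: "(\<Prod>k\<in>{i..<Suc k}. x k) = x k * P"
    using k(2) by (simp add: P_def mult.commute)
  have tr: "transfer x i (Suc d) = (if ro k = Suc k
      then (x k * (chord v w {p i, l k} * P), x (ri k) * (chord v w {p i, l k} * P) + x (Suc k) * (chord v w {p i, r k} * P))
      else (x (Suc k) * (chord v w {p i, l k} * P) + x (ro k) * (chord v w {p i, r k} * P), x k * (chord v w {p i, r k} * P)))"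
    by (simp add: IH Let_def P_def flip: k_def)
  have pt': "chord v w {p i, q k} * (x k * P) = x (ri k) * (chord v w {p i, l k} * P) + x (ro k) * (chord v w {p i, r k} * P)"
    using arg_cong[OF pt, of "\<lambda>t. t * P"] by (simp add: algebra_simps)
  have Suc_k: "i + Suc d = Suc k" by (simp add: k_def)
  from frame_step[OF k(4,5)] show ?case
  proof (elim disjE conjE)
    assume *: "l (Suc k) = l k" "r (Suc k) = q k" "p (Suc k) = r k"
    then have ro: "ro k = Suc k" using lab_lr[OF k2] by (simp add: ro_def)
    then show ?thesis
      unfolding Suc_k prod * tr using pt' by (simp add: ro mult.left_commute)
  next
    assume *: "l (Suc k) = q k" "r (Suc k) = r k" "p (Suc k) = l k"
    then have ri: "ri k = Suc k" using lab_lr[OF k2] by (simp add: ri_def)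
    moreover have "ro k \<noteq> ri k" using sides_distinct[of k] k by simp
    ultimately show ?thesis
      unfolding Suc_k prod * tr using pt' by (simp add: mult.left_commute)
  qed
qed

lemma cut_sum_chord:
  assumes ij: "1 \<le> i" "i \<le> j" "j \<le> n"
  shows "cut_sum x i j = chord v w {p i, q j} * (\<Prod>k = i..j. x k)"
proof -
  have "(\<Prod>k = i..j. x k) = x j * (\<Prod>k\<in>{i..<j}. x k)"
    using ij by (simp add: atLeastLessThanSuc_atLeastAtMost[symmetric] mult.commute)
  moreover have "chord v w {p i, q j} * (x j * (\<Prod>k\<in>{i..<j}. x k)) =
      chord v w {p i, l j} * (\<Prod>k\<in>{i..<j}. x k) * x (ri j) + chord v w {p i, r j} * (\<Prod>k\<in>{i..<j}. x k) * x (ro j)"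
    using arg_cong[OF ptolemy_apex[OF ij], of "\<lambda>t. t * (\<Prod>k\<in>{i..<j}. x k)"]
    by (simp add: algebra_simps)
  ultimately show ?thesis
    using transfer_chord[of i "j - i"] ij unfolding cut_sum_def by simp
qed

end

end

section \<open>The cluster variables of a path quiver\<close>

lemma card_ordered_pairs: "2 * card (SIGMA j:{1..n}. {1..j}) = n * (n + 1)"
proof -
  have "card (SIGMA j:{1..n}. {1..j}) = (\<Sum>j\<in>{1..n}. j)" by simp
  also have "2 * \<dots> = n * (n + 1)" by (induction n) (simp_all add: algebra_simps)
  finally show ?thesis .
qed

lemma card_pairs: "2 * card {{a, b} | a b. a < b \<and> b < (N::nat)} = N * (N - 1)"
proof -
  have "{{a, b} | a b. a < b \<and> b < N} = {B. B \<subseteq> {..<N} \<and> card B = 2}"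
  proof (intro equalityI subsetI)
    fix B assume "B \<in> {B. B \<subseteq> {..<N} \<and> card B = 2}"
    then obtain a b where ab: "B = {a, b}" "a \<noteq> b" "a < N" "b < N" by (auto simp: card_2_iff)
    then have "B = {min a b, max a b}" "min a b < max a b" "max a b < N" by (auto simp: min_def max_def)
    then show "B \<in> {{a, b} | a b. a < b \<and> b < N}" by blast
  qed auto
  then have "card {{a, b} | a b. a < b \<and> b < N} = N choose 2" by (simp add: n_subsets)
  moreover have "even (N * (N - 1))" by (cases N) auto
  ultimately show ?thesis by (simp add: choose_two)
qed

text \<open>Of the (n + 3)(n + 2)/2 pairs of vertices, 2n + 3 are edges. What is left is the number
  of pairs \<open>i <= j\<close> in \<open>{1..n}\<close>; doubling avoids division.\<close>

lemma (in labelled_polygon) card_other_diagonals: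
  "2 * card (polygon_diagonals (n + 3) - T) = n * (n + 1)" "finite (polygon_diagonals (n + 3))"
proof -
  let ?P = "{{a, b} | a b. a < b \<and> b < n + 3}"
  have "?P \<subseteq> Pow {..<n + 3}" by auto
  then have fin: "finite ?P" by (rule finite_subset) simp
  then show "finite (polygon_diagonals (n + 3))" by (simp add: polygon_diagonals_def)
  have sub: "edges \<subseteq> ?P" using edge_pair by blast
  have "polygon_diagonals (n + 3) - T = ?P - edges"
    by (auto simp: polygon_diagonals_def edges_def)
  then have "card (polygon_diagonals (n + 3) - T) = card ?P - card edges"
    using sub fin by (simp add: card_Diff_subset finite_subset)
  moreover have "card edges = 2 * n + 3"
    using bij_betw_same_card[OF E_bij] by simp
  ultimately show "2 * card (polygon_diagonals (n + 3) - T) = n * (n + 1)"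
    using card_pairs[of "n + 3"] by (simp add: algebra_simps)
qed

locale free_path_frame = nonempty_path_frame +
  fixes x v w :: "nat \<Rightarrow> ratfun"
  assumes free: "free_generating (2*n+3) x"
    and chord_E: "k \<in> {1..2*n+3} \<Longrightarrow> chord v w (E k) = x k"
begin

lemma peval_cut_poly_chord:
  assumes "1 \<le> i" "i \<le> j" "j \<le> n"
  shows "peval of_int x (cut_poly i j) = chord v w {p i, q j} * (\<Prod>k = i..j. x k)"
  unfolding peval_cut_poly by (rule cut_sum_chord[OF chord_E assms])

lemma x_nonzero:
  assumes "k \<in> {1..2*n+3}"
  shows "x k \<noteq> 0"
  using peval_eq_0_iff[OF free polys_in_Var[OF assms]] by simp

lemma peval_eq_0: "f \<in> polys_in {1..2*n+3} \<Longrightarrow> peval of_int x f = 0 \<longleftrightarrow> f = 0"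
  by (rule peval_eq_0_iff[OF free])

lemma prod_nonzero:
  assumes "1 \<le> i" "j \<le> n"
  shows "(\<Prod>k = i..j. x k) \<noteq> 0"
proof -
  have "x k \<noteq> 0" if "k \<in> {i..j}" for k using x_nonzero[of k] that assms by simp
  then show ?thesis by simp
qed

lemma prod_Var_in:
  assumes "1 \<le> i" "j \<le> n"
  shows "(\<Prod>k = i..j. Var k) \<in> polys_in {1..2*n+3}"
  using assms by (intro polys_in_prod polys_in_Var) auto

section \<open>Separation of the chords by their denominators\<close>

lemma apex_chord_eq:
  assumes "1 \<le> i" "i \<le> j" "j \<le> n"
  shows "peval of_int x (cut_poly i j) / (\<Prod>k = i..j. x k) = chord v w {p i, q j}"
  using peval_cut_poly_chord[OF assms] prod_nonzero[of i j] assms by simp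

text \<open>Keeping \<open>f\<close> arbitrary serves two purposes: with
  \<open>f = cut_poly i j\<close> it separates the diagonals, and for a competing numerator it gives
  uniqueness in the definite description.\<close>

lemma apex_unique:
  assumes ij: "1 \<le> i" "i \<le> j" "j \<le> n" and ij': "1 \<le> i'" "i' \<le> j'" "j' \<le> n"
    and f: "f \<in> polys_in {1..2*n+3}" "\<And>k. k \<in> {1..n} \<Longrightarrow> \<not> Var k dvd f"
    and eq: "peval of_int x f / (\<Prod>k = i..j. x k) = chord v w {p i', q j'}"
  shows "i' = i" "j' = j" "f = cut_poly i' j'"
proof -
  have "peval of_int x f * (\<Prod>k = i'..j'. x k) = peval of_int x (cut_poly i' j') * (\<Prod>k = i..j. x k)"
    using eq prod_nonzero[of i j] ij ij' unfolding peval_cut_poly_chord[OF ij'] by (simp add: field_simps)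
  then have "peval of_int x (f * (\<Prod>k = i'..j'. Var k)) = peval of_int x (cut_poly i' j' * (\<Prod>k = i..j. Var k))"
    by (simp add: peval_mult peval_prod)
  then have *: "f * (\<Prod>k = i'..j'. Var k) = cut_poly i' j' * (\<Prod>k = i..j. Var k)"
    by (intro peval_inj[OF free] polys_in_mult f cut_poly_in ij' prod_Var_in) (use ij ij' in auto)
  have "{i'..j'} = {i..j}" "f = cut_poly i' j'"
    using prod_Var_cancel[OF *] f(2) Var_not_dvd_cut_poly[OF ij'] ij ij' by auto
  then show "i' = i" "j' = j" "f = cut_poly i' j'" using ij ij' by (auto simp: Icc_eq_Icc)
qed

text \<open>Clearing the denominator would turn \<open>f\<close> into a monomial divisible by
  \<open>Var i\<close>.\<close>

lemma apex_not_edge: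
  assumes ij: "1 \<le> i" "i \<le> j" "j \<le> n" and s: "s \<in> {1..2*n+3}"
    and f: "f \<in> polys_in {1..2*n+3}" "\<And>k. k \<in> {1..n} \<Longrightarrow> \<not> Var k dvd f"
  shows "peval of_int x f / (\<Prod>k = i..j. x k) \<noteq> x s"
proof
  assume "peval of_int x f / (\<Prod>k = i..j. x k) = x s"
  then have "peval of_int x f = x s * (\<Prod>k = i..j. x k)"
    using prod_nonzero[of i j] ij by (simp add: field_simps)
  then have "peval of_int x f = peval of_int x (Var s * (\<Prod>k = i..j. Var k))"
    by (simp add: peval_mult peval_prod)
  then have "f = Var s * (\<Prod>k = i..j. Var k)"
    by (intro peval_inj[OF free] polys_in_mult f prod_Var_in) (use ij s in auto)
  moreover have "Var i dvd (\<Prod>k = i..j. Var k :: int mpoly)"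
    using ij by (intro dvd_prodI) auto
  ultimately show False using f(2)[of i] ij by auto
qed

text \<open>Algebra replaces geometry: a nonzero chord forces \<open>p i\<close> and
  \<open>q j\<close> to differ, and the denominator shows that the pair is not an edge.\<close>

lemma apex_diagonal:
  assumes ij: "1 \<le> i" "i \<le> j" "j \<le> n"
  shows "{p i, q j} \<in> polygon_diagonals (n + 3) - T"
proof -
  have nz: "chord v w {p i, q j} \<noteq> 0"
    using peval_cut_poly_chord[OF ij] peval_eq_0[OF cut_poly_in[OF ij]] cut_poly_nonzero[OF ij] by auto
  then have "p i \<noteq> q j" by auto
  moreover have "p i < n + 3" "q j < n + 3"
    using edge_bounds[OF frame_edges(3)[of i]] edge_bounds[OF frame_edges(4)[of j]] ij by auto
  moreover have "{p i, q j} \<notin> edges"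
  proof
    assume e: "{p i, q j} \<in> edges"
    then have "chord v w {p i, q j} = x (lab {p i, q j})"
      using chord_E[OF lab_range[OF e]] E_lab[OF e] by simp
    then show False
      using apex_not_edge[OF ij lab_range[OF e] cut_poly_in[OF ij] Var_not_dvd_cut_poly[OF ij]]
        apex_chord_eq[OF ij] by simp
  qed
  ultimately show ?thesis using pair_cases[of "p i" "q j"] by (auto simp: edges_def)
qed

text \<open>The diagonals \<open>{p i, q j}\<close> are distinct because their chords have distinct denominators;
  counting shows that there are no others.\<close>

lemma other_diagonals:
  assumes "e \<in> polygon_diagonals (n + 3) - T"
  obtains i j where "1 \<le> i" "i \<le> j" "j \<le> n" "e = {p i, q j}"
proof -
  let ?S = "SIGMA j:{1..n}. {1..j}" and ?f = "\<lambda>(j, i). {p i, q j}"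
  have "inj_on ?f ?S"
  proof (rule inj_onI, clarify)
    fix j i j' i' assume *: "j \<in> {1..n}" "i \<in> {1..j}" "j' \<in> {1..n}" "i' \<in> {1..j'}" and eq: "{p i, q j} = {p i', q j'}"
    then have ij: "1 \<le> i" "i \<le> j" "j \<le> n" and ij': "1 \<le> i'" "i' \<le> j'" "j' \<le> n" by auto
    have "peval of_int x (cut_poly i j) / (\<Prod>k = i..j. x k) = chord v w {p i', q j'}"
      using apex_chord_eq[OF ij] eq by simp
    then have "i' = i \<and> j' = j"
      by (intro conjI apex_unique(1,2)[OF ij ij' cut_poly_in[OF ij]] Var_not_dvd_cut_poly[OF ij])
    then show "j = j' \<and> i = i'" by simp
  qed
  then have "card (?f ` ?S) = card ?S" by (rule card_image)
  then have "card (?f ` ?S) = card (polygon_diagonals (n + 3) - T)"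
    using card_ordered_pairs[of n] card_other_diagonals(1) by linarith
  moreover have "?f ` ?S \<subseteq> polygon_diagonals (n + 3) - T" using apex_diagonal by auto
  ultimately have "?f ` ?S = polygon_diagonals (n + 3) - T"
    using card_other_diagonals(2) by (intro card_subset_eq) auto
  then have "e \<in> ?f ` ?S" using assms by simp
  then obtain j i where "j \<in> {1..n}" "i \<in> {1..j}" "e = {p i, q j}" by blast
  then show ?thesis using that[of i j] by simp
qed

text \<open>This licenses the division in every mutation, as any diagonal may be flipped at some
  seed.\<close>

lemma diagonal_chord_nonzero:
  assumes "e \<in> polygon_diagonals (n + 3)"
  shows "chord v w e \<noteq> 0"
proof (cases "e \<in> T")
  case True
  then have "e \<in> edges" by (simp add: edges_def)
  then show ?thesis using chord_E[OF lab_range] E_lab x_nonzero[OF lab_range] by metis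
next
  case False
  then obtain i j where ij: "1 \<le> i" "i \<le> j" "j \<le> n" and e: "e = {p i, q j}"
    using other_diagonals assms by blast
  then show ?thesis
    using peval_cut_poly_chord[OF ij] peval_eq_0[OF cut_poly_in[OF ij]] cut_poly_nonzero[OF ij] by auto
qed

lemma numerator_eq:
  assumes ij: "1 \<le> i" "i \<le> j" "j \<le> n"
  shows "numerator n (2*n+3) (x, num_arrows (Qbar_T n E T)) i j = cut_poly i j"
proof -
  have "realizes v w n (x, num_arrows (Qbar_T n E T)) E T"
    using labelled chord_E by (simp add: realizes_def)
  then have cv: "cluster_variables n (2*n+3) (x, num_arrows (Qbar_T n E T)) = chord v w ` polygon_diagonals (n + 3)"
    using cluster_variables_eq diagonal_chord_nonzero by blast
  show ?thesis
    unfolding numerator_def fst_conv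
  proof (rule the_equality)
    show "cut_poly i j \<in> polys_in {1..2*n+3} \<and> (\<forall>k\<in>{1..n}. \<not> Var k dvd cut_poly i j) \<and>
        peval of_int x (cut_poly i j) / (\<Prod>k = i..j. x k) \<in>
          cluster_variables n (2*n+3) (x, num_arrows (Qbar_T n E T))"
      using cut_poly_in[OF ij] Var_not_dvd_cut_poly[OF ij] apex_chord_eq[OF ij] apex_diagonal[OF ij]
      unfolding cv by auto
  next
    fix f assume "f \<in> polys_in {1..2*n+3} \<and> (\<forall>k\<in>{1..n}. \<not> Var k dvd f) \<and>
        peval of_int x f / (\<Prod>k = i..j. x k) \<in> cluster_variables n (2*n+3) (x, num_arrows (Qbar_T n E T))"
    then have f: "f \<in> polys_in {1..2*n+3}" "\<And>k. k \<in> {1..n} \<Longrightarrow> \<not> Var k dvd f"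
      and "peval of_int x f / (\<Prod>k = i..j. x k) \<in> chord v w ` polygon_diagonals (n + 3)"
      unfolding cv by auto
    then obtain e where e: "e \<in> polygon_diagonals (n + 3)" "peval of_int x f / (\<Prod>k = i..j. x k) = chord v w e"
      by blast
    \<comment> \<open>A chord in \<open>T\<close> is an initial variable and cannot be such a
      fraction; among the other chords the denominator singles out
      \<open>{p i, q j}\<close>.\<close>
    show "f = cut_poly i j"
    proof (cases "e \<in> T")
      case True
      then have edge: "e \<in> edges" by (simp add: edges_def)
      then have "chord v w e = x (lab e)" using chord_E[OF lab_range[OF edge]] E_lab by simp
      then show ?thesis using apex_not_edge[OF ij lab_range[OF edge] f] e(2) by simp
    next
      case False
      then obtain i' j' where ij': "1 \<le> i'" "i' \<le> j'" "j' \<le> n" and e': "e = {p i', q j'}"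
        using other_diagonals e(1) by blast
      show ?thesis using apex_unique[OF ij ij' f] e(2) e' by simp
    qed
  qed
qed

end

theorem corollary1p4:
  fixes n :: nat and E :: "nat \<Rightarrow> nat set" and T :: "nat set set" and x :: "nat \<Rightarrow> ratfun"
  assumes "n \<ge> 1"
    and "labelled_triangulation n E T"
    and "acyclic_quiver (Q_T n E T)"
    and "underlying_path n (Q_T n E T)"
    and "free_generating (2*n+3) x"
  shows "\<forall>i j. 1 \<le> i \<and> i \<le> j \<and> j \<le> n \<longrightarrow>
    numerator n (2*n+3) (x, num_arrows (Qbar_T n E T)) i j =
      (\<Sum>D \<in> max_discrete (Qbar_sub n E T i j) {i..j}.
         \<Prod>\<alpha> \<in> D. Var (third_side n E T (tail (Qbar_sub n E T i j) \<alpha>) (head (Qbar_sub n E T i j) \<alpha>)))"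
proof -
  interpret labelled_polygon n E T by unfold_locales (fact assms(2))
  obtain l r p q where "path_frame n E T l r p q" using path_frame_exists[OF assms(4)] by blast
  then interpret path_frame n E T l r p q .
  interpret nonempty_path_frame n E T l r p q by unfold_locales (fact assms(1))
  have nz: "x k \<noteq> 0" if "k \<in> {1..2*n+3}" for k
    using peval_eq_0_iff[OF assms(5) polys_in_Var[OF that]] by simp
  \<comment> \<open>The initial variables prescribe the chords of all edges; algebraic independence
    makes them nonzero, as the construction of the vectors requires.\<close>
  obtain v w where vw: "\<And>e. e \<in> edges \<Longrightarrow> chord v w e = x (lab e)"
    using exists_chords[of "\<lambda>e. x (lab e)"] nz lab_range by metis
  interpret free_path_frame n E T l r p q x v w
  proof unfold_locales
    show "chord v w (E k) = x k" if "k \<in> {1..2*n+3}" for k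
      using vw[OF E_edges[OF that]] lab_E[OF that] by simp
  qed (fact assms(5))
  show ?thesis
  proof (intro allI impI, elim conjE)
    fix i j assume ij: "1 \<le> i" "i \<le> j" "j \<le> n"
    show "numerator n (2*n+3) (x, num_arrows (Qbar_T n E T)) i j =
      (\<Sum>D \<in> max_discrete (Qbar_sub n E T i j) {i..j}.
         \<Prod>\<alpha> \<in> D. Var (third_side n E T (tail (Qbar_sub n E T i j) \<alpha>) (head (Qbar_sub n E T i j) \<alpha>)))"
      unfolding numerator_eq[OF ij] sum_max_discrete_Qbar_sub[OF ij] ..
  qed
qed

end
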